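(* Let $F(x,y)\in\mathbb{Z}[x,y]$ be a diagonalizable form of degree $r\geq 6$ with discriminant $\Delta$, and let $h$ be a positive integer. Put $$\Delta'=\frac{|\Delta|}{2^{r^2-r}r^r h^{2r-2}}$$ and assume that $$\Delta' \geq r^{13r^2(r-1)/(r^2-5r-2)}\, h^{4(r-1)(r^2-r+2)/(r^2-5r-2)}.$$ Then $$N_F(h)\leq \begin{cases} 2r+1 & \text{if } D<0,\\ 5 & \text{if } D>0,\ r \text{ is even and } F \text{ is indefinite},\\ 3 & \text{if } D>0,\ r \text{ is odd and } F \text{ is indefinite},\\ 1 & \text{if } D>0 \text{ and } F \text{ is definite}.\end{cases}$$
   Context: A binary form $F(x,y)\in\mathbb{Z}[x,y]$ of degree $r$ is called diagonalizable if it can be written as $F(x,y)=(\alpha x+\beta y)^r-(\gamma x+\delta y)^r$ with (complex) constants $\alpha,\beta,\gamma,\delta$ satisfying $j=\alpha\delta-\beta\gamma\neq 0$. For such a form one can write $(\alpha x+\beta y)(\gamma x+\delta y)=\chi(Ax^2+Bxy+Cy^2)$ with $A,B,C\in\mathbb{Z}$ and a constant $\chi$; put $D=D(F)=B^2-4AC$ (which is nonzero). $F$ is definite if $F(x,y)$ takes values of only one strict sign for real $(x,y)\neq(0,0)$, and indefinite if it takes both signs. A solution $(x,y)\in\mathbb{Z}^2$ is primitive if $\gcd(x,y)=1$. $N_F(h)$ is the number of primitive solutions $(x,y)\in\mathbb{Z}^2$ of $0<|F(x,y)|\leq h$, where $(x,y)$ and $(-x,-y)$ are counted as one solution. *)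

theory Defs
  imports
    "HOL-Computational_Algebra.Fundamental_Theorem_Algebra"
    "HOL-Combinatorics.Permutations"
begin

text \<open>The form $a_0 x^r + a_1 x^{r-1} y + \cdots + a_r y^r$; the values $a_i$ with $i > r$ play
  no role.\<close>

definition binary_form :: "nat \<Rightarrow> (nat \<Rightarrow> int) \<Rightarrow> 'a::comm_ring_1 \<Rightarrow> 'a \<Rightarrow> 'a" where
  "binary_form r a x y = (\<Sum>i\<le>r. of_int (a i) * x ^ (r - i) * y ^ i)"

definition linear_factorization ::
    "nat \<Rightarrow> (nat \<Rightarrow> int) \<Rightarrow> (nat \<Rightarrow> complex) \<Rightarrow> (nat \<Rightarrow> complex) \<Rightarrow> bool" where
  "linear_factorization r a p q \<longleftrightarrow>
     (\<forall>x y. binary_form r a x y = (\<Prod>i<r. p i * x + q i * y))"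

text \<open>The usual discriminant of a binary form, valid also when $a_0 = 0$; for $a_0 \neq 0$ it is
  $a_0^{2r-2} \prod_{i<j} (\theta_i - \theta_j)^2$ with $\theta_i$ the roots of $F(x, 1)$.
  That the description determines it is \<open>linear_factorization_exists\<close>
  and \<open>form_discriminant_eq\<close> below.\<close>

definition form_discriminant :: "nat \<Rightarrow> (nat \<Rightarrow> int) \<Rightarrow> complex" where
  "form_discriminant r a = (THE d. \<exists>p q. linear_factorization r a p q \<and>
     d = (\<Prod>j<r. \<Prod>i<j. (p i * q j - p j * q i)\<^sup>2))"

definition diagonalization ::
    "nat \<Rightarrow> (nat \<Rightarrow> int) \<Rightarrow> complex \<Rightarrow> complex \<Rightarrow> complex \<Rightarrow> complex \<Rightarrow> bool" where
  "diagonalization r a \<alpha> \<beta> \<gamma> \<delta> \<longleftrightarrow> \<alpha> * \<delta> - \<beta> * \<gamma> \<noteq> 0 \<and>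
     (\<forall>x y. binary_form r a x y = (\<alpha> * x + \<beta> * y) ^ r - (\<gamma> * x + \<delta> * y) ^ r)"

definition diagonalizable :: "nat \<Rightarrow> (nat \<Rightarrow> int) \<Rightarrow> bool" where
  "diagonalizable r a \<longleftrightarrow> (\<exists>\<alpha> \<beta> \<gamma> \<delta>. diagonalization r a \<alpha> \<beta> \<gamma> \<delta>)"

text \<open>The integers $A, B, C$ attached to a diagonalizable form. They are not normalized, so
  $D = B^2 - 4AC$ is defined only up to a nonzero rational square factor; only its sign is used.
  They exist for $r \geq 3$: \<open>diagonal_quadratic_exists\<close> below.\<close>

definition diagonal_quadratic :: "nat \<Rightarrow> (nat \<Rightarrow> int) \<Rightarrow> int \<Rightarrow> int \<Rightarrow> int \<Rightarrow> bool" where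
  "diagonal_quadratic r a A B C \<longleftrightarrow>
     (\<exists>\<alpha> \<beta> \<gamma> \<delta> \<chi>. diagonalization r a \<alpha> \<beta> \<gamma> \<delta> \<and>
        (\<forall>x y. (\<alpha> * x + \<beta> * y) * (\<gamma> * x + \<delta> * y) =
           \<chi> * (of_int A * x\<^sup>2 + of_int B * x * y + of_int C * y\<^sup>2)))"

definition definite_form :: "nat \<Rightarrow> (nat \<Rightarrow> int) \<Rightarrow> bool" where
  "definite_form r a \<longleftrightarrow>
     (\<forall>x y :: real. (x, y) \<noteq> (0, 0) \<longrightarrow> binary_form r a x y > 0) \<or>
     (\<forall>x y :: real. (x, y) \<noteq> (0, 0) \<longrightarrow> binary_form r a x y < 0)"

definition indefinite_form :: "nat \<Rightarrow> (nat \<Rightarrow> int) \<Rightarrow> bool" where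
  "indefinite_form r a \<longleftrightarrow>
     (\<exists>x y :: real. binary_form r a x y > 0) \<and> (\<exists>x y :: real. binary_form r a x y < 0)"

text \<open>The set of pairs $\{(x, y), (-x, -y)\}$ of primitive solutions of $0 < |F(x, y)| \leq h$.\<close>

definition primitive_solution_pairs :: "nat \<Rightarrow> (nat \<Rightarrow> int) \<Rightarrow> nat \<Rightarrow> (int \<times> int) set set" where
  "primitive_solution_pairs r a h = {{(x, y), (- x, - y)} | x y.
     coprime x y \<and> 0 < \<bar>binary_form r a x y\<bar> \<and> \<bar>binary_form r a x y\<bar> \<le> int h}"

definition N_F :: "nat \<Rightarrow> (nat \<Rightarrow> int) \<Rightarrow> nat \<Rightarrow> nat" where
  "N_F r a h = card (primitive_solution_pairs r a h)"

lemma prod_linear_poly: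
  fixes P Q :: "nat \<Rightarrow> complex"
  assumes nz: "\<And>i. i < r \<Longrightarrow> P i \<noteq> 0"
  shows "(\<Prod>i<r. [:Q i, P i:]) = smult (\<Prod>i<r. P i) (\<Prod>i<r. [:- (- Q i / P i), 1:])"
proof -
  have "(\<Prod>i<r. [:Q i, P i:]) = (\<Prod>i<r. smult (P i) [:- (- Q i / P i), 1:])"
    by (rule prod.cong) (use nz in auto)
  then show ?thesis by (simp only: prod_smult)
qed

lemma prod_pairs_square:
  fixes f :: "nat \<Rightarrow> nat \<Rightarrow> complex"
  assumes anti: "\<And>i j. i < r \<Longrightarrow> j < r \<Longrightarrow> f j i = - f i j"
  shows "(\<Prod>i<r. \<Prod>j\<in>{..<r} - {i}. f i j) =
    (\<Prod>j<r. \<Prod>i<j. - 1) * (\<Prod>j<r. \<Prod>i<j. (f i j)\<^sup>2)"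
  using anti
proof (induction r)
  case (Suc r)
  have "(\<Prod>i<Suc r. \<Prod>j\<in>{..<Suc r} - {i}. f i j) =
      (\<Prod>i<r. \<Prod>j\<in>{..<Suc r} - {i}. f i j) * (\<Prod>j<r. f r j)"
  proof -
    have "{..<Suc r} - {r} = {..<r}" by auto
    then show ?thesis by simp
  qed
  also have "(\<Prod>i<r. \<Prod>j\<in>{..<Suc r} - {i}. f i j) =
      (\<Prod>i<r. f i r * (\<Prod>j\<in>{..<r} - {i}. f i j))"
  proof (rule prod.cong)
    fix i assume "i \<in> {..<r}"
    then have "{..<Suc r} - {i} = insert r ({..<r} - {i})" by auto
    then show "(\<Prod>j\<in>{..<Suc r} - {i}. f i j) = f i r * (\<Prod>j\<in>{..<r} - {i}. f i j)" by simp
  qed simp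
  also have "\<dots> = (\<Prod>i<r. f i r) * (\<Prod>i<r. \<Prod>j\<in>{..<r} - {i}. f i j)"
    by (rule prod.distrib)
  also have "(\<Prod>i<r. \<Prod>j\<in>{..<r} - {i}. f i j) =
      (\<Prod>j<r. \<Prod>i<j. - 1) * (\<Prod>j<r. \<Prod>i<j. (f i j)\<^sup>2)"
    by (rule Suc.IH) (rule Suc.prems, simp_all)
  also have "(\<Prod>j<r. f r j) = (\<Prod>i<r. - 1 * f i r)"
  proof (rule prod.cong)
    fix i assume "i \<in> {..<r}"
    then have "f r i = - f i r" by (intro Suc.prems) auto
    then show "f r i = - 1 * f i r" by simp
  qed simp
  also have "\<dots> = (\<Prod>i<r. - 1) * (\<Prod>i<r. f i r)"
    by (rule prod.distrib)
  finally show ?case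
    by (simp add: power2_eq_square prod.distrib algebra_simps)
qed simp

lemma prod_linear_discriminant_unique:
  fixes p q p' q' :: "nat \<Rightarrow> complex"
  assumes eq: "\<And>x y. (\<Prod>i<r. p i * x + q i * y) = (\<Prod>i<r. p' i * x + q' i * y)"
  shows "(\<Prod>j<r. \<Prod>i<j. (p i * q j - p j * q i)\<^sup>2) =
    (\<Prod>j<r. \<Prod>i<j. (p' i * q' j - p' j * q' i)\<^sup>2)"
proof -
  have degenerate: "(\<Prod>j<r. \<Prod>i<j. (u i * v j - u j * v i)\<^sup>2) = (if r \<ge> 2 then 0 else 1)"
    if "\<And>t. (\<Prod>i<r. u i + v i * t) = 0" for u v :: "nat \<Rightarrow> complex"
  proof -
    have "(\<Prod>i<r. [:u i, v i:]) = 0"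
      unfolding poly_eq_poly_eq_iff[symmetric] using that by (intro ext) (simp add: poly_prod mult.commute)
    then obtain k where k: "k < r" "u k = 0" "v k = 0" by auto
    show ?thesis
    proof (cases "r \<ge> 2")
      case True
      obtain m where m: "m < r" "m \<noteq> k"
      proof (cases "k = 0")
        case True then show ?thesis using that[of 1] \<open>r \<ge> 2\<close> by auto
      next
        case False then show ?thesis using that[of 0] \<open>r \<ge> 2\<close> by auto
      qed
      have "(\<Prod>i<max k m. (u i * v (max k m) - u (max k m) * v i)\<^sup>2) = 0"
        by (rule prod_zero, simp, rule bexI[of _ "min k m"]) (use k m in \<open>auto simp: max_def min_def\<close>)
      moreover have "max k m < r" using k m by simp
      ultimately have "(\<Prod>j<r. \<Prod>i<j. (u i * v j - u j * v i)\<^sup>2) = 0"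
        by (intro prod_zero) auto
      then show ?thesis using True by simp
    next
      case False
      then have "r = 0 \<or> r = 1" by auto
      then show ?thesis by auto
    qed
  qed
  show ?thesis
  proof (cases "\<forall>t. (\<Prod>i<r. p i + q i * t) = 0")
    case True
    have "(\<Prod>i<r. p' i + q' i * t) = 0" for t
      using eq[of 1 t] True by simp
    then show ?thesis using True degenerate[of p q] degenerate[of p' q'] by simp
  next
    case False
    then obtain t where t: "(\<Prod>i<r. p i + q i * t) \<noteq> 0" by blast
    define P where "P i = p i + q i * t" for i
    define P' where "P' i = p' i + q' i * t" for i
    have c: "(\<Prod>i<r. P i) = (\<Prod>i<r. P' i)"
      using eq[of 1 t] by (simp add: P_def P'_def)
    have P0: "(\<Prod>i<r. P i) \<noteq> 0" using t by (simp only: P_def not_False_eq_True)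
    have P0': "(\<Prod>i<r. P' i) \<noteq> 0" using P0 c by metis
    have nz: "P i \<noteq> 0" "P' i \<noteq> 0" if "i < r" for i
      using P0 P0' that unfolding prod_zero_iff[OF finite_lessThan] by blast+
    define \<theta> where "\<theta> i = - q i / P i" for i
    define \<theta>' where "\<theta>' i = - q' i / P' i" for i
    have polyeq: "(\<Prod>i<r. [:q i, P i:]) = (\<Prod>i<r. [:q' i, P' i:])"
    proof (rule iffD1[OF poly_eq_poly_eq_iff], rule ext)
      fix z
      have "(\<Prod>i<r. q i + z * P i) = (\<Prod>i<r. p i * z + q i * (1 + t * z))"
        by (simp add: P_def algebra_simps)
      also have "\<dots> = (\<Prod>i<r. p' i * z + q' i * (1 + t * z))" by (rule eq)
      also have "\<dots> = (\<Prod>i<r. q' i + z * P' i)"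
        by (simp add: P'_def algebra_simps)
      finally show "poly (\<Prod>i<r. [:q i, P i:]) z = poly (\<Prod>i<r. [:q' i, P' i:]) z"
        by (simp add: poly_prod)
    qed
    have roots: "proots (\<Prod>i<r. [:v i, u i:]) = image_mset (\<lambda>i. - v i / u i) (mset_set {..<r})"
      if "\<And>i. i < r \<Longrightarrow> u i \<noteq> 0" for u v :: "nat \<Rightarrow> complex"
    proof -
      have "proots (\<Prod>i<r. [:v i, u i:]) = proots (\<Prod>i<r. [:- (- v i / u i), 1:])"
        using that by (subst prod_linear_poly) auto
      also have "\<dots> = (\<Sum>i<r. {# - v i / u i #})"
        by (subst proots_prod) (auto intro!: sum.cong simp del: minus_divide_left)
      also have "\<dots> = image_mset (\<lambda>i. - v i / u i) (mset_set {..<r})"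
        by (induction r) (auto simp: lessThan_Suc)
      finally show ?thesis .
    qed
    have "image_mset \<theta> (mset_set {..<r}) = image_mset \<theta>' (mset_set {..<r})"
      using roots[of P q] roots[of P' q'] nz polyeq by (simp add: \<theta>_def[abs_def] \<theta>'_def[abs_def])
    then obtain \<pi> where \<pi>: "\<pi> permutes {..<r}" "\<And>i. i < r \<Longrightarrow> \<theta> i = \<theta>' (\<pi> i)"
      by (rule image_mset_eq_implies_permutes[OF finite_lessThan]) blast
    have expand: "(\<Prod>i<r. \<Prod>j\<in>{..<r} - {i}. u i * u j * (\<tau> i - \<tau> j)) =
        (\<Prod>i<r. u i) ^ (2 * (r - 1)) * (\<Prod>i<r. \<Prod>j\<in>{..<r} - {i}. \<tau> i - \<tau> j)"
      if "(\<Prod>i<r. u i) \<noteq> 0" for u \<tau> :: "nat \<Rightarrow> complex"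
    proof -
      have "(\<Prod>j\<in>{..<r} - {i}. u i * u j * (\<tau> i - \<tau> j)) =
          u i ^ (r - 1) * ((\<Prod>i<r. u i) / u i) * (\<Prod>j\<in>{..<r} - {i}. \<tau> i - \<tau> j)" if "i < r" for i
      proof -
        have "u i \<noteq> 0" using that \<open>(\<Prod>i<r. u i) \<noteq> 0\<close> by auto
        then have "(\<Prod>j\<in>{..<r} - {i}. u j) = (\<Prod>i<r. u i) / u i"
          using that by (subst prod_diff1) auto
        then show ?thesis using that by (simp add: prod.distrib)
      qed
      then have "(\<Prod>i<r. \<Prod>j\<in>{..<r} - {i}. u i * u j * (\<tau> i - \<tau> j)) =
          (\<Prod>i<r. u i ^ (r - 1) * ((\<Prod>i<r. u i) / u i) * (\<Prod>j\<in>{..<r} - {i}. \<tau> i - \<tau> j))"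
        by (intro prod.cong) auto
      also have "\<dots> = (\<Prod>i<r. u i) ^ (r - 1) * ((\<Prod>i<r. u i) ^ r / (\<Prod>i<r. u i)) *
          (\<Prod>i<r. \<Prod>j\<in>{..<r} - {i}. \<tau> i - \<tau> j)"
        by (simp add: prod.distrib prod_dividef prod_power_distrib)
      also have "(\<Prod>i<r. u i) ^ (r - 1) * ((\<Prod>i<r. u i) ^ r / (\<Prod>i<r. u i)) =
          (\<Prod>i<r. u i) ^ (2 * (r - 1))"
        using that by (cases r) (simp_all add: mult_2 power_add)
      finally show ?thesis .
    qed
    have disc: "(\<Prod>i<r. \<Prod>j\<in>{..<r} - {i}. u i * u j * (- (v i) / u i - (- (v j) / u j))) =
        (\<Prod>j<r. \<Prod>i<j. - 1) * (\<Prod>j<r. \<Prod>i<j. (w i * v j - w j * v i)\<^sup>2)"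
      if u: "\<And>i. u i = w i + v i * t" and nz: "\<And>i. i < r \<Longrightarrow> u i \<noteq> 0"
      for u v w :: "nat \<Rightarrow> complex"
    proof -
      have "(\<Prod>i<r. \<Prod>j\<in>{..<r} - {i}. u i * u j * (- (v i) / u i - (- (v j) / u j))) =
          (\<Prod>i<r. \<Prod>j\<in>{..<r} - {i}. w i * v j - w j * v i)"
      proof (intro prod.cong refl)
        fix i j assume "i \<in> {..<r}" "j \<in> {..<r} - {i}"
        then have "u i \<noteq> 0" "u j \<noteq> 0" using nz by auto
        then have "u i * u j * (- (v i) / u i - (- (v j) / u j)) = u i * v j - u j * v i"
          by (simp add: field_simps)
        then show "u i * u j * (- (v i) / u i - (- (v j) / u j)) = w i * v j - w j * v i"
          by (simp add: u algebra_simps)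
      qed
      then show ?thesis by (simp add: prod_pairs_square)
    qed
    have perm: "(\<Prod>i<r. \<Prod>j\<in>{..<r} - {i}. \<theta> i - \<theta> j) =
        (\<Prod>i<r. \<Prod>j\<in>{..<r} - {i}. \<theta>' i - \<theta>' j)"
    proof -
      have "(\<Prod>i<r. \<Prod>j\<in>{..<r} - {i}. \<theta> i - \<theta> j) =
          (\<Prod>i<r. \<Prod>j\<in>{..<r} - {\<pi> i}. \<theta>' (\<pi> i) - \<theta>' j)"
      proof (rule prod.cong[OF refl])
        fix i assume i: "i \<in> {..<r}"
        have "bij_betw \<pi> ({..<r} - {i}) ({..<r} - {\<pi> i})"
          using i by (intro bij_betw_DiffI permutes_imp_bij[OF \<pi>(1)])
            (use permutes_in_image[OF \<pi>(1), of i] in \<open>auto simp: bij_betw_def\<close>)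
        then have "(\<Prod>j\<in>{..<r} - {\<pi> i}. \<theta>' (\<pi> i) - \<theta>' j) =
            (\<Prod>j\<in>{..<r} - {i}. \<theta>' (\<pi> i) - \<theta>' (\<pi> j))"
          by (rule prod.reindex_bij_betw[symmetric])
        also have "\<dots> = (\<Prod>j\<in>{..<r} - {i}. \<theta> i - \<theta> j)"
          using i \<pi>(2) by (intro prod.cong) auto
        finally show "(\<Prod>j\<in>{..<r} - {i}. \<theta> i - \<theta> j) =
            (\<Prod>j\<in>{..<r} - {\<pi> i}. \<theta>' (\<pi> i) - \<theta>' j)" by simp
      qed
      also have "\<dots> = (\<Prod>i<r. \<Prod>j\<in>{..<r} - {i}. \<theta>' i - \<theta>' j)"
        using prod.reindex_bij_betw[OF permutes_imp_bij[OF \<pi>(1)],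
            where g = "\<lambda>k. \<Prod>j\<in>{..<r} - {k}. \<theta>' k - \<theta>' j"] .
      finally show ?thesis .
    qed
    have "(\<Prod>i<r. \<Prod>j\<in>{..<r} - {i}. P i * P j * (\<theta> i - \<theta> j)) =
        (\<Prod>i<r. \<Prod>j\<in>{..<r} - {i}. P' i * P' j * (\<theta>' i - \<theta>' j))"
      by (simp only: expand[OF P0] expand[OF P0'] perm c)
    then have "(\<Prod>j<r. \<Prod>i<j. - 1) * (\<Prod>j<r. \<Prod>i<j. (p i * q j - p j * q i)\<^sup>2) =
        (\<Prod>j<r. \<Prod>i<j. - 1) * (\<Prod>j<r. \<Prod>i<j. (p' i * q' j - p' j * q' i)\<^sup>2)"
      unfolding \<theta>_def \<theta>'_def using disc[of P p q] disc[of P' p' q'] nz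
      by (simp add: P_def P'_def)
    then show ?thesis by simp
  qed
qed

lemma form_discriminant_eq:
  assumes "linear_factorization r a p q"
  shows "form_discriminant r a = (\<Prod>j<r. \<Prod>i<j. (p i * q j - p j * q i)\<^sup>2)"
  unfolding form_discriminant_def
proof (rule the_equality)
  show "\<exists>u v. linear_factorization r a u v \<and>
      (\<Prod>j<r. \<Prod>i<j. (p i * q j - p j * q i)\<^sup>2) = (\<Prod>j<r. \<Prod>i<j. (u i * v j - u j * v i)\<^sup>2)"
    using assms by blast
next
  fix d
  assume "\<exists>u v. linear_factorization r a u v \<and> d = (\<Prod>j<r. \<Prod>i<j. (u i * v j - u j * v i)\<^sup>2)"
  then obtain u v where uv: "linear_factorization r a u v"
    and d: "d = (\<Prod>j<r. \<Prod>i<j. (u i * v j - u j * v i)\<^sup>2)" by blast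
  have "(\<Prod>i<r. u i * x + v i * y) = (\<Prod>i<r. p i * x + q i * y)" for x y
    using uv assms by (simp add: linear_factorization_def)
  then show "d = (\<Prod>j<r. \<Prod>i<j. (p i * q j - p j * q i)\<^sup>2)"
    unfolding d by (rule prod_linear_discriminant_unique)
qed

lemma linear_factorization_exists:
  assumes r: "r \<ge> 1"
  shows "\<exists>p q. linear_factorization r a p q"
proof -
  define G :: "complex poly" where "G = (\<Sum>i\<le>r. monom (of_int (a i)) (r - i))"
  have coeff_r: "coeff G r = of_int (a 0)"
  proof -
    have "coeff G r = (\<Sum>i\<le>r. if i = 0 then of_int (a i) else 0)"
      unfolding G_def coeff_sum using r by (intro sum.cong) auto
    then show ?thesis by simp
  qed
  define n where "n = degree G"
  have n: "n \<le> r"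
    unfolding n_def G_def by (intro degree_sum_le) (auto intro: order.trans[OF degree_monom_le])
  have hom: "binary_form r a x y = y ^ r * poly G (x / y)" if "y \<noteq> 0" for x y :: complex
    unfolding binary_form_def G_def poly_sum poly_monom sum_distrib_left
  proof (rule sum.cong)
    fix i assume "i \<in> {..r}"
    then have "y ^ r = y ^ (r - i) * y ^ i" by (simp flip: power_add)
    then show "of_int (a i) * x ^ (r - i) * y ^ i =
        y ^ r * (of_int (a i) * (x / y) ^ (r - i))"
      using that by (simp add: power_divide)
  qed simp
  obtain \<theta> where \<theta>: "smult (lead_coeff G) (\<Prod>i<n. [:- \<theta> i, 1:]) = G"
    using complex_poly_decompose'[of G] unfolding n_def by blast
  have fact: "binary_form r a x y = lead_coeff G * (y ^ (r - n) * (\<Prod>i<n. x - \<theta> i * y))"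
    for x y :: complex
  proof (cases "y = 0")
    case True
    have "binary_form r a x y = (\<Sum>i\<le>r. if i = 0 then of_int (a i) * x ^ r else 0)"
      unfolding binary_form_def True by (intro sum.cong) auto
    then have "binary_form r a x y = of_int (a 0) * x ^ r" by simp
    moreover have "of_int (a 0) = (if n = r then lead_coeff G else 0)"
      using coeff_r n coeff_eq_0[of G r] by (auto simp: n_def)
    ultimately show ?thesis using True n by auto
  next
    case False
    have "poly G (x / y) = lead_coeff G * (\<Prod>i<n. x / y - \<theta> i)"
      by (subst \<theta>[symmetric]) (simp add: poly_prod)
    then have "binary_form r a x y =
        lead_coeff G * (y ^ (r - n) * (y ^ n * (\<Prod>i<n. x / y - \<theta> i)))"
      using hom[OF False] n by (simp flip: power_add mult.assoc)
    also have "y ^ n * (\<Prod>i<n. x / y - \<theta> i) = (\<Prod>i<n. y * (x / y - \<theta> i))"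
      by (simp add: prod.distrib)
    also have "\<dots> = (\<Prod>i<n. x - \<theta> i * y)"
      using False by (intro prod.cong) (auto simp: field_simps)
    finally show ?thesis .
  qed
  define s where "s i = (if i = (0::nat) then lead_coeff G else 1)" for i
  define p where "p i = s i * (if i < n then 1 else 0)" for i
  define q where "q i = s i * (if i < n then - \<theta> i else 1)" for i
  have "linear_factorization r a p q"
    unfolding linear_factorization_def
  proof (intro allI)
    fix x y :: complex
    have "(\<Prod>i<r. p i * x + q i * y) = (\<Prod>i<r. s i * (if i < n then x - \<theta> i * y else y))"
      by (intro prod.cong) (auto simp: p_def q_def algebra_simps)
    also have "\<dots> = (\<Prod>i<r. s i) * (\<Prod>i<r. if i < n then x - \<theta> i * y else y)"
      by (rule prod.distrib)
    also have "(\<Prod>i<r. s i) = lead_coeff G"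
      using r by (simp add: s_def prod.delta)
    also have "(\<Prod>i<r. if i < n then x - \<theta> i * y else y) =
        (\<Prod>i<n. x - \<theta> i * y) * (\<Prod>i\<in>{n..<r}. y)"
    proof -
      have "{..<r} = {..<n} \<union> {n..<r}" using n by auto
      then have "(\<Prod>i<r. if i < n then x - \<theta> i * y else y) =
          (\<Prod>i<n. if i < n then x - \<theta> i * y else y) *
          (\<Prod>i\<in>{n..<r}. if i < n then x - \<theta> i * y else y)"
        by (simp add: prod.union_disjoint ivl_disj_int)
      then show ?thesis by simp
    qed
    finally show "binary_form r a x y = (\<Prod>i<r. p i * x + q i * y)"
      by (simp add: fact mult_ac)
  qed
  then show ?thesis by blast
qed

lemma diagonalization_coeffs:
  assumes "diagonalization r a \<alpha> \<beta> \<gamma> \<delta>" and i: "i \<le> r"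
  shows "of_int (a i) = of_nat (r choose i) * (\<alpha> ^ (r - i) * \<beta> ^ i - \<gamma> ^ (r - i) * \<delta> ^ i)"
proof -
  define G :: "complex poly" where "G = (\<Sum>i\<le>r. monom (of_int (a i)) i)"
  define H where "H = (\<Sum>i\<le>r. monom (of_nat (r choose i) *
      (\<alpha> ^ (r - i) * \<beta> ^ i - \<gamma> ^ (r - i) * \<delta> ^ i)) i)"
  have "poly G y = poly H y" for y
  proof -
    have "poly G y = binary_form r a 1 y"
      by (simp add: G_def binary_form_def poly_sum poly_monom)
    also have "\<dots> = (\<beta> * y + \<alpha>) ^ r - (\<delta> * y + \<gamma>) ^ r"
      using assms(1) by (simp add: diagonalization_def add.commute)
    also have "\<dots> = poly H y"
      unfolding binomial_ring H_def poly_sum poly_monom sum_subtractf[symmetric]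
      by (intro sum.cong) (auto simp: algebra_simps power_mult_distrib)
    finally show ?thesis .
  qed
  then have "G = H" by (simp add: poly_eq_poly_eq_iff[symmetric] ext)
  then have "coeff G i = coeff H i" by simp
  then show ?thesis using i by (simp add: G_def H_def coeff_sum)
qed

text \<open>The coefficients of a diagonalizable form, divided by the binomial coefficients, satisfy the
  recurrence $A b_{i+2} - B b_{i+1} + C b_i = 0$, where $Ax^2 + Bxy + Cy^2$ is the product of the
  two linear forms; solving it shows that this product is proportional to an integral one.\<close>

lemma diagonal_quadratic_exists:
  assumes r: "r \<ge> 3" and diag: "diagonalizable r a"
  shows "\<exists>A B C. diagonal_quadratic r a A B C"
proof -
  obtain \<alpha> \<beta> \<gamma> \<delta> where d: "diagonalization r a \<alpha> \<beta> \<gamma> \<delta>"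
    using diag by (auto simp: diagonalizable_def)
  define j where "j = \<alpha> * \<delta> - \<beta> * \<gamma>"
  have j: "j \<noteq> 0" using d by (simp add: diagonalization_def j_def)
  define c where "c i = a i * int (fact i * fact (r - i))" for i
  have c: "of_int (c i) = of_nat (fact r) * (\<alpha> ^ (r - i) * \<beta> ^ i - \<gamma> ^ (r - i) * \<delta> ^ i)"
    if "i \<le> r" for i
  proof -
    have "of_nat (fact r) = (of_nat (fact i * fact (r - i) * (r choose i)) :: complex)"
      by (simp only: binomial_fact_lemma[OF that])
    then show ?thesis
      unfolding c_def by (simp add: diagonalization_coeffs[OF d that] mult_ac)
  qed
  have quad: "(\<alpha> * x + \<beta> * y) * (\<gamma> * x + \<delta> * y) =
      \<alpha> * \<gamma> * x\<^sup>2 + (\<alpha> * \<delta> + \<beta> * \<gamma>) * x * y + \<beta> * \<delta> * y\<^sup>2" for x y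
    by (simp add: algebra_simps power2_eq_square)
  have conclude: ?thesis
    if K: "K \<noteq> 0" and A: "of_int A = K * (\<alpha> * \<gamma>)" and B: "of_int B = K * (\<alpha> * \<delta> + \<beta> * \<gamma>)"
      and C: "of_int C = K * (\<beta> * \<delta>)" for K A B C
  proof -
    have "(\<alpha> * x + \<beta> * y) * (\<gamma> * x + \<delta> * y) =
        inverse K * (of_int A * x\<^sup>2 + of_int B * x * y + of_int C * y\<^sup>2)" for x y
      unfolding quad A B C using K by (simp add: field_simps)
    then show ?thesis using d unfolding diagonal_quadratic_def by blast
  qed
  have main: ?thesis if k: "k + 3 \<le> r" and nz: "(\<alpha> * \<gamma>) ^ (r - k - 3) * (\<beta> * \<delta>) ^ k \<noteq> 0" for k
  proof -
    define X where "X = of_nat (fact r) * (\<alpha> ^ (r - k - 3) * \<beta> ^ k)"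
    define Y where "Y = of_nat (fact r) * (\<gamma> ^ (r - k - 3) * \<delta> ^ k)"
    have XY: "X * Y \<noteq> 0"
      using nz by (auto simp: X_def Y_def power_mult_distrib)
    have cc: "of_int (c (k + l)) = X * (\<alpha> ^ (3 - l) * \<beta> ^ l) - Y * (\<gamma> ^ (3 - l) * \<delta> ^ l)"
      if "l \<le> 3" for l
    proof -
      have kl: "r - (k + l) = (r - k - 3) + (3 - l)" using k that by auto
      have "k + l \<le> r" using k that by simp
      then show ?thesis
        unfolding c[OF \<open>k + l \<le> r\<close>] kl X_def Y_def power_add by (simp only: algebra_simps)
    qed
    have c0: "of_int (c k) = X * \<alpha> ^ 3 - Y * \<gamma> ^ 3"
      and c1: "of_int (c (k + 1)) = X * (\<alpha>\<^sup>2 * \<beta>) - Y * (\<gamma>\<^sup>2 * \<delta>)"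
      and c2: "of_int (c (k + 2)) = X * (\<alpha> * \<beta>\<^sup>2) - Y * (\<gamma> * \<delta>\<^sup>2)"
      and c3: "of_int (c (k + 3)) = X * \<beta> ^ 3 - Y * \<delta> ^ 3"
      using cc[of 0] cc[of 1] cc[of 2] cc[of 3] by simp_all
    show ?thesis
    proof (rule conclude[of "- (X * Y * j\<^sup>2)" "c k * c (k + 2) - (c (k + 1))\<^sup>2"
          "c k * c (k + 3) - c (k + 1) * c (k + 2)" "c (k + 1) * c (k + 3) - (c (k + 2))\<^sup>2"])
      show "- (X * Y * j\<^sup>2) \<noteq> 0" using XY j by simp
    qed (simp only: of_int_diff of_int_mult of_int_power c0 c1 c2 c3 j_def, algebra)+
  qed
  show ?thesis
  proof (cases "\<alpha> * \<gamma> = 0")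
    case False
    then show ?thesis using r by (intro main[of 0]) auto
  next
    case ag: True
    show ?thesis
    proof (cases "\<beta> * \<delta> = 0")
      case False
      then show ?thesis using r by (intro main[of "r - 3"]) auto
    next
      case True
      have "\<alpha> * \<delta> + \<beta> * \<gamma> \<noteq> 0"
        using ag True j by (auto simp: j_def)
      then show ?thesis
        using ag True by (intro conclude[of "inverse (\<alpha> * \<delta> + \<beta> * \<gamma>)" 0 1 0]) auto
    qed
  qed
qed

end

theory Submission
  imports Defs "HOL-Number_Theory.Cong" "HOL-Analysis.Analysis"
begin

text \<open>Write $F = u^r - v^r$ with linear forms $u, v$ of determinant $j$. The discriminant hypothesis
  makes $|j|$ large. Since $|u(p) v(q) - u(q) v(p)| \geq |j|$ for distinct solutions $p, q$, at most one
  solution is small. Every other solution makes $v/u$ extremely close to an $r$-th root of unity, and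
  solutions close to the same root satisfy a gap principle: their sizes grow at least like an
  $(r-1)$-st power. Three of them are impossible: feeding the middle one into the diagonal Pade
  approximants of $s^{1/r}$ produces linear combinations of $u$ and $v$ which at the largest one
  are, up to a controlled factor, integer multiples of $j$, but too small to be nonzero; and
  two consecutive approximants cannot both give zero. So there is at most one solution plus two for
  each root of unity that occurs. For $D > 0$ the ratios $v/u$ are real up to a common factor, which
  leaves at most two roots of unity (one for odd $r$) and forces a real zero of $F$ as soon as one
  occurs.\<close>

section \<open>Pade approximation of the $r$-th root\<close>

text \<open>The integrality rests on a symmetry. With s = j/\<mu>, a square root of D, the form and
  its Jacobian with Ax^2 + Bxy + Cy^2 show that 2rs u^r and 2rs v^r are conjugate under s -> -s.
  Swapping the two arguments exchanges the homogenized Pade polynomials P and Q, so their values at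
  conjugate arguments are conjugate too. Hence u(p) v(q) Q - v(p) u(q) P is odd under conjugation,
  and (2rs)^n turns it into j times an integer. This needs integral Pade coefficients; their
  denominators involve only primes dividing r and are cleared by r^(2n). The price is a factor
  |s|^n, and nothing in the hypotheses bounds s directly. Making the quadratic form primitive turns
  4 r^2 D \<mu>^r into a nonzero integer, which bounds |s|^(r-2) by 4 r^2 |j|^r. The gap between the
  two smaller solutions contains this power of |j| and pays for it; hence a contradiction is drawn
  from three solutions near one root rather than from two.\<close>

lemma multiplicity_fact_le:
  assumes p: "prime (p::nat)"
  shows "multiplicity p (fact k) \<le> k"
proof -
  have mult_eq: "multiplicity p i = card {e\<in>{1..k}. p ^ e dvd i}" if "i \<in> {1..k}" for i
  proof -
    have i: "i > 0" "i \<le> k" using that by auto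
    have "{e\<in>{1..k}. p ^ e dvd i} = {1..multiplicity p i}"
    proof (intro set_eqI iffI)
      fix e assume e: "e \<in> {1..multiplicity p i}"
      then have "p ^ e dvd i" by (auto intro: multiplicity_dvd')
      \<comment> \<open>A power p^e dividing i has e < i <= k, so cutting the exponents off at k
        loses nothing.\<close>
      have "e < 2 ^ e" by simp
      also have "2 ^ e \<le> p ^ e" using p prime_ge_2_nat by (simp add: power_mono)
      also have "p ^ e \<le> i" using \<open>p ^ e dvd i\<close> i by (simp add: dvd_imp_le)
      finally have "e < i" .
      with \<open>p ^ e dvd i\<close> show "e \<in> {e\<in>{1..k}. p ^ e dvd i}" using e i by auto
    next
      fix e assume "e \<in> {e\<in>{1..k}. p ^ e dvd i}"
      then show "e \<in> {1..multiplicity p i}"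
        using i p by (auto intro!: multiplicity_geI dest: prime_gt_1_nat)
    qed
    then show ?thesis by simp
  qed
  have cnt: "card {i\<in>{1..k}. m dvd i} \<le> k div m" if "m > 0" for m
  proof -
    have "{i\<in>{1..k}. m dvd i} \<subseteq> (\<lambda>t. m * t) ` {1..k div m}"
    proof
      fix i assume "i \<in> {i\<in>{1..k}. m dvd i}"
      then obtain t where "i = m * t" "1 \<le> i" "i \<le> k" by (auto elim: dvdE)
      then have "t \<le> k div m" "1 \<le> t" using that
        by (auto simp: less_eq_div_iff_mult_less_eq mult.commute intro: Suc_leI)
      then show "i \<in> (\<lambda>t. m * t) ` {1..k div m}" using \<open>i = m * t\<close> by auto
    qed
    then have "card {i\<in>{1..k}. m dvd i} \<le> card ((\<lambda>t. m * t) ` {1..k div m})"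
      by (intro card_mono) auto
    also have "\<dots> \<le> card {1..k div m}" by (rule card_image_le) simp
    finally show ?thesis by simp
  qed
  \<comment> \<open>Legendre's sum of k div p^e is largest for p = 2, where each term is at most
    half of the preceding one; in this form the bound telescopes.\<close>
  have geo: "(\<Sum>e=1..n. k div 2 ^ e) \<le> k - k div 2 ^ n" for n
  proof (induction n)
    case (Suc n)
    have "2 * (k div 2 ^ Suc n) \<le> k div 2 ^ n"
      unfolding power_Suc2 div_mult2_eq by simp
    moreover have "k div 2 ^ n \<le> k" by simp
    ultimately have "(\<Sum>e=1..n. k div 2 ^ e) + k div 2 ^ Suc n \<le> k - k div 2 ^ Suc n"
      using Suc by linarith
    then show ?case by simp
  qed simp
  have "multiplicity p (fact k) = multiplicity p (\<Prod>i=1..k. i)" by (simp add: fact_prod)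
  also have "\<dots> = (\<Sum>i=1..k. multiplicity p i)"
    using p by (intro prime_elem_multiplicity_prod_distrib) auto
  also have "\<dots> = (\<Sum>i=1..k. \<Sum>e=1..k. if p ^ e dvd i then 1 else 0)"
    by (intro sum.cong refl) (simp add: mult_eq sum.If_cases Int_def)
  also have "\<dots> = (\<Sum>e=1..k. \<Sum>i=1..k. if p ^ e dvd i then 1 else 0)"
    by (rule sum.swap)
  also have "\<dots> = (\<Sum>e=1..k. card {i\<in>{1..k}. p ^ e dvd i})"
    by (intro sum.cong refl) (simp add: sum.If_cases Int_def)
  also have "\<dots> \<le> (\<Sum>e=1..k. k div 2 ^ e)"
  proof (rule sum_mono)
    fix e
    have "p \<ge> 2" using p by (rule prime_ge_2_nat)
    then have "card {i\<in>{1..k}. p ^ e dvd i} \<le> k div p ^ e" by (intro cnt) auto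
    also have "\<dots> \<le> k div 2 ^ e"
      using \<open>p \<ge> 2\<close> by (intro div_le_mono2 power_mono) auto
    finally show "card {i\<in>{1..k}. p ^ e dvd i} \<le> k div 2 ^ e" .
  qed
  also have "\<dots> \<le> k" using geo[of k] by simp
  finally show ?thesis .
qed

text \<open>One prime at a time. A prime dividing r occurs at most k times in k!, which r^k covers.
  For any other prime, r is invertible modulo the power of it in k!, so the factors are congruent to
  r times k consecutive integers, whose product k! divides.\<close>

lemma fact_dvd_arith_prod:
  fixes a :: int and r :: nat
  assumes "r > 0"
  shows "fact k dvd int r ^ k * (\<Prod>i<k. a - int r * int i)"
proof (cases "int r ^ k * (\<Prod>i<k. a - int r * int i) = 0")
  case False
  define T where "T = int r ^ k * (\<Prod>i<k. a - int r * int i)"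
  have T: "T \<noteq> 0" using False T_def by simp
  have "(fact k :: int) dvd T"
  proof (rule multiplicity_le_imp_dvd)
    fix p :: int assume p: "prime p"
    then have "p > 1" by (simp add: prime_gt_1_int)
    then obtain p' where p': "p = int p'" by (metis nonneg_int_cases order_less_imp_le zero_less_one order_less_trans)
    then have pp: "prime p'" using p by simp
    show "multiplicity p (fact k) \<le> multiplicity p T"
    proof (cases "p dvd int r")
      case True
      have "p ^ multiplicity p (fact k) dvd fact k" by (rule multiplicity_dvd)
      then have "int (p' ^ multiplicity p (fact k)) dvd int (fact k)" by (simp add: p')
      then have "p' ^ multiplicity p (fact k) dvd fact k" by (simp only: int_dvd_int_iff)
      then have "multiplicity p (fact k) \<le> multiplicity p' (fact k)"
        using prime_gt_1_nat[OF pp] by (intro multiplicity_geI) auto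
      also have "\<dots> \<le> k" by (rule multiplicity_fact_le[OF pp])
      also have "k \<le> multiplicity p T"
      proof (rule multiplicity_geI)
        show "p ^ k dvd T" using True by (simp add: T_def dvd_power_same)
      qed (use T p \<open>p > 1\<close> in auto)
      finally show ?thesis .
    next
      case False
      define N where "N = p ^ multiplicity p (fact k)"
      have "coprime p (int r)" using False p by (simp add: prime_imp_coprime)
      then have cop: "coprime (int r) N" unfolding N_def by (simp add: coprime_commute)
      obtain t where t: "[int r * t = 1] (mod N)"
        using cong_solve_coprime_int[OF cop] by auto
      have "[a - int r * int i = int r * (a * t - int i)] (mod N)" for i
      proof -
        have "[a * 1 - int r * int i = a * (int r * t) - int r * int i] (mod N)"
          using t by (intro cong_diff cong_mult cong_refl) (simp add: cong_sym)
        then show ?thesis by (simp add: algebra_simps)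
      qed
      then have "[(\<Prod>i<k. a - int r * int i) = (\<Prod>i<k. int r * (a * t - int i))] (mod N)"
        by (intro cong_prod) auto
      moreover have "N dvd (\<Prod>i<k. int r * (a * t - int i))"
      proof -
        have "N dvd fact k" unfolding N_def by (rule multiplicity_dvd)
        also have "fact k dvd (\<Prod>i<k. a * t - int i)"
          using gbinomial_int_mult_fact[of k "a * t"] unfolding atLeast0LessThan
          by (intro dvdI) (rule sym)
        finally show ?thesis by (simp add: prod.distrib)
      qed
      ultimately have "N dvd (\<Prod>i<k. a - int r * int i)"
        using cong_dvd_iff by blast
      then have "N dvd T" by (simp add: T_def)
      then show ?thesis unfolding N_def using T p \<open>p > 1\<close> by (intro multiplicity_geI) auto
    qed
  qed simp
  then show ?thesis by (simp add: T_def)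
next
  case True
  show ?thesis unfolding True by simp
qed

section \<open>Divided differences and the vanishing order of the approximation\<close>

text \<open>The sum is the coefficient of degree \<open>card S - 1\<close> in the Lagrange
  interpolation polynomial of f on S. That polynomial is f itself, whose degree is smaller.\<close>

lemma lagrange_divided_difference:
  fixes S :: "'a::field set" and f :: "'a poly"
  assumes fin: "finite S" and deg: "degree f + 1 < card S"
  shows "(\<Sum>x\<in>S. poly f x / (\<Prod>y\<in>S-{x}. x - y)) = 0"
proof -
  define L where "L x = (\<Prod>y\<in>S-{x}. [:-y, 1:])" for x
  define c where "c x = poly f x / (\<Prod>y\<in>S-{x}. x - y)" for x
  define g where "g = f - (\<Sum>x\<in>S. smult (c x) (L x))"
  have L: "degree (L x) = card S - 1" "lead_coeff (L x) = 1" if "x \<in> S" for x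
  proof -
    have "degree (L x) = (\<Sum>y\<in>S-{x}. degree [:-y, 1:])"
      unfolding L_def by (rule degree_prod_eq_sum_degree) auto
    then show "degree (L x) = card S - 1" using that fin by simp
    show "lead_coeff (L x) = 1"
      unfolding L_def lead_coeff_prod by simp
  qed
  have "degree g \<le> card S - 1"
    unfolding g_def using deg L
    by (intro degree_diff_le degree_sum_le fin) (auto intro: order.trans[OF degree_smult_le])
  moreover have "poly g x = 0" if x: "x \<in> S" for x
  proof -
    have "poly (\<Sum>x\<in>S. smult (c x) (L x)) x = (\<Sum>z\<in>S. c z * (\<Prod>y\<in>S-{z}. x - y))"
      by (simp add: poly_sum L_def poly_prod)
    also have "\<dots> = (\<Sum>z\<in>S. if z = x then c x * (\<Prod>y\<in>S-{x}. x - y) else 0)"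
      using x fin by (intro sum.cong refl) (auto intro!: prod_zero)
    also have "\<dots> = c x * (\<Prod>y\<in>S-{x}. x - y)" using x fin by simp
    also have "\<dots> = poly f x" using fin by (simp add: c_def)
    finally show ?thesis by (simp add: g_def)
  qed
  then have "S \<subseteq> {x. poly g x = 0}" by auto
  ultimately have "g = 0"
    using fin deg card_mono[OF poly_roots_finite[of g], of S] card_poly_roots_bound[of g]
    by (cases "g = 0") auto
  then have "coeff f (card S - 1) = coeff (\<Sum>x\<in>S. smult (c x) (L x)) (card S - 1)"
    by (simp add: g_def)
  also have "\<dots> = (\<Sum>x\<in>S. c x)"
    using L by (auto simp: coeff_sum intro!: sum.cong)
  finally show ?thesis using deg by (simp add: c_def coeff_eq_0)
qed

text \<open>The shift c is 0 for differences inside one family of exponents and -1/r for differences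
  between the families rk and rk + 1.\<close>

lemma prod_diff_below: "(\<Prod>j<k. real k - real j + c) = pochhammer (1 + c) k"
proof -
  have "(\<Prod>j<k. real k - real j + c) = (\<Prod>j<k. 1 + c + real (k - Suc j))"
    by (intro prod.cong refl) (auto simp: of_nat_diff)
  also have "\<dots> = (\<Prod>j<k. 1 + c + real j)"
    by (rule prod.nat_diff_reindex)
  finally show ?thesis by (simp add: pochhammer_prod atLeast0LessThan)
qed

lemma prod_diff_above:
  assumes "k \<le> n"
  shows "(\<Prod>j\<in>{k<..n}. real k - real j + c) = (-1) ^ (n - k) * pochhammer (1 - c) (n - k)"
proof -
  have "(\<Prod>j\<in>{k<..n}. real k - real j + c) = (\<Prod>i<n-k. (-1) * (1 - c + real i))"
    by (rule prod.reindex_bij_witness[of _ "\<lambda>i. k + 1 + i" "\<lambda>j. j - k - 1"])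
      (use assms in \<open>auto simp: of_nat_diff\<close>)
  then show ?thesis unfolding prod.distrib by (simp add: pochhammer_prod atLeast0LessThan)
qed

text \<open>Coefficients of the hypergeometric numerator of the diagonal Pade approximant of
  s^(1/r), a Jacobi polynomial with parameters -1/r and 1/r in another variable. The power of r
  makes them integers.\<close>

definition pade_coeff :: "nat \<Rightarrow> nat \<Rightarrow> nat \<Rightarrow> real" where
  "pade_coeff r n k = real r ^ (2 * n) *
     (((real n + 1 / real r) gchoose k) * ((real n - 1 / real r) gchoose (n - k)))"

text \<open>One r^k clears the denominators of the k factors, the other is the r^k with which
  \<open>fact_dvd_arith_prod\<close> absorbs k!.\<close>

lemma gchoose_denominator:
  assumes "r > 0"
  shows "real r ^ (2 * k) * ((of_int a / real r) gchoose k) \<in> \<int>"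
proof -
  obtain t where t: "int r ^ k * (\<Prod>i<k. a - int r * int i) = fact k * t"
    using fact_dvd_arith_prod[OF assms, of k a] by (auto elim: dvdE)
  have "real r ^ k * (\<Prod>i<k. of_int a / real r - real i) = (\<Prod>i<k. real r * (of_int a / real r - real i))"
    by (simp add: prod.distrib)
  also have "\<dots> = (\<Prod>i<k. of_int (a - int r * int i))"
    using assms by (intro prod.cong refl) (simp add: field_simps)
  finally have "real r ^ (2 * k) * (\<Prod>i<k. of_int a / real r - real i) =
      of_int (int r ^ k * (\<Prod>i<k. a - int r * int i))"
    by (simp add: mult_2 power_add)
  also have "\<dots> = fact k * of_int t" unfolding t by simp
  finally have "real r ^ (2 * k) * ((of_int a / real r) gchoose k) = of_int t"
    by (simp add: gbinomial_prod_rev atLeast0LessThan field_simps)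
  then show ?thesis by simp
qed

lemma pade_coeff_Ints:
  assumes "r > 0" "k \<le> n"
  shows "pade_coeff r n k \<in> \<int>"
proof -
  have 1: "real n + 1 / real r = of_int (int (r * n) + 1) / real r"
    "real n - 1 / real r = of_int (int (r * n) - 1) / real r"
    using assms by (simp_all add: field_simps)
  have "2 * n = 2 * k + 2 * (n - k)" using assms by simp
  then have p: "real r ^ (2 * n) = real r ^ (2 * k) * real r ^ (2 * (n - k))"
    by (simp only: power_add)
  have "pade_coeff r n k =
      (real r ^ (2 * k) * ((of_int (int (r * n) + 1) / real r) gchoose k)) *
      (real r ^ (2 * (n - k)) * ((of_int (int (r * n) - 1) / real r) gchoose (n - k)))"
    unfolding pade_coeff_def 1 p by (simp only: mult_ac)
  then show ?thesis
    using gchoose_denominator[OF assms(1)] by (metis Ints_mult)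
qed

text \<open>Positivity turns sums of absolute values into plain sums and excludes cancellation in
  the determinant at 0.\<close>

lemma pade_coeff_pos:
  assumes "r \<ge> 2" "k \<le> n"
  shows "pade_coeff r n k > 0"
proof -
  have "1 / real r < 1" "1 / real r > 0" using assms by auto
  have "real n + 1 / real r - real i > 0" if "i < k" for i
    using that assms \<open>1 / real r > 0\<close> by linarith
  moreover have "real n - 1 / real r - real i > 0" if "i < n - k" for i
  proof -
    have "real i + 1 \<le> real n" using that by linarith
    then show ?thesis using \<open>1 / real r < 1\<close> by linarith
  qed
  ultimately have "(real n + 1 / real r) gchoose k > 0" "(real n - 1 / real r) gchoose (n - k) > 0"
    unfolding gbinomial_prod_rev by (intro divide_pos_pos prod_pos ballI; simp)+
  then show ?thesis using assms by (simp add: pade_coeff_def)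
qed

text \<open>This is the value of the polynomial at 1. In Vandermonde's identity the shifts 1/r and
  -1/r cancel and leave a central binomial coefficient.\<close>

lemma pade_coeff_sum:
  assumes "r > 0"
  shows "(\<Sum>k\<le>n. pade_coeff r n k) \<le> (4 * real r ^ 2) ^ n"
proof -
  have "(\<Sum>k\<le>n. pade_coeff r n k) = real r ^ (2 * n) *
      (\<Sum>k=0..n. ((real n + 1 / real r) gchoose k) * ((real n - 1 / real r) gchoose (n - k)))"
    by (simp add: pade_coeff_def sum_distrib_left atLeast0AtMost)
  also have "\<dots> = real r ^ (2 * n) * (real (2 * n) gchoose n)"
    by (subst gbinomial_Vandermonde) simp
  also have "real (2 * n) gchoose n = real ((2 * n) choose n)"
    by (rule binomial_gbinomial[symmetric])
  also have "real r ^ (2 * n) * real ((2 * n) choose n) \<le> real r ^ (2 * n) * real (2 ^ (2 * n))"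
    by (intro mult_left_mono of_nat_mono binomial_le_pow2) simp
  also have "real (2 ^ (2 * n)) = 2 ^ (2 * n)" by simp
  finally have "(\<Sum>k\<le>n. pade_coeff r n k) \<le> real r ^ (2 * n) * 2 ^ (2 * n)" .
  also have "\<dots> = (4 * real r ^ 2) ^ n" by (simp add: power_mult_distrib flip: power_mult) (simp add: power_mult)
  finally show ?thesis .
qed

lemma sum_reflect: "(\<Sum>k\<le>n. g (n - k)) = (\<Sum>k\<le>n. g k)" for g :: "nat \<Rightarrow> 'a::comm_monoid_add"
  by (rule sum.reindex_bij_witness[of _ "\<lambda>k. n - k" "\<lambda>k. n - k"]) auto

text \<open>Up to a common factor the coefficients of both polynomials of the approximation are the weights
  of the divided difference over the exponents $rk$ and $rk + 1$ with $k \leq n$. This is what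
  makes the remainder vanish to order $2n+1$.\<close>

definition pade_weight :: "nat \<Rightarrow> nat \<Rightarrow> nat \<Rightarrow> real" where
  "pade_weight r n k = (\<Prod>j\<in>{..n}-{k}. real (r * k) - real (r * j)) *
     (\<Prod>j\<le>n. real (r * k) - real (r * j + 1))"

text \<open>The exponent 4n collects 2n from \<open>pade_coeff\<close>, n from the differences
  within a family and n + 1 from those between the families, less one because the difference -1/r at
  equal index cancels a factor r.\<close>

definition pade_const :: "nat \<Rightarrow> nat \<Rightarrow> real" where
  "pade_const r n = real r ^ (4 * n) * (pochhammer (1 + 1 / real r) n * pochhammer (1 - 1 / real r) n)"

lemma pade_coeff_weight:
  assumes r: "r > 0" and k: "k \<le> n"
  shows "pade_coeff r n k * pade_weight r n k = - pade_const r n"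
proof -
  define \<nu> where "\<nu> = 1 / real r"
  have rn: "real r * \<nu> = 1" "\<nu> * real r = 1" using r by (simp_all add: \<nu>_def)
  have d: "{..n} - {k} = {..<k} \<union> {k<..n}" "{..n} = insert k ({..<k} \<union> {k<..n})" using k by auto
  have c: "card ({..n} - {k}) = n" using k by simp
  have A: "(\<Prod>j\<in>{..n}-{k}. real (r * k) - real (r * j)) =
      real r ^ n * ((-1) ^ (n - k) * (fact k * fact (n - k)))"
  proof -
    have "(\<Prod>j\<in>{..n}-{k}. real (r * k) - real (r * j)) =
        (\<Prod>j\<in>{..n}-{k}. real r * (real k - real j))"
      by (intro prod.cong refl) (simp add: algebra_simps)
    also have "\<dots> = real r ^ n * (\<Prod>j\<in>{..n}-{k}. real k - real j)"
      unfolding prod.distrib by (simp add: c)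
    also have "(\<Prod>j\<in>{..n}-{k}. real k - real j) = (-1) ^ (n - k) * (fact k * fact (n - k))"
      unfolding d(1) using prod_diff_below[of k 0] prod_diff_above[OF k, of 0]
      by (subst prod.union_disjoint) (auto simp: pochhammer_fact)
    finally show ?thesis .
  qed
  have B: "(\<Prod>j\<le>n. real (r * k) - real (r * j + 1)) =
      real r ^ n * (- ((-1) ^ (n - k) * (pochhammer (1 - \<nu>) k * pochhammer (1 + \<nu>) (n - k))))"
  proof -
    have "(\<Prod>j\<le>n. real (r * k) - real (r * j + 1)) = (\<Prod>j\<le>n. real r * (real k - real j + - \<nu>))"
      by (intro prod.cong refl) (simp add: algebra_simps rn)
    also have "\<dots> = real r ^ Suc n * (\<Prod>j\<le>n. (real k - real j + - \<nu>))"
      unfolding prod.distrib by simp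
    also have "(\<Prod>j\<le>n. (real k - real j + - \<nu>)) =
        - \<nu> * ((\<Prod>j<k. (real k - real j + - \<nu>)) * (\<Prod>j\<in>{k<..n}. (real k - real j + - \<nu>)))"
      unfolding d(2) by (subst prod.insert, simp, simp, subst prod.union_disjoint) auto
    also have "\<dots> = - \<nu> * (pochhammer (1 - \<nu>) k * ((-1) ^ (n - k) * pochhammer (1 + \<nu>) (n - k)))"
      unfolding prod_diff_below prod_diff_above[OF k] by simp
    finally have "(\<Prod>j\<le>n. real (r * k) - real (r * j + 1)) = real r ^ n * (- ((real r * \<nu>) *
        ((-1) ^ (n - k) * (pochhammer (1 - \<nu>) k * pochhammer (1 + \<nu>) (n - k)))))"
      by (simp add: mult_ac)
    then show ?thesis unfolding rn by simp
  qed
  have C: "((real n + \<nu>) gchoose k) * fact k * pochhammer (1 + \<nu>) (n - k) = pochhammer (1 + \<nu>) n"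
  proof -
    have "((real n + \<nu>) gchoose k) * fact k = pochhammer (1 + \<nu> + real (n - k)) k"
      using k by (simp add: gbinomial_pochhammer' of_nat_diff algebra_simps)
    then show ?thesis
      using pochhammer_product[of "n - k" n "1 + \<nu>"] k by (simp add: mult.commute)
  qed
  have E: "((real n - \<nu>) gchoose (n - k)) * fact (n - k) * pochhammer (1 - \<nu>) k = pochhammer (1 - \<nu>) n"
  proof -
    have "((real n - \<nu>) gchoose (n - k)) * fact (n - k) = pochhammer (1 - \<nu> + real k) (n - k)"
      using k by (simp add: gbinomial_pochhammer' of_nat_diff algebra_simps)
    then show ?thesis
      using pochhammer_product[of k n "1 - \<nu>"] k by (simp add: mult.commute)
  qed
  have sq: "(-1) ^ (n - k) * ((-1::real) ^ (n - k)) = 1" by (simp flip: power_add)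
  have "pade_coeff r n k * pade_weight r n k = - (real r ^ (2*n) * real r ^ n * real r ^ n *
      ((-1) ^ (n - k) * (-1) ^ (n - k)) *
      (((real n + \<nu>) gchoose k) * fact k * pochhammer (1 + \<nu>) (n - k)) *
      (((real n - \<nu>) gchoose (n - k)) * fact (n - k) * pochhammer (1 - \<nu>) k))"
    unfolding pade_coeff_def pade_weight_def A B \<nu>_def by (simp only: mult_minus_right mult_ac)
  also have "\<dots> = - (real r ^ (2*n) * real r ^ n * real r ^ n *
      pochhammer (1 + \<nu>) n * pochhammer (1 - \<nu>) n)" unfolding C E sq by simp
  also have "real r ^ (2*n) * real r ^ n * real r ^ n = real r ^ (4 * n)" by (simp flip: power_add)
  finally show ?thesis by (simp add: pade_const_def \<nu>_def mult.assoc)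
qed

text \<open>The reflection x -> rn + 1 - x exchanges the two families of exponents and changes the
  sign of all 2n + 1 differences.\<close>

lemma pade_weight_reflect:
  assumes k: "k \<le> n"
  shows "(\<Prod>j\<in>{..n}-{k}. real (r * k + 1) - real (r * j + 1)) *
     (\<Prod>j\<le>n. real (r * k + 1) - real (r * j)) = - pade_weight r n (n - k)"
proof -
  have "(\<Prod>j\<in>{..n}-{k}. real (r * k + 1) - real (r * j + 1)) =
      (\<Prod>j\<in>{..n}-{n-k}. (-1) * (real (r * (n - k)) - real (r * j)))"
    by (rule prod.reindex_bij_witness[of _ "\<lambda>j. n - j" "\<lambda>j. n - j"])
      (use k in \<open>auto simp: of_nat_diff algebra_simps\<close>)
  moreover have "(\<Prod>j\<le>n. real (r * k + 1) - real (r * j)) =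
      (\<Prod>j\<le>n. (-1) * (real (r * (n - k)) - real (r * j + 1)))"
    by (rule prod.reindex_bij_witness[of _ "\<lambda>j. n - j" "\<lambda>j. n - j"])
      (use k in \<open>auto simp: of_nat_diff algebra_simps\<close>)
  moreover have "card ({..n} - {n - k}) = n" by simp
  ultimately show ?thesis
    unfolding pade_weight_def prod.distrib prod_constant by simp
qed

text \<open>The 2n + 2 exponents are distinct, so the divided difference of f over them is 0. By
  \<open>pade_coeff_weight\<close> and \<open>pade_weight_reflect\<close> its weights are
  proportional to the coefficients, with opposite signs on the two families.\<close>

lemma pade_vanishing:
  fixes f :: "real poly"
  assumes r: "r \<ge> 2" and f: "degree f \<le> 2 * n"
  shows "(\<Sum>k\<le>n. pade_coeff r n (n - k) * poly f (real (r * k + 1))) =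
    (\<Sum>k\<le>n. pade_coeff r n k * poly f (real (r * k)))"
proof -
  define e where "e k = real (r * k)" for k
  define o' where "o' k = real (r * k + 1)" for k
  have e_eq: "e i = e j \<longleftrightarrow> i = j" and o_eq: "o' i = o' j \<longleftrightarrow> i = j" for i j
    using r by (auto simp: e_def o'_def)
  then have inj: "inj_on e X" "inj_on o' X" for X
    by (auto simp: inj_on_def)
  have ne: "e i \<noteq> o' j" for i j
  proof
    assume "e i = o' j"
    then have "r * i = r * j + 1" unfolding e_def o'_def of_nat_eq_iff .
    then have "r dvd 1" by (metis dvd_add_right_iff dvd_triv_left)
    then show False using r by simp
  qed
  have ne': "o' j \<noteq> e i" for i j using ne[of i j] by metis
  define S where "S = e ` {..n} \<union> o' ` {..n}"
  have disj: "e ` X \<inter> o' ` Y = {}" "o' ` X \<inter> e ` Y = {}" for X Y using ne ne' by auto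
  have fin: "finite S" by (simp add: S_def)
  have "card S = 2 * n + 2"
    unfolding S_def using inj disj by (subst card_Un_disjoint) (auto simp: card_image)
  then have zero: "(\<Sum>x\<in>S. poly f x / (\<Prod>y\<in>S-{x}. x - y)) = 0"
    using f by (intro lagrange_divided_difference fin) auto
  have sumS: "(\<Sum>x\<in>S. g x) = (\<Sum>k\<le>n. g (e k)) + (\<Sum>k\<le>n. g (o' k))" for g :: "real \<Rightarrow> real"
    unfolding S_def using disj inj by (simp add: sum.union_disjoint sum.reindex)
  have K: "pade_const r n \<noteq> 0"
  proof -
    have "1 / real r < 1" using r by simp
    then have "1 + 1 / real r > 0" "1 - 1 / real r > 0" by (simp_all add: add_pos_nonneg)
    then have "pade_const r n > 0"
      unfolding pade_const_def using r by (intro mult_pos_pos pochhammer_pos) auto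
    then show ?thesis by simp
  qed
  have we: "(\<Prod>y\<in>S-{e k}. e k - y) = pade_weight r n k" if "k \<le> n" for k
  proof -
    have "S - {e k} = e ` ({..n} - {k}) \<union> o' ` {..n}"
      using ne ne' by (auto simp: S_def e_eq)
    then have "(\<Prod>y\<in>S-{e k}. e k - y) =
        (\<Prod>j\<in>{..n}-{k}. e k - e j) * (\<Prod>j\<le>n. e k - o' j)"
      using inj disj by (simp add: prod.union_disjoint prod.reindex)
    then show ?thesis by (simp only: pade_weight_def e_def o'_def)
  qed
  have wo: "(\<Prod>y\<in>S-{o' k}. o' k - y) = - pade_weight r n (n - k)" if "k \<le> n" for k
  proof -
    have "S - {o' k} = o' ` ({..n} - {k}) \<union> e ` {..n}"
      using ne ne' by (auto simp: S_def o_eq)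
    then have "(\<Prod>y\<in>S-{o' k}. o' k - y) =
        (\<Prod>j\<in>{..n}-{k}. o' k - o' j) * (\<Prod>j\<le>n. o' k - e j)"
      using inj disj by (simp add: prod.union_disjoint prod.reindex)
    then show ?thesis using pade_weight_reflect[OF that] by (simp only: e_def o'_def)
  qed
  have w: "1 / pade_weight r n k = - pade_coeff r n k / pade_const r n" if "k \<le> n" for k
  proof -
    have "pade_weight r n k \<noteq> 0" using pade_coeff_weight[of r k n] r that K by auto
    then show ?thesis using pade_coeff_weight[of r k n] r that K by (simp add: field_simps)
  qed
  have "0 = (\<Sum>k\<le>n. poly f (e k) / pade_weight r n k) +
      (\<Sum>k\<le>n. poly f (o' k) / (- pade_weight r n (n - k)))"
    using zero unfolding sumS by (simp add: we wo)
  also have "\<dots> = (\<Sum>k\<le>n. poly f (e k) * (- pade_coeff r n k / pade_const r n)) +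
      (\<Sum>k\<le>n. poly f (o' k) * (pade_coeff r n (n - k) / pade_const r n))"
  proof (intro arg_cong2[of _ _ _ _ "(+)"] sum.cong refl)
    fix k assume "k \<in> {..n}"
    then show "poly f (e k) / pade_weight r n k = poly f (e k) * (- pade_coeff r n k / pade_const r n)"
      using w[of k] by (metis atMost_iff divide_inverse inverse_eq_divide)
    have "poly f (o' k) / - pade_weight r n (n - k) = poly f (o' k) * - (1 / pade_weight r n (n - k))"
      by simp
    then show "poly f (o' k) / - pade_weight r n (n - k) =
        poly f (o' k) * (pade_coeff r n (n - k) / pade_const r n)"
      using w[of "n - k"] by simp
  qed
  also have "\<dots> = ((\<Sum>k\<le>n. pade_coeff r n (n - k) * poly f (o' k)) -
      (\<Sum>k\<le>n. pade_coeff r n k * poly f (e k))) / pade_const r n"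
    by (simp add: diff_divide_distrib sum_divide_distrib sum_negf mult.commute)
  finally show ?thesis using K unfolding e_def o'_def by (simp del: of_nat_mult of_nat_add)
qed

text \<open>The case of the polynomial x choose i. The two sides are the coefficients of t^i in
  (1+t) Q((1+t)^r) and in P((1+t)^r), where Q is \<open>pade_Q r n\<close> and P is
  \<open>pade_P r n\<close>.\<close>

lemma pade_vanishing_choose:
  assumes r: "r \<ge> 2" and i: "i \<le> 2 * n"
  shows "(\<Sum>k\<le>n. pade_coeff r n (n - k) * real ((r * k + 1) choose i)) =
    (\<Sum>k\<le>n. pade_coeff r n k * real ((r * k) choose i))"
proof -
  define f where "f = smult (1 / fact i) (\<Prod>l<i. [:- real l, 1:])"
  have "degree (\<Prod>l<i. [:- real l, 1:]) = (\<Sum>l<i. degree [:- real l, 1:])"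
    by (rule degree_prod_eq_sum_degree) auto
  then have "degree f \<le> 2 * n" using i by (simp add: f_def)
  moreover have "poly f (real m) = real (m choose i)" for m
    by (simp add: f_def poly_prod binomial_gbinomial gbinomial_prod_rev atLeast0LessThan)
  ultimately show ?thesis using pade_vanishing[OF r, of f n] by (simp only:)
qed

section \<open>The approximants and the size of the remainder\<close>

definition pade_P :: "nat \<Rightarrow> nat \<Rightarrow> complex poly" where
  "pade_P r n = (\<Sum>k\<le>n. monom (of_real (pade_coeff r n k)) k)"

text \<open>The coefficients of \<open>pade_P\<close> in reverse order: after homogenizing, the two
  polynomials differ by a swap of the variables.\<close>

definition pade_Q :: "nat \<Rightarrow> nat \<Rightarrow> complex poly" where
  "pade_Q r n = (\<Sum>k\<le>n. monom (of_real (pade_coeff r n (n - k))) k)"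

text \<open>Coefficient of t^i in w Q(w^r) - P(w^r) for w = 1 + t. Substituting s = w^r replaces the
  root by w and makes the remainder a polynomial.\<close>

definition pade_taylor :: "nat \<Rightarrow> nat \<Rightarrow> nat \<Rightarrow> real" where
  "pade_taylor r n i = (\<Sum>k\<le>n. pade_coeff r n (n - k) * real ((r * k + 1) choose i)) -
    (\<Sum>k\<le>n. pade_coeff r n k * real ((r * k) choose i))"

lemma power_one_plus_expand:
  fixes t :: "'a::comm_ring_1"
  assumes "m \<le> N"
  shows "(1 + t) ^ m = (\<Sum>i\<le>N. of_nat (m choose i) * t ^ i)"
proof -
  have "(1 + t) ^ m = (\<Sum>i\<le>m. of_nat (m choose i) * t ^ i)"
    using binomial_ring[of t 1 m] by (simp add: add.commute)
  also have "\<dots> = (\<Sum>i\<le>N. of_nat (m choose i) * t ^ i)"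
    using assms by (intro sum.mono_neutral_left) (auto simp: binomial_eq_0)
  finally show ?thesis .
qed

lemma pade_remainder_taylor:
  "(1 + t) * poly (pade_Q r n) ((1 + t) ^ r) - poly (pade_P r n) ((1 + t) ^ r) =
    (\<Sum>i\<le>r * n + 1. of_real (pade_taylor r n i) * t ^ i)"
proof -
  have Q: "(1 + t) * poly (pade_Q r n) ((1 + t) ^ r) =
      (\<Sum>k\<le>n. of_real (pade_coeff r n (n - k)) * (1 + t) ^ (r * k + 1))"
    by (simp add: pade_Q_def poly_sum poly_monom sum_distrib_left mult.left_commute flip: power_mult)
  also have "\<dots> = (\<Sum>k\<le>n. \<Sum>i\<le>r * n + 1.
      of_real (pade_coeff r n (n - k)) * of_nat ((r * k + 1) choose i) * t ^ i)"
  proof (rule sum.cong[OF refl])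
    fix k assume "k \<in> {..n}"
    then have "r * k + 1 \<le> r * n + 1" by simp
    then show "of_real (pade_coeff r n (n - k)) * (1 + t) ^ (r * k + 1) = (\<Sum>i\<le>r * n + 1.
      of_real (pade_coeff r n (n - k)) * of_nat ((r * k + 1) choose i) * t ^ i)"
      by (simp only: power_one_plus_expand sum_distrib_left mult.assoc)
  qed
  finally have 1: "(1 + t) * poly (pade_Q r n) ((1 + t) ^ r) = (\<Sum>i\<le>r * n + 1. \<Sum>k\<le>n.
      of_real (pade_coeff r n (n - k)) * of_nat ((r * k + 1) choose i) * t ^ i)"
    by (subst sum.swap)
  have P: "poly (pade_P r n) ((1 + t) ^ r) =
      (\<Sum>k\<le>n. of_real (pade_coeff r n k) * (1 + t) ^ (r * k))"
    by (simp add: pade_P_def poly_sum poly_monom power_mult)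
  also have "\<dots> = (\<Sum>k\<le>n. \<Sum>i\<le>r * n + 1.
      of_real (pade_coeff r n k) * of_nat ((r * k) choose i) * t ^ i)"
  proof (rule sum.cong[OF refl])
    fix k assume "k \<in> {..n}"
    then have "r * k \<le> r * n + 1" by (simp add: le_SucI)
    then show "of_real (pade_coeff r n k) * (1 + t) ^ (r * k) = (\<Sum>i\<le>r * n + 1.
      of_real (pade_coeff r n k) * of_nat ((r * k) choose i) * t ^ i)"
      by (simp only: power_one_plus_expand sum_distrib_left mult.assoc)
  qed
  finally have 2: "poly (pade_P r n) ((1 + t) ^ r) = (\<Sum>i\<le>r * n + 1. \<Sum>k\<le>n.
      of_real (pade_coeff r n k) * of_nat ((r * k) choose i) * t ^ i)"
    by (subst sum.swap)
  show ?thesis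
    unfolding 1 2 pade_taylor_def
    by (simp add: sum_subtractf left_diff_distrib sum_distrib_right)
qed

lemma pade_taylor_zero: "r \<ge> 2 \<Longrightarrow> i \<le> 2 * n \<Longrightarrow> pade_taylor r n i = 0"
  using pade_vanishing_choose by (simp add: pade_taylor_def)

lemma one_plus_inverse_power:
  assumes "r > 0"
  shows "(1 + 1 / real r) ^ (r * n) \<le> 3 ^ n"
proof -
  have "1 + 1 / real r \<le> exp (1 / real r)" by (rule exp_ge_add_one_self)
  then have "(1 + 1 / real r) ^ r \<le> exp (1 / real r) ^ r"
    by (intro power_mono) (auto intro: add_nonneg_nonneg)
  also have "\<dots> = exp 1" using assms by (simp flip: exp_of_nat_mult)
  also have "\<dots> \<le> 3" by (rule exp_le)
  finally show ?thesis unfolding power_mult by (intro power_mono) auto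
qed

text \<open>Taking out x^(2n+1) with x = r |w - 1| <= 1 leaves an expansion with nonnegative
  coefficients at t = 1/r, where (1 + 1/r)^(rn+1) <= 2 * 3^n. The 12 is this 3 times the 4 of
  \<open>pade_coeff_sum\<close>; the leading 4 is the 2 once for each polynomial.\<close>

lemma pade_remainder_bound:
  fixes w :: complex
  assumes r: "r \<ge> 2" and w: "real r * cmod (w - 1) \<le> 1"
  shows "cmod (w * poly (pade_Q r n) (w ^ r) - poly (pade_P r n) (w ^ r)) \<le>
    4 * (12 * real r ^ 2) ^ n * (real r * cmod (w - 1)) ^ (2 * n + 1)"
proof -
  define t where "t = w - 1"
  define x where "x = real r * cmod t"
  define N where "N = r * n + 1"
  define S where "S = (\<Sum>k\<le>n. pade_coeff r n k)"
  have x: "0 \<le> x" "x \<le> 1" using w by (auto simp: x_def t_def)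
  have tx: "cmod t = x * (1 / real r)" using r by (simp add: x_def)
  have pos: "pade_coeff r n k \<ge> 0" if "k \<le> n" for k
    using pade_coeff_pos[OF r that] by simp
  have full: "(\<Sum>i\<le>N. real (m choose i) * (1 / real r) ^ i) \<le> 2 * 3 ^ n" if "m \<le> N" for m
  proof -
    have "(\<Sum>i\<le>N. real (m choose i) * (1 / real r) ^ i) = (1 + 1 / real r) ^ m"
      using power_one_plus_expand[OF that, of "1 / real r"] by simp
    also have "\<dots> \<le> (1 + 1 / real r) ^ N" using that by (intro power_increasing) auto
    also have "\<dots> = (1 + 1 / real r) * (1 + 1 / real r) ^ (r * n)" by (simp add: N_def)
    also have "\<dots> \<le> 2 * 3 ^ n"
      using one_plus_inverse_power[of r n] r by (intro mult_mono) auto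
    finally show ?thesis .
  qed
  have weighted: "(\<Sum>k\<le>n. c k * (\<Sum>i\<le>N. real (m k choose i) * (1 / real r) ^ i)) \<le> (\<Sum>k\<le>n. c k) * (2 * 3 ^ n)"
    if "\<And>k. k \<le> n \<Longrightarrow> m k \<le> N" "\<And>k. k \<le> n \<Longrightarrow> c k \<ge> 0" for c m
    unfolding sum_distrib_right using that full by (intro sum_mono mult_left_mono) auto
  define B where "B i = (\<Sum>k\<le>n. pade_coeff r n (n - k) * real ((r * k + 1) choose i)) +
    (\<Sum>k\<le>n. pade_coeff r n k * real ((r * k) choose i))" for i
  have "cmod (w * poly (pade_Q r n) (w ^ r) - poly (pade_P r n) (w ^ r)) =
      cmod (\<Sum>i\<le>N. of_real (pade_taylor r n i) * t ^ i)"
    using pade_remainder_taylor[of t r n] by (simp add: t_def N_def)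
  also have "\<dots> \<le> (\<Sum>i\<le>N. cmod (of_real (pade_taylor r n i) * t ^ i))"
    by (rule norm_sum)
  also have "\<dots> \<le> (\<Sum>i\<le>N. x ^ (2 * n + 1) * (B i * (1 / real r) ^ i))"
  proof (rule sum_mono)
    fix i
    have B0: "B i \<ge> 0" unfolding B_def using pos by (intro add_nonneg_nonneg sum_nonneg) auto
    show "cmod (of_real (pade_taylor r n i) * t ^ i) \<le> x ^ (2 * n + 1) * (B i * (1 / real r) ^ i)"
    proof (cases "i \<le> 2 * n")
      case True
      then show ?thesis using pade_taylor_zero[OF r True] B0 x by simp
    next
      case False
      have "(\<Sum>k\<le>n. pade_coeff r n (n - k) * real ((r * k + 1) choose i)) \<ge> 0"
        "(\<Sum>k\<le>n. pade_coeff r n k * real ((r * k) choose i)) \<ge> 0"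
        using pos by (auto intro!: sum_nonneg)
      then have "\<bar>pade_taylor r n i\<bar> \<le> B i" unfolding pade_taylor_def B_def by linarith
      moreover have "x ^ i \<le> x ^ (2 * n + 1)" using x False by (intro power_decreasing) auto
      ultimately have "\<bar>pade_taylor r n i\<bar> * (x ^ i * (1 / real r) ^ i) \<le> B i * (x ^ (2 * n + 1) * (1 / real r) ^ i)"
        using x B0 by (intro mult_mono) auto
      moreover have "cmod (of_real (pade_taylor r n i) * t ^ i) = \<bar>pade_taylor r n i\<bar> * (x ^ i * (1 / real r) ^ i)"
        by (simp only: norm_mult norm_of_real norm_power tx power_mult_distrib)
      ultimately show ?thesis by (simp only: mult.left_commute)
    qed
  qed
  also have "\<dots> = x ^ (2 * n + 1) * (\<Sum>i\<le>N. B i * (1 / real r) ^ i)"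
    by (rule sum_distrib_left[symmetric])
  also have "(\<Sum>i\<le>N. B i * (1 / real r) ^ i) \<le> S * (2 * 3 ^ n) + S * (2 * 3 ^ n)"
  proof -
    have "(\<Sum>i\<le>N. B i * (1 / real r) ^ i) =
        (\<Sum>k\<le>n. pade_coeff r n (n - k) * (\<Sum>i\<le>N. real ((r * k + 1) choose i) * (1 / real r) ^ i)) +
        (\<Sum>k\<le>n. pade_coeff r n k * (\<Sum>i\<le>N. real ((r * k) choose i) * (1 / real r) ^ i))"
      unfolding B_def distrib_right sum.distrib sum_distrib_right sum_distrib_left
      by (intro arg_cong2[of _ _ _ _ "(+)"]; subst sum.swap; simp add: mult.assoc)
    also have "\<dots> \<le> (\<Sum>k\<le>n. pade_coeff r n (n - k)) * (2 * 3 ^ n) + (\<Sum>k\<le>n. pade_coeff r n k) * (2 * 3 ^ n)"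
      using pos by (intro add_mono weighted) (auto simp: N_def le_SucI)
    finally show ?thesis using sum_reflect[of "pade_coeff r n" n] by (simp add: S_def)
  qed
  also have "S * (2 * 3 ^ n) + S * (2 * 3 ^ n) \<le> (4 * real r ^ 2) ^ n * (2 * 3 ^ n) + (4 * real r ^ 2) ^ n * (2 * 3 ^ n)"
    unfolding S_def using r by (intro add_mono mult_right_mono pade_coeff_sum) auto
  finally have "cmod (w * poly (pade_Q r n) (w ^ r) - poly (pade_P r n) (w ^ r)) \<le>
      x ^ (2 * n + 1) * ((4 * real r ^ 2) ^ n * (2 * 3 ^ n) + (4 * real r ^ 2) ^ n * (2 * 3 ^ n))"
    using x by (simp add: mult_left_mono)
  also have "\<dots> = 4 * (12 * real r ^ 2) ^ n * x ^ (2 * n + 1)"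
  proof -
    have "(12 * real r ^ 2) ^ n = (4 * real r ^ 2) ^ n * 3 ^ n"
      by (subst power_mult_distrib[symmetric]) simp
    moreover have "z * (p * (2 * q) + p * (2 * q)) = 4 * (p * q) * z" for z p q :: real by simp
    ultimately show ?thesis by (simp only:)
  qed
  finally show ?thesis by (simp add: x_def t_def)
qed

lemma pade_P_bound:
  fixes w :: complex
  assumes r: "r \<ge> 2" and w: "real r * cmod (w - 1) \<le> 1"
  shows "cmod (poly (pade_P r n) (w ^ r)) \<le> (12 * real r ^ 2) ^ n"
proof -
  have "cmod w \<le> 1 + 1 / real r"
  proof -
    have "cmod w \<le> 1 + cmod (w - 1)" using norm_triangle_ineq[of 1 "w - 1"] by simp
    moreover have "cmod (w - 1) \<le> 1 / real r" using w r by (simp add: field_simps)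
    ultimately show ?thesis by simp
  qed
  then have wk: "cmod w ^ (r * k) \<le> 3 ^ n" if "k \<le> n" for k
  proof -
    have "cmod w ^ (r * k) \<le> (1 + 1 / real r) ^ (r * k)"
      using \<open>cmod w \<le> 1 + 1 / real r\<close> by (intro power_mono) auto
    also have "\<dots> \<le> (1 + 1 / real r) ^ (r * n)"
      using that by (intro power_increasing) auto
    also have "\<dots> \<le> 3 ^ n" using one_plus_inverse_power r by simp
    finally show ?thesis .
  qed
  have "cmod (poly (pade_P r n) (w ^ r)) \<le> (\<Sum>k\<le>n. pade_coeff r n k * cmod w ^ (r * k))"
    unfolding pade_P_def poly_sum poly_monom power_mult[symmetric]
    by (intro sum_norm_le) (simp add: norm_mult norm_power pade_coeff_pos[OF r] abs_of_pos)
  also have "\<dots> \<le> (\<Sum>k\<le>n. pade_coeff r n k * 3 ^ n)"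
    using wk by (intro sum_mono mult_left_mono) (auto simp: pade_coeff_pos[OF r] less_imp_le)
  also have "\<dots> = (\<Sum>k\<le>n. pade_coeff r n k) * 3 ^ n" by (simp add: sum_distrib_right)
  also have "\<dots> \<le> (4 * real r ^ 2) ^ n * 3 ^ n"
    using pade_coeff_sum[of r n] r by (intro mult_right_mono) auto
  also have "\<dots> = (12 * real r ^ 2) ^ n"
    by (subst power_mult_distrib[symmetric]) simp
  finally show ?thesis .
qed

section \<open>Independence of consecutive approximations\<close>

lemma pade_remainder_dvd:
  assumes r: "r \<ge> 2"
  shows "[:-1, 1:] ^ (2 * n + 1) dvd
    [:0, 1:] * pcompose (pade_Q r n) (monom 1 r) - pcompose (pade_P r n) (monom 1 r)"
proof -
  have "[:0, 1:] * pcompose (pade_Q r n) (monom 1 r) - pcompose (pade_P r n) (monom 1 r) =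
      (\<Sum>i\<le>r * n + 1. smult (of_real (pade_taylor r n i)) ([:-1, 1:] ^ i))"
  proof (rule iffD1[OF poly_eq_poly_eq_iff], rule ext)
    fix w :: complex
    have "poly (\<Sum>i\<le>N. smult (of_real (pade_taylor r n i)) ([:-1, 1:] ^ i)) w =
        (\<Sum>i\<le>N. of_real (pade_taylor r n i) * (w - 1) ^ i)" for N
      by (simp add: poly_sum)
    then show "poly ([:0, 1:] * pcompose (pade_Q r n) (monom 1 r) - pcompose (pade_P r n) (monom 1 r)) w =
        poly (\<Sum>i\<le>r * n + 1. smult (of_real (pade_taylor r n i)) ([:-1, 1:] ^ i)) w"
      using pade_remainder_taylor[of "w - 1" r n]
      by (simp only: poly_diff poly_mult poly_pcompose poly_monom) simp
  qed
  also have "[:-1, 1:] ^ (2 * n + 1) dvd \<dots>"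
  proof (rule dvd_sum)
    fix i
    show "[:-1, 1:] ^ (2 * n + 1) dvd smult (of_real (pade_taylor r n i)) ([:-1, 1:] ^ i)"
    proof (cases "i \<le> 2 * n")
      case False
      then show ?thesis by (intro dvd_smult le_imp_power_dvd) auto
    qed (simp add: pade_taylor_zero[OF r])
  qed
  finally show ?thesis .
qed

lemma pcompose_power: "pcompose (p ^ m) q = pcompose p q ^ m" for p :: "'a::comm_ring_1 poly"
  by (induction m) (simp_all add: pcompose_mult pcompose_1)

text \<open>The determinant of two consecutive approximations is a nonzero multiple of $(s-1)^{2n+1}$:
  its degree is at most $2n+1$, and after substituting $w^r$ it is a combination of the two
  remainders.\<close>

lemma pade_determinant:
  assumes r: "r \<ge> 2" and s: "s \<noteq> 1"
  shows "poly (pade_P r n) s * poly (pade_Q r (Suc n)) s \<noteq>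
    poly (pade_P r (Suc n)) s * poly (pade_Q r n) s"
proof -
  define W where "W = pade_P r n * pade_Q r (Suc n) - pade_P r (Suc n) * pade_Q r n"
  define X :: "complex poly" where "X = monom 1 r"
  have degP: "degree (pade_P r k) \<le> k" "degree (pade_Q r k) \<le> k" for k
    unfolding pade_P_def pade_Q_def
    by (intro degree_sum_le; simp; meson degree_monom_le order.trans)+
  have degW: "degree W \<le> 2 * n + 1"
  proof -
    have "degree (pade_P r n * pade_Q r (Suc n)) \<le> 2 * n + 1"
      "degree (pade_P r (Suc n) * pade_Q r n) \<le> 2 * n + 1"
      using degP[of n] degP[of "Suc n"] degree_mult_le[of "pade_P r n" "pade_Q r (Suc n)"]
        degree_mult_le[of "pade_P r (Suc n)" "pade_Q r n"] by linarith+
    then show ?thesis unfolding W_def by (rule degree_diff_le)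
  qed
  \<comment> \<open>At 0 only the constant terms survive. Passing from n to n + 1 multiplies that of
    P by n + 1 - 1/r and that of Q by n + 1 + 1/r, up to a common factor, so the two products
    differ.\<close>
  have W0: "poly W 0 \<noteq> 0"
  proof -
    have P0: "poly (pade_P r k) 0 = of_real (pade_coeff r k 0)"
      "poly (pade_Q r k) 0 = of_real (pade_coeff r k k)" for k
    proof -
      have "poly (pade_P r k) 0 = coeff (pade_P r k) 0" "poly (pade_Q r k) 0 = coeff (pade_Q r k) 0"
        by (simp_all add: poly_0_coeff_0)
      then show "poly (pade_P r k) 0 = of_real (pade_coeff r k 0)"
        "poly (pade_Q r k) 0 = of_real (pade_coeff r k k)"
        by (simp_all add: pade_P_def pade_Q_def coeff_sum)
    qed
    have s0: "pade_coeff r (Suc n) 0 = real r ^ 2 * ((real n + 1 - 1 / real r) / (real n + 1)) * pade_coeff r n 0"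
      using gbinomial_factors[of "real n - 1 / real r" n]
      by (simp add: pade_coeff_def algebra_simps power_add power2_eq_square)
    have sn: "pade_coeff r (Suc n) (Suc n) = real r ^ 2 * ((real n + 1 + 1 / real r) / (real n + 1)) * pade_coeff r n n"
      using gbinomial_factors[of "real n + 1 / real r" n]
      by (simp add: pade_coeff_def algebra_simps power_add power2_eq_square)
    have "pade_coeff r n 0 * pade_coeff r (Suc n) (Suc n) - pade_coeff r (Suc n) 0 * pade_coeff r n n =
        real r ^ 2 * pade_coeff r n 0 * pade_coeff r n n * (2 * (1 / real r) / (real n + 1))"
    proof -
      have "p * (R * ((d + e) / d) * q) - (R * ((d - e) / d) * p) * q = R * p * q * (2 * e / d)" for p q R d e :: real
        by (simp add: add_divide_distrib diff_divide_distrib algebra_simps)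
      then show ?thesis unfolding s0 sn .
    qed
    also have "\<dots> > 0"
      using r pade_coeff_pos[OF r, of 0 n] pade_coeff_pos[OF r, of n n] by (intro mult_pos_pos divide_pos_pos) auto
    finally have "pade_coeff r n 0 * pade_coeff r (Suc n) (Suc n) - pade_coeff r (Suc n) 0 * pade_coeff r n n \<noteq> 0"
      by simp
    moreover have "poly W 0 = of_real (pade_coeff r n 0 * pade_coeff r (Suc n) (Suc n) - pade_coeff r (Suc n) 0 * pade_coeff r n n)"
      by (simp add: W_def P0)
    ultimately show ?thesis by (simp only: of_real_eq_0_iff not_False_eq_True)
  qed
  \<comment> \<open>In the combination of the two remainders the terms w Q_n Q_(n+1) cancel.\<close>
  have dvdW: "[:-1, 1:] ^ (2 * n + 1) dvd pcompose W X"
  proof -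
    have "[:-1, 1:] ^ (2 * n + 1) dvd ([:-1, 1:] ^ (2 * Suc n + 1) :: complex poly)"
      by (rule le_imp_power_dvd) simp
    then have d1: "[:-1, 1:] ^ (2 * n + 1) dvd
        ([:0, 1:] * pcompose (pade_Q r (Suc n)) X - pcompose (pade_P r (Suc n)) X)"
      using pade_remainder_dvd[OF r, of "Suc n"] unfolding X_def by (rule dvd_trans)
    moreover have "pcompose W X =
        pcompose (pade_Q r n) X * ([:0, 1:] * pcompose (pade_Q r (Suc n)) X - pcompose (pade_P r (Suc n)) X) -
        pcompose (pade_Q r (Suc n)) X * ([:0, 1:] * pcompose (pade_Q r n) X - pcompose (pade_P r n) X)"
      by (simp add: W_def pcompose_diff pcompose_mult algebra_simps)
    ultimately show ?thesis
      using dvd_diff[OF dvd_mult[OF d1] dvd_mult[OF pade_remainder_dvd[OF r, of n]]]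
      unfolding X_def by (simp only:)
  qed
  have "W \<noteq> 0" using W0 by auto
  then obtain V where V: "W = [:-1, 1:] ^ order 1 W * V" and nd: "\<not> [:-1, 1:] dvd V"
    using order_decomp[of W 1] by auto
  define m where "m = order 1 W"
  have "V \<noteq> 0" using nd by auto
  have m: "m \<ge> 2 * n + 1"
  proof (rule ccontr)
    assume "\<not> m \<ge> 2 * n + 1"
    then have less: "m < 2 * n + 1" by simp
    \<comment> \<open>w^r - 1 = (w - 1) U(w) with U(1) = r nonzero. The map w -> w^r is thus
      unramified at 1, and the order of W at 1 equals that of W(w^r).\<close>
    define U :: "complex poly" where "U = (\<Sum>i<r. monom 1 i)"
    have XU: "pcompose [:-1, 1:] X = [:-1, 1:] * U"
    proof (rule iffD1[OF poly_eq_poly_eq_iff], rule ext)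
      fix w
      show "poly (pcompose [:-1, 1:] X) w = poly ([:-1, 1:] * U) w"
        using power_diff_1_eq[of w r]
        by (simp add: poly_pcompose X_def U_def poly_monom poly_sum algebra_simps)
    qed
    have "pcompose W X = [:-1, 1:] ^ m * (U ^ m * pcompose V X)"
      by (subst V) (simp only: pcompose_mult pcompose_power XU power_mult_distrib mult.assoc m_def)
    moreover have "[:-1, 1:] ^ (2 * n + 1) = ([:-1, 1:] ^ m * [:-1, 1:] ^ (2 * n + 1 - m) :: complex poly)"
      using less by (simp flip: power_add)
    ultimately have "[:-1, 1:] ^ m * [:-1, 1:] ^ (2 * n + 1 - m) dvd [:-1, 1:] ^ m * (U ^ m * pcompose V X)"
      using dvdW by (simp only:)
    then have "[:-1, 1:] ^ (2 * n + 1 - m) dvd U ^ m * pcompose V X"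
      by (subst (asm) dvd_mult_cancel_left) auto
    moreover have "[:-1, 1:] dvd ([:-1, 1:] ^ (2 * n + 1 - m) :: complex poly)"
      using less by (intro dvd_power) auto
    ultimately have "[:-1, 1:] dvd U ^ m * pcompose V X" by (rule dvd_trans[rotated])
    then have "poly (U ^ m * pcompose V X) 1 = 0" by (simp only: poly_eq_0_iff_dvd)
    then have "of_nat r ^ m * poly V 1 = 0"
      by (simp add: U_def poly_sum poly_monom poly_pcompose X_def)
    then show False using r nd by (simp add: poly_eq_0_iff_dvd)
  qed
  have "degree W = m + degree V"
    using \<open>V \<noteq> 0\<close> by (subst V) (simp add: degree_mult_eq degree_linear_power flip: m_def)
  then have "degree V = 0" using degW m by simp
  then obtain c where c: "V = [:c:]" by (rule degree_eq_zeroE)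
  have "poly W s = (s - 1) ^ m * c" by (subst V) (simp add: c m_def)
  then have "poly W s \<noteq> 0" using s c \<open>V \<noteq> 0\<close> by auto
  then show ?thesis by (simp add: W_def)
qed

section \<open>Arithmetic of diagonal forms\<close>

text \<open>The partial derivative over any commutative ring, so that integrality at integer points
  and the complex derivative concern one formula. At i = r the truncated exponent is harmless,
  because the factor r - i is 0.\<close>

definition form_dx :: "nat \<Rightarrow> (nat \<Rightarrow> int) \<Rightarrow> 'a::comm_ring_1 \<Rightarrow> 'a \<Rightarrow> 'a" where
  "form_dx r a x y = (\<Sum>i\<le>r. of_int (a i) * (of_nat (r - i) * x ^ (r - i - 1)) * y ^ i)"

definition form_dy :: "nat \<Rightarrow> (nat \<Rightarrow> int) \<Rightarrow> 'a::comm_ring_1 \<Rightarrow> 'a \<Rightarrow> 'a" where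
  "form_dy r a x y = (\<Sum>i\<le>r. of_int (a i) * x ^ (r - i) * (of_nat i * y ^ (i - 1)))"

lemma of_int_form:
  "of_int (binary_form r a x y) = binary_form r a (of_int x) (of_int y)"
  "of_int (form_dx r a x y) = form_dx r a (of_int x) (of_int y)"
  "of_int (form_dy r a x y) = form_dy r a (of_int x) (of_int y)"
  by (simp_all add: binary_form_def form_dx_def form_dy_def)

lemma of_real_binary_form:
  "complex_of_real (binary_form r a x y) = binary_form r a (of_real x) (of_real y)"
  by (simp add: binary_form_def)

text \<open>The quadratic form is primitive, its content being moved into \<open>\<mu>\<close>;
  \<open>norm_s_bound\<close> rests on this. The linear forms are parameters so that v can later be
  multiplied by a root of unity.\<close>

locale diagonal_form =
  fixes r :: nat and a :: "nat \<Rightarrow> int" and \<alpha> \<beta> \<gamma> \<delta> \<mu> :: complex and A B C :: int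
  assumes r6: "r \<ge> 6"
    and diag: "diagonalization r a \<alpha> \<beta> \<gamma> \<delta>"
    and quad: "\<And>x y. (\<alpha> * x + \<beta> * y) * (\<gamma> * x + \<delta> * y) =
           \<mu> * (of_int A * x\<^sup>2 + of_int B * x * y + of_int C * y\<^sup>2)"
    and primitive: "gcd A (gcd B C) = 1"
begin

definition "j = \<alpha> * \<delta> - \<beta> * \<gamma>"
text \<open>The square root of \<open>D\<close> singled out by the order of the two linear forms:
  exchanging u and v changes its sign.\<close>

definition "s = j / \<mu>"
definition "D = B\<^sup>2 - 4 * A * C"
definition "u p = \<alpha> * of_int (fst p) + \<beta> * of_int (snd p)"
definition "v p = \<gamma> * of_int (fst p) + \<delta> * of_int (snd p)"
definition "F p = binary_form r a (fst p) (snd p)" for p :: "int \<times> int"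
definition "area p q = fst p * snd q - fst q * snd p" for p q :: "int \<times> int"
text \<open>Polarization of the quadratic form, equal to twice its value when p = q.\<close>

definition "polar p q = 2 * A * fst p * fst q + B * (fst p * snd q + fst q * snd p) + 2 * C * snd p * snd q"

lemma j_nonzero: "j \<noteq> 0"
  using diag by (simp add: diagonalization_def j_def)

lemma quad_coeffs: "\<alpha> * \<gamma> = \<mu> * of_int A" "\<alpha> * \<delta> + \<beta> * \<gamma> = \<mu> * of_int B" "\<beta> * \<delta> = \<mu> * of_int C"
proof -
  show 1: "\<alpha> * \<gamma> = \<mu> * of_int A" using quad[of 1 0] by simp
  show 2: "\<beta> * \<delta> = \<mu> * of_int C" using quad[of 0 1] by simp
  show "\<alpha> * \<delta> + \<beta> * \<gamma> = \<mu> * of_int B" using quad[of 1 1] 1 2 by (simp add: algebra_simps)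
qed

lemma j_square: "j\<^sup>2 = \<mu>\<^sup>2 * of_int D"
proof -
  have "j\<^sup>2 = (\<alpha> * \<delta> + \<beta> * \<gamma>)\<^sup>2 - 4 * (\<alpha> * \<gamma>) * (\<beta> * \<delta>)" unfolding j_def by algebra
  then show ?thesis unfolding quad_coeffs D_def by (simp add: algebra_simps power2_eq_square)
qed

lemma mu_nonzero: "\<mu> \<noteq> 0"
  using j_square j_nonzero by auto

lemma j_eq: "j = \<mu> * s"
  using mu_nonzero by (simp add: s_def)

lemma s_square: "s\<^sup>2 = of_int D"
  using j_square mu_nonzero by (simp add: s_def power_divide)

lemma s_nonzero: "s \<noteq> 0" and D_nonzero: "D \<noteq> 0"
  using s_square j_nonzero j_eq by auto

lemma form_eq: "of_int (F p) = u p ^ r - v p ^ r"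
  using diag by (simp add: F_def of_int_form diagonalization_def u_def v_def)

text \<open>Together with \<open>uv_area\<close> and j = \<mu> s this writes 2 u(p) v(q) and 2 u(q)
  v(p) as \<mu> times conjugate elements of Z[s].\<close>

lemma uv_polar: "u p * v q + u q * v p = \<mu> * of_int (polar p q)"
proof -
  have "u p * v q + u q * v p = 2 * (\<alpha> * \<gamma>) * (of_int (fst p) * of_int (fst q)) +
      (\<alpha> * \<delta> + \<beta> * \<gamma>) * (of_int (fst p) * of_int (snd q) + of_int (fst q) * of_int (snd p)) +
      2 * (\<beta> * \<delta>) * (of_int (snd p) * of_int (snd q))"
    by (simp add: u_def v_def algebra_simps)
  then show ?thesis unfolding quad_coeffs polar_def by (simp add: algebra_simps)
qed

lemma uv_area: "u p * v q - u q * v p = j * of_int (area p q)"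
  by (simp add: u_def v_def j_def area_def algebra_simps)

text \<open>Both sides are the derivative in x of the same function, which spares a comparison of
  coefficients.\<close>

lemma form_dx_eq: "form_dx r a x y =
    of_nat r * (\<alpha> * (\<alpha> * x + \<beta> * y) ^ (r - 1) - \<gamma> * (\<gamma> * x + \<delta> * y) ^ (r - 1))"
proof -
  have "((\<lambda>x. binary_form r a x y) has_field_derivative form_dx r a x y) (at x)"
    unfolding binary_form_def form_dx_def
    by (auto intro!: derivative_eq_intros sum.cong simp: mult_ac)
  moreover have "((\<lambda>x. (\<alpha> * x + \<beta> * y) ^ r - (\<gamma> * x + \<delta> * y) ^ r) has_field_derivative
      of_nat r * (\<alpha> * (\<alpha> * x + \<beta> * y) ^ (r - 1) - \<gamma> * (\<gamma> * x + \<delta> * y) ^ (r - 1))) (at x)"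
    by (auto intro!: derivative_eq_intros simp: algebra_simps)
  moreover have "(\<lambda>x. binary_form r a x y) = (\<lambda>x. (\<alpha> * x + \<beta> * y) ^ r - (\<gamma> * x + \<delta> * y) ^ r)"
    using diag by (simp add: diagonalization_def)
  ultimately show ?thesis using DERIV_unique by metis
qed

lemma form_dy_eq: "form_dy r a x y =
    of_nat r * (\<beta> * (\<alpha> * x + \<beta> * y) ^ (r - 1) - \<delta> * (\<gamma> * x + \<delta> * y) ^ (r - 1))"
proof -
  have "((\<lambda>y. binary_form r a x y) has_field_derivative form_dy r a x y) (at y)"
    unfolding binary_form_def form_dy_def
    by (auto intro!: derivative_eq_intros sum.cong simp: mult_ac)
  moreover have "((\<lambda>y. (\<alpha> * x + \<beta> * y) ^ r - (\<gamma> * x + \<delta> * y) ^ r) has_field_derivative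
      of_nat r * (\<beta> * (\<alpha> * x + \<beta> * y) ^ (r - 1) - \<delta> * (\<gamma> * x + \<delta> * y) ^ (r - 1))) (at y)"
    by (auto intro!: derivative_eq_intros simp: algebra_simps)
  moreover have "(\<lambda>y. binary_form r a x y) = (\<lambda>y. (\<alpha> * x + \<beta> * y) ^ r - (\<gamma> * x + \<delta> * y) ^ r)"
    using diag by (simp add: diagonalization_def)
  ultimately show ?thesis using DERIV_unique by metis
qed

text \<open>The Jacobian covariant of $F$ and $Ax^2 + Bxy + Cy^2$.\<close>

definition "jac p = (B * fst p + 2 * C * snd p) * form_dx r a (fst p) (snd p) -
    (2 * A * fst p + B * snd p) * form_dy r a (fst p) (snd p)"

text \<open>Multiplied by \<mu>, the linear forms Bx + 2Cy and 2Ax + By become \<delta> u + \<beta>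
  v and \<gamma> u + \<alpha> v. In the combination of the derivatives the mixed terms then cancel
  and leave r j (u^r + v^r). With u^r - v^r = F this determines u^r and v^r separately.\<close>

lemma jac_eq: "of_nat r * s * (u p ^ r + v p ^ r) = of_int (jac p)"
proof -
  define x y where "x = complex_of_int (fst p)" and "y = complex_of_int (snd p)"
  define X Y where "X = u p ^ (r - 1)" and "Y = v p ^ (r - 1)"
  have uv: "u p = \<alpha> * x + \<beta> * y" "v p = \<gamma> * x + \<delta> * y" by (simp_all add: u_def v_def x_def y_def)
  have r1: "u p ^ r = u p * X" "v p ^ r = v p * Y"
    using r6 by (simp_all add: X_def Y_def power_eq_if)
  have dx: "form_dx r a x y = of_nat r * (\<alpha> * X - \<gamma> * Y)"
    and dy: "form_dy r a x y = of_nat r * (\<beta> * X - \<delta> * Y)"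
    by (simp_all add: form_dx_eq form_dy_eq X_def Y_def uv)
  have 1: "\<delta> * u p + \<beta> * v p = \<mu> * (of_int B * x + 2 * of_int C * y)"
  proof -
    have "\<delta> * u p + \<beta> * v p = (\<alpha> * \<delta> + \<beta> * \<gamma>) * x + 2 * (\<beta> * \<delta>) * y" by (simp add: uv algebra_simps)
    then show ?thesis unfolding quad_coeffs by (simp add: algebra_simps)
  qed
  have 2: "\<gamma> * u p + \<alpha> * v p = \<mu> * (2 * of_int A * x + of_int B * y)"
  proof -
    have "\<gamma> * u p + \<alpha> * v p = 2 * (\<alpha> * \<gamma>) * x + (\<alpha> * \<delta> + \<beta> * \<gamma>) * y" by (simp add: uv algebra_simps)
    then show ?thesis unfolding quad_coeffs by (simp add: algebra_simps)
  qed
  have "of_int (jac p) = (of_int B * x + 2 * of_int C * y) * form_dx r a x y -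
      (2 * of_int A * x + of_int B * y) * form_dy r a x y"
    unfolding jac_def x_def y_def by (simp add: of_int_form)
  then have "\<mu> * of_int (jac p) = (\<delta> * u p + \<beta> * v p) * form_dx r a x y - (\<gamma> * u p + \<alpha> * v p) * form_dy r a x y"
    unfolding 1 2 by (simp only: mult.assoc right_diff_distrib)
  also have "\<dots> = of_nat r * j * (u p ^ r + v p ^ r)"
    unfolding dx dy r1 j_def by (simp add: algebra_simps)
  also have "\<dots> = \<mu> * (of_nat r * s * (u p ^ r + v p ^ r))" by (simp add: j_eq mult_ac)
  finally show ?thesis using mu_nonzero by simp
qed

lemma u_power: "2 * of_nat r * s * u p ^ r = of_int (jac p) + s * of_int (int r * F p)"
  and v_power: "2 * of_nat r * s * v p ^ r = of_int (jac p) - s * of_int (int r * F p)"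
  unfolding jac_eq[symmetric] of_int_mult form_eq by (simp_all add: algebra_simps)

text \<open>Conjugates with respect to $s = \pm\sqrt{D}$. When $D$ is a square there is no
  conjugation map, so this is a relation.\<close>

definition conj_pair :: "complex \<Rightarrow> complex \<Rightarrow> bool" where
  "conj_pair z z' \<longleftrightarrow> (\<exists>X Y. z = of_int X + s * of_int Y \<and> z' = of_int X - s * of_int Y)"

lemma conj_pair_of_int: "conj_pair (of_int X) (of_int X)"
  unfolding conj_pair_def by (rule exI[of _ X], rule exI[of _ 0]) simp

lemma conj_pair_sym: "conj_pair z z' \<Longrightarrow> conj_pair z' z"
  unfolding conj_pair_def by (metis add_uminus_conv_diff diff_minus_eq_add mult_minus_right of_int_minus)

lemma conj_pair_add: "conj_pair z z' \<Longrightarrow> conj_pair w w' \<Longrightarrow> conj_pair (z + w) (z' + w')"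
  unfolding conj_pair_def
proof (elim exE conjE)
  fix X Y X' Y'
  assume "z = of_int X + s * of_int Y" "z' = of_int X - s * of_int Y"
    "w = of_int X' + s * of_int Y'" "w' = of_int X' - s * of_int Y'"
  note * = this
  have "z + w = of_int (X + X') + s * of_int (Y + Y') \<and> z' + w' = of_int (X + X') - s * of_int (Y + Y')"
    unfolding * by (simp add: algebra_simps)
  then show "\<exists>X Y. z + w = of_int X + s * of_int Y \<and> z' + w' = of_int X - s * of_int Y" by blast
qed

lemma conj_pair_mult: "conj_pair z z' \<Longrightarrow> conj_pair w w' \<Longrightarrow> conj_pair (z * w) (z' * w')"
  unfolding conj_pair_def
proof (elim exE conjE)
  fix X Y X' Y'
  assume *: "z = of_int X + s * of_int Y" "z' = of_int X - s * of_int Y"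
    "w = of_int X' + s * of_int Y'" "w' = of_int X' - s * of_int Y'"
  have "z * w = of_int X * of_int X' + s\<^sup>2 * (of_int Y * of_int Y') + s * (of_int X * of_int Y' + of_int Y * of_int X')"
    "z' * w' = of_int X * of_int X' + s\<^sup>2 * (of_int Y * of_int Y') - s * (of_int X * of_int Y' + of_int Y * of_int X')"
    unfolding * by (simp_all add: algebra_simps power2_eq_square)
  then have "z * w = of_int (X * X' + D * (Y * Y')) + s * of_int (X * Y' + Y * X') \<and>
      z' * w' = of_int (X * X' + D * (Y * Y')) - s * of_int (X * Y' + Y * X')"
    unfolding s_square by simp
  then show "\<exists>X Y. z * w = of_int X + s * of_int Y \<and> z' * w' = of_int X - s * of_int Y" by blast
qed

lemma conj_pair_power: "conj_pair z z' \<Longrightarrow> conj_pair (z ^ n) (z' ^ n)"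
proof (induction n)
  case 0
  then show ?case using conj_pair_of_int[of 1] by simp
qed (simp add: conj_pair_mult)

lemma conj_pair_sum:
  "finite S \<Longrightarrow> (\<And>i. i \<in> S \<Longrightarrow> conj_pair (f i) (g i)) \<Longrightarrow> conj_pair (sum f S) (sum g S)"
proof (induction S rule: finite_induct)
  case empty
  then show ?case using conj_pair_of_int[of 0] by simp
qed (simp add: conj_pair_add)

lemma conj_pair_uv: "conj_pair (2 * of_nat r * s * u p ^ r) (2 * of_nat r * s * v p ^ r)"
  unfolding u_power v_power conj_pair_def by blast

text \<open>Written this way, the two values are exchanged by swapping U and V; for conjugate
  arguments they are therefore conjugate.\<close>

lemma pade_homogeneous:
  assumes "U \<noteq> 0"
  shows "U ^ n * poly (pade_P r n) (V / U) = (\<Sum>k\<le>n. of_real (pade_coeff r n k) * (V ^ k * U ^ (n - k)))"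
    and "U ^ n * poly (pade_Q r n) (V / U) = (\<Sum>k\<le>n. of_real (pade_coeff r n k) * (U ^ k * V ^ (n - k)))"
proof -
  have 1: "U ^ n * (V / U) ^ k = V ^ k * U ^ (n - k)" if "k \<le> n" for k
    using that assms by (simp add: power_divide power_diff field_simps)
  have 2: "U ^ n * (c * (V / U) ^ k) = c * (V ^ k * U ^ (n - k))" if "k \<le> n" for k c
    using 1[OF that] by (simp only: mult.left_commute)
  show "U ^ n * poly (pade_P r n) (V / U) = (\<Sum>k\<le>n. of_real (pade_coeff r n k) * (V ^ k * U ^ (n - k)))"
    unfolding pade_P_def poly_sum poly_monom sum_distrib_left by (intro sum.cong refl 2) simp
  have "U ^ n * poly (pade_Q r n) (V / U) =
      (\<Sum>k\<le>n. of_real (pade_coeff r n (n - k)) * (U ^ (n - k) * V ^ (n - (n - k))))"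
    unfolding pade_Q_def poly_sum poly_monom sum_distrib_left
    by (intro sum.cong refl) (subst 2, auto)
  then show "U ^ n * poly (pade_Q r n) (V / U) = (\<Sum>k\<le>n. of_real (pade_coeff r n k) * (U ^ k * V ^ (n - k)))"
    using sum_reflect[of "\<lambda>k. of_real (pade_coeff r n k) * (U ^ k * V ^ (n - k))" n] by simp
qed

text \<open>Equal to $u(q)^{rn+1} (u(p) (w Q(w^r) - P(w^r)) - (v(p) - u(p)) P(w^r))$ with $w = v(q)/u(q)$.\<close>

definition "linear_combination n p q = u p * v q * (u q ^ r) ^ n * poly (pade_Q r n) (v q ^ r / u q ^ r) -
    v p * u q * (u q ^ r) ^ n * poly (pade_P r n) (v q ^ r / u q ^ r)"

text \<open>After multiplication by (2rs)^n the expression is x Q' - y P' with P', Q' conjugate and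
  2x, 2y equal to \<mu> times conjugates. It is odd under s -> -s, which produces the factor \<mu> s
  = j.\<close>

lemma linear_combination_integral:
  assumes "u q \<noteq> 0"
  shows "\<exists>m::int. (2 * of_nat r * s) ^ n * linear_combination n p q = j * of_int m"
proof -
  define U V where "U = u q ^ r" and "V = v q ^ r"
  have U0: "U \<noteq> 0" using assms by (simp add: U_def)
  define c where "c = 2 * of_nat r * s"
  have cp: "conj_pair (c * U) (c * V)" unfolding c_def U_def V_def by (rule conj_pair_uv)
  define P' where "P' = c ^ n * (\<Sum>k\<le>n. of_real (pade_coeff r n k) * (V ^ k * U ^ (n - k)))"
  define Q' where "Q' = c ^ n * (\<Sum>k\<le>n. of_real (pade_coeff r n k) * (U ^ k * V ^ (n - k)))"
  have scale: "c ^ n * (e * (x ^ k * y ^ (n - k))) = e * ((c * x) ^ k * (c * y) ^ (n - k))"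
    if "k \<le> n" for e x y k
  proof -
    have "c ^ n = c ^ k * c ^ (n - k)" using that by (simp flip: power_add)
    then show ?thesis by (simp add: power_mult_distrib mult_ac)
  qed
  have "conj_pair P' Q'"
    unfolding P'_def Q'_def sum_distrib_left
  proof (rule conj_pair_sum)
    fix k assume "k \<in> {..n}"
    then have k: "k \<le> n" by simp
    obtain e :: int where "pade_coeff r n k = of_int e"
      using pade_coeff_Ints[of r k n] k r6 by (auto elim: Ints_cases)
    then have e: "complex_of_real (pade_coeff r n k) = of_int e" by simp
    show "conj_pair (c ^ n * (of_real (pade_coeff r n k) * (V ^ k * U ^ (n - k))))
        (c ^ n * (of_real (pade_coeff r n k) * (U ^ k * V ^ (n - k))))"
      unfolding scale[OF k] e
      by (intro conj_pair_mult conj_pair_power conj_pair_of_int cp conj_pair_sym[OF cp])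
  qed simp
  then obtain X Y where XY: "P' = of_int X + s * of_int Y" "Q' = of_int X - s * of_int Y"
    by (auto simp: conj_pair_def)
  have "c ^ n * linear_combination n p q = (u p * v q) * (c ^ n * (U ^ n * poly (pade_Q r n) (V / U))) -
      (u q * v p) * (c ^ n * (U ^ n * poly (pade_P r n) (V / U)))"
    by (simp add: linear_combination_def U_def V_def algebra_simps)
  also have "\<dots> = (u p * v q) * Q' - (u q * v p) * P'"
    unfolding pade_homogeneous[OF U0] P'_def Q'_def ..
  finally have e: "c ^ n * linear_combination n p q =
      (u p * v q) * (of_int X - s * of_int Y) - (u q * v p) * (of_int X + s * of_int Y)"
    unfolding XY .
  have "2 * (c ^ n * linear_combination n p q) =
      (u p * v q - u q * v p) * (2 * of_int X) - (u p * v q + u q * v p) * (2 * (s * of_int Y))"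
    unfolding e by (simp add: algebra_simps)
  also have "\<dots> = 2 * (j * of_int (area p q * X - polar p q * Y))"
    unfolding uv_polar uv_area by (simp add: j_eq algebra_simps)
  finally have "c ^ n * linear_combination n p q = j * of_int (area p q * X - polar p q * Y)" by simp
  then show ?thesis unfolding c_def by blast
qed

text \<open>Two zeros would put the nonzero vector (u(p) v(q), v(p) u(q)) into the kernel of a
  matrix that is regular by \<open>pade_determinant\<close>. That F(q) is nonzero keeps the argument
  of the approximants away from 1.\<close>

lemma linear_combination_nonzero:
  assumes "u q \<noteq> 0" "v q \<noteq> 0" "F q \<noteq> 0" "u p \<noteq> 0 \<or> v p \<noteq> 0"
  shows "linear_combination n p q \<noteq> 0 \<or> linear_combination (Suc n) p q \<noteq> 0"
proof (rule ccontr)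
  assume "\<not> ?thesis"
  then have z: "linear_combination n p q = 0" "linear_combination (Suc n) p q = 0" by auto
  define t where "t = v q ^ r / u q ^ r"
  have "t \<noteq> 1"
  proof
    assume "t = 1"
    then have "u q ^ r - v q ^ r = 0" using assms(1) by (simp add: t_def)
    then show False using form_eq[of q] assms(3) by simp
  qed
  have E: "(u p * v q) * poly (pade_Q r k) t = (v p * u q) * poly (pade_P r k) t"
    if "linear_combination k p q = 0" for k
    using that assms(1) unfolding linear_combination_def t_def[symmetric] by (simp add: mult_ac)
  have e1: "(u p * v q) * poly (pade_Q r n) t = (v p * u q) * poly (pade_P r n) t"
    and e2: "(u p * v q) * poly (pade_Q r (Suc n)) t = (v p * u q) * poly (pade_P r (Suc n)) t"
    using E z by blast+
  have "(u p * v q) * (poly (pade_P r n) t * poly (pade_Q r (Suc n)) t - poly (pade_P r (Suc n)) t * poly (pade_Q r n) t) = 0"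
    "(v p * u q) * (poly (pade_P r n) t * poly (pade_Q r (Suc n)) t - poly (pade_P r (Suc n)) t * poly (pade_Q r n) t) = 0"
    using e1 e2 by algebra+
  then show False using pade_determinant[of r t n] r6 \<open>t \<noteq> 1\<close> assms by auto
qed

lemma norm_s_ge_1: "cmod s \<ge> 1"
proof -
  have "cmod s ^ 2 = \<bar>real_of_int D\<bar>"
    using s_square by (metis norm_of_int norm_power)
  then have "1 \<le> cmod s ^ 2" using D_nonzero by simp
  then show ?thesis using power_less_one_iff[of "cmod s" 2] by (metis norm_ge_zero not_less pos2)
qed

text \<open>Because $A, B, C$ are coprime, so are the values of $Ax^2 + Bxy + Cy^2$ at $(1,0)$, $(0,1)$, $(1,1)$;
  hence $4 r^2 D \mu^r$ is an integer.\<close>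

lemma norm_s_bound: "cmod s ^ (r - 2) \<le> 4 * real r ^ 2 * cmod j ^ r"
proof -
  define \<kappa> where "\<kappa> = 4 * of_nat r ^ 2 * s\<^sup>2 * \<mu> ^ r"
  have ev: "\<exists>m::int. \<kappa> * of_int (A * x\<^sup>2 + B * x * y + C * y\<^sup>2) ^ r = of_int m" for x y :: int
  proof -
    define p where "p = (x, y)"
    have "u p * v p = \<mu> * of_int (A * x\<^sup>2 + B * x * y + C * y\<^sup>2)"
      unfolding u_def v_def quad p_def by simp
    then have "\<kappa> * of_int (A * x\<^sup>2 + B * x * y + C * y\<^sup>2) ^ r = 4 * of_nat r ^ 2 * s\<^sup>2 * (u p * v p) ^ r"
      by (simp add: \<kappa>_def power_mult_distrib mult_ac)
    also have "\<dots> = (2 * of_nat r * s * u p ^ r) * (2 * of_nat r * s * v p ^ r)"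
      by (simp add: power_mult_distrib power2_eq_square)
    also have "\<dots> = of_int (jac p) ^ 2 - s\<^sup>2 * of_int (int r * F p) ^ 2"
      unfolding u_power v_power by (simp add: algebra_simps power2_eq_square)
    also have "\<dots> = of_int (jac p ^ 2 - D * (int r * F p) ^ 2)" unfolding s_square by simp
    finally show ?thesis by blast
  qed
  define g where "g = gcd (A ^ r) (C ^ r)"
  have g1: "gcd g ((A + B + C) ^ r) = 1"
  proof -
    have "gcd A (gcd C (A + B + C)) = 1"
    proof -
      have "gcd A (gcd C (A + B + C)) dvd A" "gcd A (gcd C (A + B + C)) dvd C"
        "gcd A (gcd C (A + B + C)) dvd A + B + C" by (auto intro: dvd_trans)
      moreover from this have "gcd A (gcd C (A + B + C)) dvd (A + B + C) - A - C" by (intro dvd_diff)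
      ultimately have "gcd A (gcd C (A + B + C)) dvd gcd A (gcd B C)" by simp
      then show ?thesis using primitive by simp
    qed
    then have c: "coprime (gcd A C) (A + B + C)" by (simp add: coprime_iff_gcd_eq_1 gcd.assoc)
    have "g = gcd A C ^ r" unfolding g_def by (simp add: gcd_exp)
    then have "coprime g ((A + B + C) ^ r)" using c by (simp add: coprime_power_left_iff coprime_power_right_iff)
    then show ?thesis by (simp add: coprime_iff_gcd_eq_1)
  qed
  obtain a1 a2 where a12: "a1 * A ^ r + a2 * C ^ r = g" unfolding g_def using bezout_int by blast
  obtain b1 b2 where b12: "b1 * g + b2 * (A + B + C) ^ r = 1" using g1 bezout_int[of g "(A + B + C) ^ r"] by auto
  obtain m1 m2 m3 :: int where m: "\<kappa> * of_int A ^ r = of_int m1" "\<kappa> * of_int C ^ r = of_int m2"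
    "\<kappa> * of_int (A + B + C) ^ r = of_int m3"
    using ev[of 1 0] ev[of 0 1] ev[of 1 1] by auto
  have "\<kappa> = \<kappa> * of_int (b1 * (a1 * A ^ r + a2 * C ^ r) + b2 * (A + B + C) ^ r)"
    unfolding a12 b12 by simp
  also have "\<dots> = of_int b1 * (of_int a1 * (\<kappa> * of_int A ^ r) + of_int a2 * (\<kappa> * of_int C ^ r)) +
      of_int b2 * (\<kappa> * of_int (A + B + C) ^ r)"
    by (simp add: algebra_simps)
  also have "\<dots> = of_int (b1 * (a1 * m1 + a2 * m2) + b2 * m3)" unfolding m by simp
  finally obtain m :: int where km: "\<kappa> = of_int m" by blast
  have "\<kappa> \<noteq> 0" using r6 s_nonzero mu_nonzero by (simp add: \<kappa>_def)
  then have "m \<noteq> 0" using km by auto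
  then have "1 \<le> cmod \<kappa>" unfolding km by simp
  then have k1: "1 \<le> 4 * real r ^ 2 * cmod s ^ 2 * cmod \<mu> ^ r"
    by (simp add: \<kappa>_def norm_mult norm_power)
  have "r = 2 + (r - 2)" using r6 by simp
  then have sr: "cmod s ^ r = cmod s ^ 2 * cmod s ^ (r - 2)" by (metis power_add)
  \<comment> \<open>The factor |s|^(r-2) completes |s|^2 |\<mu>|^r to |j|^r.\<close>
  have "cmod s ^ (r - 2) \<le> (4 * real r ^ 2 * cmod s ^ 2 * cmod \<mu> ^ r) * cmod s ^ (r - 2)"
    using k1 mult_right_mono[of 1 _ "cmod s ^ (r - 2)"] by simp
  also have "\<dots> = 4 * real r ^ 2 * cmod j ^ r"
    unfolding j_eq norm_mult power_mult_distrib sr by (simp only: mult_ac)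
  finally show ?thesis .
qed

end

section \<open>Solutions close to the same root of unity\<close>

text \<open>The first bound makes the remainder of the approximation of degree $n$ small enough, the second one
  the contribution of the larger solution, even in degree $n + 1$. The least $n$ with the first bound works.\<close>

lemma choose_degree:
  fixes r :: nat and S h m X J g Q :: real
  assumes r6: "r \<ge> 6" and S: "S \<ge> 1" and h: "h \<ge> 1" and m: "m > 0" and J: "J \<ge> 1"
    and M: "m ^ r \<ge> S ^ 2 * real r ^ 22 * h ^ 9" and gap: "J * m ^ (r - 1) \<le> h * X"
    and g_def: "g = 24 * real r ^ 3 * S" and Q_def: "Q = m ^ r / (9 * g * h ^ 2)"
  obtains n where "24 * h * X < J * m ^ (r - 1) * Q ^ n"
    "2 * h * m * (g * m ^ r) ^ (n + 1) < J * X ^ (r - 1)" "Q \<ge> 1" "g * m ^ r \<ge> 1"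
proof -
  define R where "R = real r"
  define b where "b = r - 1"
  define M where "M = m ^ r"
  have rb: "r = b + 1" using r6 by (simp add: b_def)
  have R: "R \<ge> 6" using r6 by (simp add: R_def)
  have M22: "M \<ge> S ^ 2 * R ^ 22 * h ^ 9" using assms by (simp add: M_def R_def)
  have M0: "M > 0" using m by (simp add: M_def)
  have R2: "R ^ 2 \<ge> 36" using power_mono[of 6 R 2] R by simp
  have g0: "g > 0" using S r6 by (simp add: g_def)
  have g: "g \<le> R ^ 5 * S"
  proof -
    have "g \<le> R ^ 2 * R ^ 3 * S" unfolding g_def R_def[symmetric]
      using R2 R S by (intro mult_right_mono) auto
    then show ?thesis by (simp flip: power_add)
  qed
  have g9: "9 * g * h ^ 2 \<le> R ^ 7 * S * h ^ 2"
  proof -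
    have "9 * g * h ^ 2 \<le> R ^ 2 * (R ^ 5 * S) * h ^ 2"
      using R2 g g0 h by (intro mult_right_mono mult_mono) auto
    then show ?thesis by (simp flip: power_add add: mult.assoc[symmetric])
  qed
  have X0: "X > 0"
  proof -
    have "0 < J * m ^ (r - 1)" using J m by simp
    then have "0 < h * X" using gap by linarith
    then show ?thesis using h by (simp add: zero_less_mult_iff)
  qed
  have lower: "S ^ i * R ^ k * h ^ l \<le> M ^ e" if "i \<le> 2 * e" "k \<le> 22 * e" "l \<le> 9 * e" for i k l e
  proof -
    have "S ^ i * R ^ k * h ^ l \<le> S ^ (2 * e) * R ^ (22 * e) * h ^ (9 * e)"
      using that S R h by (intro mult_mono power_increasing) auto
    also have "\<dots> = (S ^ 2 * R ^ 22 * h ^ 9) ^ e" by (simp add: power_mult power_mult_distrib)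
    also have "\<dots> \<le> M ^ e" using M22 S R h by (intro power_mono) auto
    finally show ?thesis .
  qed
  have QM: "9 * g * h ^ 2 > 0" using g0 h by simp
  have Q2: "Q \<ge> 2"
  proof -
    have "2 * (9 * g * h ^ 2) \<le> R * (R ^ 7 * S * h ^ 2)" using R QM by (intro mult_mono[OF _ g9]) auto
    also have "\<dots> = S ^ 1 * R ^ 8 * h ^ 2" by (simp add: power_Suc[symmetric] eval_nat_numeral)
    also have "\<dots> \<le> M ^ 1" by (rule lower) auto
    finally show ?thesis unfolding Q_def M_def[symmetric] using QM by (simp add: le_divide_eq)
  qed
  have gM: "g * m ^ r \<ge> 1"
  proof -
    have "S ^ 0 * R ^ 0 * h ^ 0 \<le> M ^ 1" by (rule lower) auto
    then have "1 \<le> M" by simp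
    moreover have "24 * 1 * 1 \<le> g" unfolding g_def using S R by (intro mult_mono) (auto simp: R_def)
    ultimately show ?thesis unfolding M_def using mult_mono[of 1 g 1 "m ^ r"] by simp
  qed
  have "1 < Q" using Q2 by simp
  \<comment> \<open>One more factor Q in the lower bound for X gives b factors Q in X^b, enough to
    pay for one more factor g M. This reduces every k to \<open>base\<close>.\<close>
  have step: "g * M \<le> Q ^ b"
  proof -
    have "g * (9 * g * h ^ 2) ^ b \<le> (R ^ 5 * S) * (R ^ 7 * S * h ^ 2) ^ b"
      using g0 QM S R by (intro mult_mono[OF g power_mono[OF g9]]) auto
    also have "\<dots> = S ^ (1 + b) * R ^ (5 + 7 * b) * h ^ (2 * b)"
      by (simp add: power_mult_distrib power_add power_mult)
    also have "\<dots> \<le> M ^ (r - 2)" using r6 by (intro lower) (auto simp: b_def)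
    finally have "(g * (9 * g * h ^ 2) ^ b) * M \<le> M ^ (r - 2) * M"
      using M0 by (intro mult_right_mono) auto
    also have "M ^ (r - 2) * M = M ^ b"
    proof -
      have "b = Suc (r - 2)" using r6 by (simp add: b_def)
      then show ?thesis by simp
    qed
    finally have "g * M \<le> M ^ b / (9 * g * h ^ 2) ^ b"
      using QM by (simp add: le_divide_eq mult_ac)
    then show ?thesis by (simp add: Q_def M_def power_divide)
  qed
  \<comment> \<open>The second claim for n = 1, with X replaced by J m^b / (24 h).\<close>
  have base: "2 * h * m * (g * M) ^ 2 < J * (J * m ^ b / (24 * h)) ^ b"
  proof -
    have "2 * h * g ^ 2 * (24 * h) ^ b \<le> 2 * h * (R ^ 5 * S) ^ 2 * (R ^ 2 * h) ^ b"
      using g g0 R2 h by (intro mult_mono power_mono) auto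
    also have "\<dots> = 2 * (S ^ 2 * R ^ (10 + 2 * b) * h ^ (1 + b))"
      by (simp add: power_mult_distrib power_add power_mult)
    also have "\<dots> < R * (S ^ 2 * R ^ (10 + 2 * b) * h ^ (1 + b))"
      using R S h by (intro mult_strict_right_mono) auto
    also have "\<dots> = S ^ 2 * R ^ (11 + 2 * b) * h ^ (1 + b)"
      by (simp add: power_add eval_nat_numeral)
    also have "\<dots> \<le> M ^ (r - 4)" using r6 by (intro lower) (auto simp: b_def)
    finally have *: "2 * h * g ^ 2 * (24 * h) ^ b < M ^ (r - 4)" .
    have "b * b = 1 + r * 2 + r * (r - 4)"
    proof -
      obtain k where "r = 4 + k" using le_Suc_ex[of 4 r] r6 by auto
      then show ?thesis by (simp add: b_def algebra_simps)
    qed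
    then have mm: "m ^ (b * b) = m * M ^ 2 * M ^ (r - 4)"
      unfolding M_def power_mult[symmetric] by (simp only: power_add power_one_right)
    have "2 * h * m * (g * M) ^ 2 * (24 * h) ^ b = (2 * h * g ^ 2 * (24 * h) ^ b) * (m * M ^ 2)"
      by (simp add: power_mult_distrib)
    also have "\<dots> < M ^ (r - 4) * (m * M ^ 2)"
      using * m M0 by (intro mult_strict_right_mono) auto
    also have "\<dots> = 1 * m ^ (b * b)" unfolding mm by simp
    also have "\<dots> \<le> J ^ (b + 1) * m ^ (b * b)" using J m by (intro mult_right_mono one_le_power) auto
    finally have "2 * h * m * (g * M) ^ 2 < J ^ (b + 1) * m ^ (b * b) / (24 * h) ^ b"
      using h by (simp add: less_divide_eq)
    also have "\<dots> = J * (J * m ^ b / (24 * h)) ^ b"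
      by (simp add: power_divide power_mult_distrib power_mult)
    finally show ?thesis .
  qed
  \<comment> \<open>The degree will be k + 1. Minimality of k then bounds X from below through Q^k;
    for k = 0 the gap hypothesis takes its place.\<close>
  define P where "P k \<longleftrightarrow> 24 * h * X < J * m ^ b * Q ^ (k + 1)" for k
  have Jm: "J * m ^ b > 0" using J m by simp
  have "\<exists>k. P k"
  proof -
    obtain k where "24 * h * X / (J * m ^ b) < Q ^ k" using real_arch_pow[OF \<open>1 < Q\<close>] by blast
    also have "\<dots> \<le> Q ^ (k + 1)" using \<open>1 < Q\<close> by (intro power_increasing) auto
    finally show ?thesis unfolding P_def using Jm by (auto simp: divide_less_eq mult_ac intro!: exI[of _ k])
  qed
  define k where "k = (LEAST k. P k)"
  have Pk: "P k" unfolding k_def using \<open>\<exists>k. P k\<close> by (rule LeastI_ex)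
  have "J * m ^ b * Q ^ k \<le> 24 * h * X"
  proof (cases k)
    case 0
    have "J * m ^ b * Q ^ k \<le> h * X" using gap 0 by (simp add: b_def)
    also have "\<dots> \<le> 24 * h * X" using h X0 by simp
    finally show ?thesis .
  next
    case (Suc l)
    then have "\<not> P l" unfolding k_def using not_less_Least by (metis lessI)
    then show ?thesis unfolding P_def Suc by simp
  qed
  then have "J * m ^ b / (24 * h) * Q ^ k \<le> X" using h by (simp add: field_simps)
  then have "(J * m ^ b / (24 * h) * Q ^ k) ^ b \<le> X ^ b"
    using Jm h \<open>1 < Q\<close> by (intro power_mono) auto
  moreover have "(c * Q ^ k) ^ b = c ^ b * (Q ^ b) ^ k" for c
    by (simp add: power_mult_distrib mult.commute flip: power_mult)
  ultimately have Xb: "(J * m ^ b / (24 * h)) ^ b * (Q ^ b) ^ k \<le> X ^ b" by (simp only:)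
  have "2 * h * m * (g * M) ^ ((k + 1) + 1) = (2 * h * m * (g * M) ^ 2) * (g * M) ^ k"
    by (simp add: power2_eq_square)
  also have "\<dots> < J * (J * m ^ b / (24 * h)) ^ b * (g * M) ^ k"
    using base g0 M0 by (intro mult_strict_right_mono) auto
  also have "\<dots> \<le> J * (J * m ^ b / (24 * h)) ^ b * (Q ^ b) ^ k"
    using step g0 M0 J Jm h by (intro mult_left_mono power_mono) auto
  also have "\<dots> = J * ((J * m ^ b / (24 * h)) ^ b * (Q ^ b) ^ k)" by simp
  also have "\<dots> \<le> J * X ^ b" using Xb J by (intro mult_left_mono) auto
  finally have "2 * h * m * (g * M) ^ ((k + 1) + 1) < J * X ^ b" .
  then show ?thesis
    using that[of "k + 1"] Pk \<open>1 < Q\<close> gM by (simp add: P_def M_def b_def)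
qed

context diagonal_form
begin

text \<open>The linearization r u^(r-1) (u - v) of u^r - v^r, which is at most h in modulus at a
  solution. The 3 is the product of the losses 2 and 3/2 from the logarithm and the exponential in
  \<open>large_solution\<close>.\<close>

definition "close h p \<longleftrightarrow> u p \<noteq> 0 \<and> cmod (v p - u p) * (real r * cmod (u p) ^ (r - 1)) \<le> 3 * h"

lemma close_bound:
  assumes "close h p"
  shows "cmod (v p - u p) \<le> h / (2 * cmod (u p) ^ (r - 1))"
proof -
  have "u p \<noteq> 0" using assms by (simp add: close_def)
  then have pos: "cmod (u p) ^ (r - 1) > 0" by simp
  have "cmod (v p - u p) * (6 * cmod (u p) ^ (r - 1)) \<le> cmod (v p - u p) * (real r * cmod (u p) ^ (r - 1))"
    using r6 by (intro mult_left_mono mult_right_mono) auto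
  also have "\<dots> \<le> 3 * h" using assms by (simp add: close_def)
  finally show ?thesis using pos by (simp add: field_simps)
qed

text \<open>A nonzero area gives |u(p) v(q) - u(q) v(p)| >= |j|. The same quantity is u(p) (v(q) -
  u(q)) - u(q) (v(p) - u(p)), in which both differences are tiny.\<close>

lemma gap_principle:
  assumes "close h p" "close h q" "h \<ge> 0" and le: "cmod (u p) \<le> cmod (u q)" and "area p q \<noteq> 0"
  shows "cmod j * cmod (u p) ^ (r - 1) \<le> h * cmod (u q)"
proof -
  define m1 m2 b where "m1 = cmod (u p)" and "m2 = cmod (u q)" and "b = r - 1"
  have pos: "m1 > 0" "m2 > 0" using assms by (auto simp: close_def m1_def m2_def)
  have "cmod j * 1 \<le> cmod j * \<bar>real_of_int (area p q)\<bar>"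
    using assms by (intro mult_left_mono) auto
  also have "\<dots> = cmod (u p * v q - u q * v p)" unfolding uv_area by (simp add: norm_mult)
  also have "\<dots> = cmod (u p * (v q - u q) - u q * (v p - u p))" by (simp add: algebra_simps)
  also have "\<dots> \<le> m1 * cmod (v q - u q) + m2 * cmod (v p - u p)"
    using norm_triangle_ineq4[of "u p * (v q - u q)" "u q * (v p - u p)"]
    by (simp add: norm_mult m1_def m2_def)
  also have "\<dots> \<le> m2 * (h / (2 * m1 ^ b)) + m2 * (h / (2 * m1 ^ b))"
  proof (intro add_mono mult_mono)
    have "cmod (v q - u q) \<le> h / (2 * m2 ^ b)"
      using close_bound[OF assms(2)] by (simp add: m2_def b_def)
    also have "\<dots> \<le> h / (2 * m1 ^ b)"
      using pos le \<open>h \<ge> 0\<close> by (intro divide_left_mono mult_left_mono power_mono) (auto simp: m1_def m2_def)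
    finally show "cmod (v q - u q) \<le> h / (2 * m1 ^ b)" .
    show "cmod (v p - u p) \<le> h / (2 * m1 ^ b)"
      using close_bound[OF assms(1)] by (simp add: m1_def b_def)
  qed (use pos le in \<open>auto simp: m1_def m2_def\<close>)
  also have "\<dots> = h * m2 / m1 ^ b" by simp
  finally show ?thesis using pos by (simp add: field_simps m1_def m2_def b_def)
qed

text \<open>The solution q supplies the approximants and p is the point at which they are tested. A
  nonzero combination, multiplied by (2rs)^n, has modulus at least |j|, while the remainder and the
  term with v(p) - u(p) each contribute less than |j|/2.\<close>

lemma approximation_contradiction:
  assumes h: "h \<ge> 1" and p: "close h p" and q: "close h q" and Fq: "F q \<noteq> 0" and J: "cmod j \<ge> 1"
    and large: "cmod (u q) ^ r \<ge> cmod s ^ 2 * real r ^ 22 * h ^ 9"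
    and gap: "cmod j * cmod (u q) ^ (r - 1) \<le> h * cmod (u p)"
  shows False
proof -
  define m X R b where "m = cmod (u q)" and "X = cmod (u p)" and "R = real r" and "b = r - 1"
  define M where "M = m ^ r"
  define g where "g = 24 * R ^ 3 * cmod s"
  define Q where "Q = M / (9 * g * h ^ 2)"
  define \<epsilon> where "\<epsilon> = 3 * h / M"
  define w where "w = v q / u q"
  have nz: "u q \<noteq> 0" "u p \<noteq> 0" using p q by (auto simp: close_def)
  then have m0: "m > 0" and X0: "X > 0" by (auto simp: m_def X_def)
  have M0: "M > 0" using m0 by (simp add: M_def)
  have R: "R \<ge> 6" using r6 by (simp add: R_def)
  have Mb: "M = m * m ^ b" unfolding M_def b_def using r6 by (simp add: power_eq_if)
  obtain N where N: "24 * h * X < J * m ^ b * Q ^ N" "2 * h * m * (g * M) ^ (N + 1) < J * X ^ b"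
    and Q1: "Q \<ge> 1" and gM1: "g * M \<ge> 1" if "J = cmod j" for J
    using choose_degree[OF r6 norm_s_ge_1 h m0[unfolded m_def] J large gap refl refl]
    unfolding m_def M_def X_def R_def b_def g_def Q_def by metis
  note N = N[OF refl] and Q1 = Q1[OF refl] and gM1 = gM1[OF refl]
  have g0: "g > 0" using R s_nonzero by (simp add: g_def)
  have "3 * h \<le> M"
  proof -
    have "3 * h \<le> 1 * R ^ 22 * h ^ 9"
    proof -
      have "3 * h ^ 1 \<le> R ^ 22 * h ^ 9"
        using R h order_trans[OF _ self_le_power[of R 22]] by (intro mult_mono power_increasing) auto
      then show ?thesis by simp
    qed
    also have "\<dots> \<le> cmod s ^ 2 * R ^ 22 * h ^ 9"
      using norm_s_ge_1 R h by (intro mult_right_mono) auto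
    finally show ?thesis using large by (simp add: M_def m_def R_def)
  qed
  then have \<epsilon>1: "\<epsilon> \<le> 1" using M0 by (simp add: \<epsilon>_def)
  have \<epsilon>0: "\<epsilon> > 0" using M0 h by (simp add: \<epsilon>_def)
  have w1: "R * cmod (w - 1) \<le> \<epsilon>"
  proof -
    have "w - 1 = (v q - u q) / u q" using nz by (simp add: w_def field_simps)
    then have "cmod (w - 1) = cmod (v q - u q) / m" by (simp add: norm_divide m_def)
    moreover have "cmod (v q - u q) * (R * m ^ b) \<le> 3 * h"
      using q by (simp add: close_def R_def m_def b_def)
    then have "R * (cmod (v q - u q) / m) \<le> \<epsilon>"
      using m0 unfolding \<epsilon>_def Mb by (simp add: field_simps)
    ultimately show ?thesis by simp
  qed
  have "v q \<noteq> 0"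
  proof
    assume "v q = 0"
    then have "R * 1 \<le> 1" using w1 \<epsilon>1 by (simp add: w_def)
    then show False using R by simp
  qed
  \<comment> \<open>Phrased as |j| < |j|: a nonzero combination in either of the degrees N and N + 1
    is already contradictory.\<close>
  have bound: "cmod j < cmod j" if nonzero: "linear_combination n p q \<noteq> 0" and n: "n \<in> {N, N + 1}" for n
  proof -
    define P1 where "P1 = poly (pade_P r n) (w ^ r)"
    define Q1' where "Q1' = poly (pade_Q r n) (w ^ r)"
    have wr: "v q ^ r / u q ^ r = w ^ r" by (simp add: w_def power_divide)
    have vq: "v q = u q * w" using nz by (simp add: w_def)
    have "linear_combination n p q = (u q ^ r) ^ n * u q * (u p * (w * Q1' - P1) - (v p - u p) * P1)"
      unfolding linear_combination_def wr P1_def[symmetric] Q1'_def[symmetric]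
      unfolding vq by (simp add: algebra_simps)
    then have "cmod (linear_combination n p q) = M ^ n * m * cmod (u p * (w * Q1' - P1) - (v p - u p) * P1)"
      by (simp add: norm_mult norm_power M_def m_def)
    also have "\<dots> \<le> M ^ n * m * (X * (4 * (12 * R ^ 2) ^ n * \<epsilon> ^ (2 * n + 1)) + h / X ^ b * (12 * R ^ 2) ^ n)"
    proof (rule mult_left_mono)
      have "cmod (w * Q1' - P1) \<le> 4 * (12 * R ^ 2) ^ n * (R * cmod (w - 1)) ^ (2 * n + 1)"
        unfolding P1_def Q1'_def R_def using w1 \<epsilon>1 r6 by (intro pade_remainder_bound) (auto simp: R_def)
      also have "\<dots> \<le> 4 * (12 * R ^ 2) ^ n * \<epsilon> ^ (2 * n + 1)"
        using w1 R by (intro mult_left_mono power_mono) auto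
      finally have 1: "cmod (w * Q1' - P1) \<le> 4 * (12 * R ^ 2) ^ n * \<epsilon> ^ (2 * n + 1)" .
      have 2: "cmod P1 \<le> (12 * R ^ 2) ^ n"
        unfolding P1_def R_def using w1 \<epsilon>1 r6 by (intro pade_P_bound) (auto simp: R_def)
      have "cmod (v p - u p) \<le> h / (2 * X ^ b)"
        using close_bound[OF p] by (simp add: X_def b_def)
      also have "\<dots> \<le> h / X ^ b" using X0 h by (intro divide_left_mono) auto
      finally have 3: "cmod (v p - u p) \<le> h / X ^ b" .
      have "cmod (u p * (w * Q1' - P1) - (v p - u p) * P1) \<le>
          X * cmod (w * Q1' - P1) + cmod (v p - u p) * cmod P1"
        using norm_triangle_ineq4[of "u p * (w * Q1' - P1)" "(v p - u p) * P1"]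
        by (simp add: norm_mult X_def)
      also have "\<dots> \<le> X * (4 * (12 * R ^ 2) ^ n * \<epsilon> ^ (2 * n + 1)) + h / X ^ b * (12 * R ^ 2) ^ n"
        using 1 2 3 X0 h by (intro add_mono mult_mono) auto
      finally show "cmod (u p * (w * Q1' - P1) - (v p - u p) * P1) \<le>
          X * (4 * (12 * R ^ 2) ^ n * \<epsilon> ^ (2 * n + 1)) + h / X ^ b * (12 * R ^ 2) ^ n" .
    qed (use M0 m0 in auto)
    finally have bound_n: "cmod (linear_combination n p q) \<le>
        M ^ n * m * (X * (4 * (12 * R ^ 2) ^ n * \<epsilon> ^ (2 * n + 1)) + h / X ^ b * (12 * R ^ 2) ^ n)" .
    have upper: "cmod (linear_combination n p q) \<le> (12 * R ^ 2) ^ n * M ^ n *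
        (4 * X * m * \<epsilon> * (\<epsilon> ^ 2) ^ n + h * m / X ^ b)"
    proof -
      have "\<epsilon> ^ (2 * n + 1) = \<epsilon> * (\<epsilon> ^ 2) ^ n" by (simp add: power_mult)
      moreover have "z * m * (X * (4 * c * (\<epsilon> * d)) + h / e * c) = c * z * (4 * X * m * \<epsilon> * d + h * m / e)"
        for z c d e by (simp add: algebra_simps)
      ultimately show ?thesis using bound_n by (simp only:)
    qed
    obtain k :: int where k: "(2 * of_nat r * s) ^ n * linear_combination n p q = j * of_int k"
      using linear_combination_integral[OF nz(1)] by blast
    then have "k \<noteq> 0" using nonzero s_nonzero r6 by auto
    then have "cmod j * 1 \<le> cmod j * \<bar>real_of_int k\<bar>" by (intro mult_left_mono) auto
    also have "\<dots> = cmod ((2 * of_nat r * s) ^ n * linear_combination n p q)"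
      unfolding k by (simp add: norm_mult)
    also have "\<dots> = (2 * R * cmod s) ^ n * cmod (linear_combination n p q)"
      by (simp add: norm_mult norm_power R_def)
    also have "\<dots> \<le> (2 * R * cmod s) ^ n * ((12 * R ^ 2) ^ n * M ^ n *
        (4 * X * m * \<epsilon> * (\<epsilon> ^ 2) ^ n + h * m / X ^ b))"
      using upper R by (intro mult_left_mono) auto
    also have "\<dots> = (g * M) ^ n * (4 * X * m * \<epsilon> * (\<epsilon> ^ 2) ^ n + h * m / X ^ b)"
    proof -
      have "g * M = (2 * R * cmod s) * ((12 * R ^ 2) * M)" by (simp add: g_def eval_nat_numeral)
      then show ?thesis by (simp only: power_mult_distrib mult.assoc)
    qed
    also have "\<dots> = 4 * X * m * \<epsilon> * (g * M * \<epsilon> ^ 2) ^ n + h * m * (g * M) ^ n / X ^ b"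
      by (simp add: algebra_simps power_mult_distrib)
    \<comment> \<open>The origin of Q: each unit of degree costs g M for clearing denominators and
      homogenizing, and gains the square of the closeness \<epsilon>.\<close>
    also have "g * M * \<epsilon> ^ 2 = 1 / Q"
      using M0 by (simp add: \<epsilon>_def Q_def power2_eq_square field_simps)
    also have "4 * X * m * \<epsilon> * (1 / Q) ^ n = 12 * h * X / (m ^ b * Q ^ n)"
      using m0 by (simp add: \<epsilon>_def Mb power_divide)
    also have "\<dots> < cmod j / 2"
    proof -
      have "24 * h * X < cmod j * m ^ b * Q ^ N" by (rule N)
      also have "\<dots> \<le> cmod j * m ^ b * Q ^ n"
        using n Q1 m0 by (intro mult_left_mono power_increasing) auto
      finally show ?thesis using m0 Q1 by (simp add: field_simps)
    qed
    \<comment> \<open>Here the larger degree is the worse one, so the bound for N + 1 is used; in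
      the preceding term Q >= 1 makes N the worse one.\<close>
    also have "h * m * (g * M) ^ n / X ^ b < cmod j / 2"
    proof -
      have "2 * h * m * (g * M) ^ n \<le> 2 * h * m * (g * M) ^ (N + 1)"
        using n gM1 h m0 by (intro mult_left_mono power_increasing) auto
      also have "\<dots> < cmod j * X ^ b" by (rule N)
      finally show ?thesis using X0 by (simp add: field_simps)
    qed
    finally show ?thesis by simp
  qed
  show False
    using linear_combination_nonzero[of q p N] bound[of N] bound[of "N + 1"] nz \<open>v q \<noteq> 0\<close> Fq by auto
qed

text \<open>The approximants at q are useful only if |u(q)|^r exceeds a multiple of |s|^2. Since
  |s|^2 <= 4 r^2 |j|^r by \<open>norm_s_bound\<close>, and the gap from p to q, raised to the power
  r, contains exactly |j|^r, the smallest solution p provides this.\<close>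

lemma no_three_close:
  assumes h: "h \<ge> 1" and cl: "close h p" "close h q" "close h t"
    and area: "area p q \<noteq> 0" "area q t \<noteq> 0" and Fq: "F q \<noteq> 0"
    and le: "cmod (u p) \<le> cmod (u q)" "cmod (u q) \<le> cmod (u t)"
    and J: "cmod j \<ge> 1" and large: "cmod (u p) ^ r \<ge> real r ^ 5 * h ^ 3"
  shows False
proof -
  define m1 m2 R b J where "m1 = cmod (u p)" and "m2 = cmod (u q)" and "R = real r" and "b = r - 1"
    and "J = cmod j"
  have R: "R \<ge> 6" using r6 by (simp add: R_def)
  have J1: "J \<ge> 1" using J by (simp add: J_def)
  have pos: "m1 > 0" "m2 > 0" using cl by (auto simp: close_def m1_def m2_def)
  have "J * m1 ^ b \<le> h * m2"
    using gap_principle[OF cl(1,2) _ le(1) area(1)] h by (simp add: m1_def m2_def b_def J_def)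
  then have "(J * m1 ^ b) ^ r \<le> (h * m2) ^ r" using J1 pos by (intro power_mono) auto
  then have 1: "J ^ r * (m1 ^ r) ^ b \<le> h ^ r * m2 ^ r"
    by (simp add: power_mult_distrib mult.commute flip: power_mult)
  have "cmod s ^ 2 * R ^ 22 * h ^ 9 * h ^ r \<le> (4 * R ^ 2 * J ^ r) * R ^ 22 * h ^ 9 * h ^ r"
  proof -
    have "cmod s ^ 2 \<le> cmod s ^ (r - 2)" using norm_s_ge_1 r6 by (intro power_increasing) auto
    also have "\<dots> \<le> 4 * R ^ 2 * J ^ r" using norm_s_bound by (simp add: R_def J_def)
    finally show ?thesis using R h by (intro mult_right_mono) auto
  qed
  also have "\<dots> = J ^ r * (4 * R ^ 24 * h ^ (9 + r))" by (simp add: power_add eval_nat_numeral)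
  also have "\<dots> \<le> J ^ r * (R ^ (5 * b) * h ^ (3 * b))"
  \<comment> \<open>Here r >= 6 enters: 25 <= 5 (r - 1) and 9 + r <= 3 (r - 1). One of the 25
    factors R covers the 4.\<close>
  proof (intro mult_left_mono mult_mono)
    have "4 * R ^ 24 \<le> R * R ^ 24" using R by (intro mult_right_mono) auto
    also have "\<dots> = R ^ 25" by (simp add: eval_nat_numeral)
    also have "\<dots> \<le> R ^ (5 * b)" using R r6 by (intro power_increasing) (auto simp: b_def)
    finally show "4 * R ^ 24 \<le> R ^ (5 * b)" .
    show "h ^ (9 + r) \<le> h ^ (3 * b)" using h r6 by (intro power_increasing) (auto simp: b_def)
  qed (use R J1 h in auto)
  also have "\<dots> = J ^ r * (R ^ 5 * h ^ 3) ^ b" by (simp add: power_mult power_mult_distrib)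
  also have "\<dots> \<le> J ^ r * (m1 ^ r) ^ b"
    using large R h J1 by (intro mult_left_mono power_mono) (auto simp: m1_def R_def)
  also note 1
  finally have "cmod s ^ 2 * R ^ 22 * h ^ 9 \<le> m2 ^ r" using h by simp
  then show False
    using approximation_contradiction[OF h cl(3,2) Fq J] gap_principle[OF cl(2,3) _ le(2) area(2)] h
    by (simp add: m2_def R_def)
qed

end

section \<open>The discriminant and the roots of unity\<close>

lemma prod_root_factors:
  assumes "r > 0"
  shows "(\<Prod>i<r. [:- cis (2 * pi * real i / real r), 1:]) = monom 1 r - 1"
proof -
  define f where "f i = cis (2 * pi * real i / real r)" for i
  define P where "P = (\<Prod>i<r. [:- f i, 1:])"
  define G where "G = monom 1 r - 1 - P"
  have bij: "bij_betw f {..<r} {z. z ^ r = 1}"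
    unfolding f_def using assms by (rule Complex.bij_betw_roots_unity)
  have "degree P = r" unfolding P_def by (simp add: degree_prod_eq_sum_degree)
  moreover have "lead_coeff P = 1" unfolding P_def lead_coeff_prod by simp
  ultimately have degP: "degree P = r" "coeff P r = 1" by simp_all
  have "G = 0"
  proof (rule ccontr)
    assume "G \<noteq> 0"
    have "degree (monom 1 r - 1 :: complex poly) \<le> r"
      by (intro degree_diff_le degree_monom_le) simp
    then have "degree G \<le> r" unfolding G_def using degP(1) by (rule degree_diff_le[OF _ eq_refl])
    moreover have "coeff G r = 0" using degP assms by (simp add: G_def)
    ultimately have "degree G < r"
      using \<open>G \<noteq> 0\<close> by (metis leading_coeff_0_iff le_neq_implies_less)
    have "{z. z ^ r = 1} \<subseteq> {z. poly G z = 0}"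
    proof
      fix z :: complex assume z: "z \<in> {z. z ^ r = 1}"
      then obtain i where "i < r" "z = f i" using bij by (auto simp: bij_betw_def)
      then have "poly P z = 0" unfolding P_def poly_prod by (intro prod_zero) auto
      then show "z \<in> {z. poly G z = 0}" using z by (simp add: G_def poly_monom)
    qed
    then have "r \<le> card {z. poly G z = 0}"
      using card_mono[OF poly_roots_finite[OF \<open>G \<noteq> 0\<close>]] card_roots_unity_eq[OF assms] by metis
    then show False using card_poly_roots_bound[OF \<open>G \<noteq> 0\<close>] \<open>degree G < r\<close> by simp
  qed
  then show ?thesis by (simp add: G_def P_def f_def)
qed

text \<open>The linear factors are u - f_i v for the r-th roots of unity f_i, with pairwise
  determinants (f_i - f_k) j. For fixed i the product of all f_i - f_k is the derivative of X^r - 1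
  at f_i, of modulus r.\<close>

lemma diagonal_discriminant:
  assumes r: "r > 0" and diag: "diagonalization r a \<alpha> \<beta> \<gamma> \<delta>"
  shows "cmod (form_discriminant r a) = real r ^ r * cmod (\<alpha> * \<delta> - \<beta> * \<gamma>) ^ (r * (r - 1))"
proof -
  define f where "f i = cis (2 * pi * real i / real r)" for i
  define c where "c = \<alpha> * \<delta> - \<beta> * \<gamma>"
  have P: "(\<Prod>i<r. [:- f i, 1:]) = monom 1 r - 1"
    unfolding f_def using r by (rule prod_root_factors)
  have fr: "f i ^ r = 1" if "i < r" for i
    using Complex.bij_betw_roots_unity[OF r] that by (auto simp: bij_betw_def f_def)
  have fact: "(\<Prod>i<r. z - f i * w) = z ^ r - w ^ r" for z w
  proof (cases "w = 0")
    case False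
    have "(\<Prod>i<r. z - f i * w) = (\<Prod>i<r. w * (z / w - f i))"
      using False by (intro prod.cong) (auto simp: field_simps)
    also have "\<dots> = w ^ r * poly (\<Prod>i<r. [:- f i, 1:]) (z / w)"
      by (simp add: prod.distrib poly_prod)
    also have "\<dots> = z ^ r - w ^ r"
      unfolding P using False by (simp add: poly_monom power_divide field_simps)
    finally show ?thesis .
  qed (use r in simp)
  have lf: "linear_factorization r a (\<lambda>i. \<alpha> - f i * \<gamma>) (\<lambda>i. \<beta> - f i * \<delta>)"
    unfolding linear_factorization_def
  proof (intro allI)
    fix x y
    have "(\<Prod>i<r. (\<alpha> - f i * \<gamma>) * x + (\<beta> - f i * \<delta>) * y) =
        (\<Prod>i<r. (\<alpha> * x + \<beta> * y) - f i * (\<gamma> * x + \<delta> * y))"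
      by (intro prod.cong) (auto simp: algebra_simps)
    then show "binary_form r a x y = (\<Prod>i<r. (\<alpha> - f i * \<gamma>) * x + (\<beta> - f i * \<delta>) * y)"
      unfolding fact using diag by (simp add: diagonalization_def)
  qed
  have diffs: "cmod (\<Prod>k\<in>{..<r} - {i}. f i - f k) = real r" if i: "i < r" for i
  proof -
    define Z where "Z = (\<Prod>k\<in>{..<r} - {i}. [:- f k, 1:])"
    have "poly (pderiv (\<Prod>k<r. [:- f k, 1:])) (f i) = of_nat r * f i ^ (r - 1)"
      unfolding P by (simp add: pderiv_diff pderiv_monom poly_monom)
    moreover have "{..<r} = insert i ({..<r} - {i})" using i by auto
    then have "(\<Prod>k<r. [:- f k, 1:]) = [:- f i, 1:] * Z"
      unfolding Z_def by (metis (no_types, lifting) finite_lessThan i lessThan_iff prod.remove)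
    moreover have "poly (pderiv ([:- f i, 1:] * Z)) (f i) = poly Z (f i)"
      by (simp only: pderiv_mult) (simp add: pderiv_pCons)
    ultimately have "(\<Prod>k\<in>{..<r} - {i}. f i - f k) = of_nat r * f i ^ (r - 1)"
      by (simp add: Z_def poly_prod)
    then show ?thesis by (simp add: norm_mult norm_power f_def)
  qed
  define g where "g i k = (f i - f k) * c" for i k
  have "(\<alpha> - f i * \<gamma>) * (\<beta> - f k * \<delta>) - (\<alpha> - f k * \<gamma>) * (\<beta> - f i * \<delta>) = g i k" for i k
    unfolding g_def c_def by (simp add: algebra_simps)
  then have "form_discriminant r a = (\<Prod>k<r. \<Prod>i<k. (g i k)\<^sup>2)"
    unfolding form_discriminant_eq[OF lf] by simp
  then have "cmod (form_discriminant r a) =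
      cmod ((\<Prod>j<r. \<Prod>i<j. - 1) * (\<Prod>j<r. \<Prod>i<j. (g i j)\<^sup>2))"
    by (simp add: norm_mult norm_power flip: prod_norm)
  also have "\<dots> = cmod (\<Prod>i<r. \<Prod>k\<in>{..<r} - {i}. g i k)"
    by (subst prod_pairs_square) (simp_all add: g_def algebra_simps)
  also have "\<dots> = (\<Prod>i<r. real r * cmod c ^ (r - 1))"
    unfolding prod_norm[symmetric, of _ "{..<r}"]
  proof (intro prod.cong refl)
    fix i assume "i \<in> {..<r}"
    then have i: "i < r" by simp
    have "(\<Prod>k\<in>{..<r} - {i}. g i k) = (\<Prod>k\<in>{..<r} - {i}. f i - f k) * c ^ (r - 1)"
      unfolding g_def prod.distrib using i by simp
    then show "cmod (\<Prod>k\<in>{..<r} - {i}. g i k) = real r * cmod c ^ (r - 1)"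
      using diffs[OF i] by (simp add: norm_mult norm_power)
  qed
  also have "\<dots> = real r ^ r * cmod c ^ (r * (r - 1))"
    by (simp add: power_mult_distrib mult.commute flip: power_mult)
  finally show ?thesis by (simp add: c_def)
qed

lemma norm_exp_minus_one_le:
  fixes t :: complex
  assumes "cmod t \<le> 1 / 3"
  shows "cmod (exp t - 1) \<le> 3 / 2 * cmod t"
proof -
  have "cmod (exp t - 1) \<le> exp \<bar>Re t\<bar> * cmod t"
    using Taylor_exp[of t 0] by simp
  also have "exp \<bar>Re t\<bar> \<le> 3 / 2"
  proof -
    have "\<bar>Re t\<bar> \<le> 1 / 3" using abs_Re_le_cmod[of t] assms by linarith
    then have "exp \<bar>Re t\<bar> \<le> exp (1 / 3)" by simp
    also have "\<dots> \<le> 3 / 2" using exp_bound[of "1 / 3 :: real"] by (simp add: power2_eq_square)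
    finally show ?thesis .
  qed
  finally show ?thesis by (simp add: mult_right_mono)
qed

section \<open>The root of unity attached to a large solution\<close>

context diagonal_form
begin

text \<open>Multiplying v by a root of unity preserves F and multiplies j and \<mu> alike, so s is
  unchanged. Statements about the root 1 thereby carry over to every root.\<close>

lemma rotate:
  assumes "\<rho> ^ r = 1"
  shows "diagonal_form r a \<alpha> \<beta> (\<rho> * \<gamma>) (\<rho> * \<delta>) (\<rho> * \<mu>) A B C"
proof
  have "\<rho> \<noteq> 0" using assms r6 by (auto simp: power_0_left)
  have e: "\<alpha> * (\<rho> * \<delta>) - \<beta> * (\<rho> * \<gamma>) = \<rho> * j" by (simp add: j_def algebra_simps)
  have "(\<rho> * \<gamma> * x + \<rho> * \<delta> * y) ^ r = (\<gamma> * x + \<delta> * y) ^ r" for x y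
  proof -
    have "\<rho> * \<gamma> * x + \<rho> * \<delta> * y = \<rho> * (\<gamma> * x + \<delta> * y)" by (simp add: algebra_simps)
    then show ?thesis by (simp add: power_mult_distrib assms)
  qed
  then show "diagonalization r a \<alpha> \<beta> (\<rho> * \<gamma>) (\<rho> * \<delta>)"
    using diag \<open>\<rho> \<noteq> 0\<close> j_nonzero unfolding diagonalization_def e by auto
  fix x y
  have "(\<alpha> * x + \<beta> * y) * (\<rho> * \<gamma> * x + \<rho> * \<delta> * y) = \<rho> * ((\<alpha> * x + \<beta> * y) * (\<gamma> * x + \<delta> * y))"
    by (simp add: algebra_simps)
  then show "(\<alpha> * x + \<beta> * y) * (\<rho> * \<gamma> * x + \<rho> * \<delta> * y) =
      \<rho> * \<mu> * (of_int A * x\<^sup>2 + of_int B * x * y + of_int C * y\<^sup>2)"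
    unfolding quad by simp
qed (use r6 primitive in auto)

lemma norm_root:
  assumes "\<rho> ^ r = (1::complex)"
  shows "cmod \<rho> = 1"
proof -
  have "cmod \<rho> ^ r = 1 ^ r" using assms by (simp flip: norm_power)
  then show ?thesis using r6 by (intro power_eq_imp_eq_base[of "cmod \<rho>" r 1]) auto
qed

definition "near h \<rho> p \<longleftrightarrow> u p \<noteq> 0 \<and> cmod (\<rho> * v p - u p) * (real r * cmod (u p) ^ (r - 1)) \<le> 3 * h"

lemma no_three_near:
  assumes h: "h \<ge> 1" and J: "cmod j \<ge> 1" and \<rho>: "\<rho> ^ r = 1"
    and G: "\<And>p. p \<in> G \<Longrightarrow> near h \<rho> p \<and> F p \<noteq> 0 \<and> cmod (u p) ^ r \<ge> real r ^ 5 * h ^ 3"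
    and area: "\<And>p q. p \<in> G \<Longrightarrow> q \<in> G \<Longrightarrow> p \<noteq> q \<Longrightarrow> area p q \<noteq> 0"
    and mem: "p \<in> G" "q \<in> G" "t \<in> G" and ne: "p \<noteq> q" "p \<noteq> t" "q \<noteq> t"
  shows False
proof -
  interpret R: diagonal_form r a \<alpha> \<beta> "\<rho> * \<gamma>" "\<rho> * \<delta>" "\<rho> * \<mu>" A B C
    using \<rho> by (rule rotate)
  have "cmod \<rho> = 1" using \<rho> by (rule norm_root)
  moreover have "R.j = \<rho> * j" unfolding R.j_def j_def by (simp add: algebra_simps)
  ultimately have RJ: "cmod R.j \<ge> 1" using J by (simp add: norm_mult)
  have Rv: "R.v p = \<rho> * v p" for p unfolding R.v_def v_def by (simp add: algebra_simps)
  have key: False if "x \<in> G" "y \<in> G" "z \<in> G" "x \<noteq> y" "y \<noteq> z"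
    "cmod (u x) \<le> cmod (u y)" "cmod (u y) \<le> cmod (u z)" for x y z
  proof -
    have cl: "R.close h p" if "p \<in> G" for p
      using G[OF that] by (simp add: R.close_def near_def Rv)
    show False
      using R.no_three_close[OF h cl[OF that(1)] cl[OF that(2)] cl[OF that(3)]]
        area[OF that(1,2,4)] area[OF that(2,3,5)] G[OF that(1)] G[OF that(2)] that(6,7) RJ
      by simp
  qed
  show False
    using key[OF mem(1) mem(2) mem(3)] key[OF mem(1) mem(3) mem(2)] key[OF mem(2) mem(1) mem(3)]
      key[OF mem(2) mem(3) mem(1)] key[OF mem(3) mem(1) mem(2)] key[OF mem(3) mem(2) mem(1)] ne
    by (smt (verit))
qed

definition "height p = max (cmod (u p)) (cmod (v p))"

text \<open>For large |j| two distinct solutions cannot both have small height; this is the source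
  of the single exceptional solution in the count.\<close>

lemma height_product:
  assumes "area p q \<noteq> 0"
  shows "cmod j \<le> 2 * height p * height q"
proof -
  have "cmod j * 1 \<le> cmod j * \<bar>real_of_int (area p q)\<bar>"
    using assms by (intro mult_left_mono) auto
  also have "\<dots> = cmod (u p * v q - u q * v p)" unfolding uv_area by (simp add: norm_mult)
  also have "\<dots> \<le> cmod (u p) * cmod (v q) + cmod (v p) * cmod (u q)"
    using norm_triangle_ineq4[of "u p * v q" "u q * v p"] by (simp add: norm_mult mult.commute)
  also have "\<dots> \<le> height p * height q + height p * height q"
    unfolding height_def by (intro add_mono mult_mono) (auto simp: le_max_iff_disj)
  finally show ?thesis by simp
qed

text \<open>Here v^r / u^r = 1 + \<zeta> with \<zeta> small, and \<rho> is defined by \<rho> v =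
  exp(t) u, where exp(t) is the principal r-th root of 1 + \<zeta>. The principal branch makes the
  factor positive when the ratio is real.\<close>

lemma large_solution:
  assumes h: "h \<ge> 1" and F: "\<bar>real_of_int (F p)\<bar> \<le> h" and large: "height p ^ r \<ge> real r ^ 6 * h ^ 3"
  shows "cmod (u p) ^ r \<ge> real r ^ 5 * h ^ 3 \<and> (\<exists>\<rho>. \<rho> ^ r = 1 \<and> near h \<rho> p \<and>
    (v p ^ r / u p ^ r \<in> \<real> \<longrightarrow> (\<exists>\<tau>>0. \<rho> * v p = of_real \<tau> * u p)))"
proof -
  define R U V where "R = real r" and "U = u p ^ r" and "V = v p ^ r"
  define \<zeta> where "\<zeta> = - of_int (F p) / U"
  have R: "R \<ge> 6" using r6 by (simp add: R_def)
  have UV: "U - V = of_int (F p)" using form_eq[of p] by (simp add: U_def V_def)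
  have h3: "h \<le> h ^ 3" using h self_le_power[of h 3] by simp
  have hR: "6 * h \<le> R ^ 5 * h ^ 3"
  proof (rule mult_mono)
    show "6 \<le> R ^ 5" using R self_le_power[of R 5] by linarith
  qed (use h h3 R in auto)
  have "R ^ 5 * h ^ 3 \<le> cmod U"
  proof -
    have "height p ^ r \<le> cmod U + h"
    proof (cases "cmod (u p) \<ge> cmod (v p)")
      case True
      then show ?thesis using h by (simp add: height_def U_def norm_power max_def)
    next
      case False
      then have "height p ^ r = cmod V" by (simp add: height_def V_def norm_power max_def)
      also have "\<dots> = cmod (U - (U - V))" by simp
      also have "\<dots> \<le> cmod U + cmod (U - V)" by (rule norm_triangle_ineq4)
      also have "cmod (U - V) \<le> h" unfolding UV using F by simp
      finally show ?thesis by simp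
    qed
    \<comment> \<open>One factor r pays for passing from the larger of |u|, |v| to |u|, which costs
      at most h on r-th powers.\<close>
    moreover have "R ^ 5 * h ^ 3 + R ^ 5 * h ^ 3 \<le> R ^ 6 * h ^ 3"
    proof -
      have "2 * (R ^ 5 * h ^ 3) \<le> R * (R ^ 5 * h ^ 3)" using R h by (intro mult_right_mono) auto
      also have "\<dots> = R ^ 6 * h ^ 3" by (simp add: eval_nat_numeral)
      finally show ?thesis by linarith
    qed
    moreover have "h \<le> 6 * h" using h by simp
    ultimately show ?thesis using large hR unfolding R_def by linarith
  qed
  then have Uh: "6 * h \<le> cmod U" using hR by linarith
  then have U0: "U \<noteq> 0" using h by auto
  then have u0: "u p \<noteq> 0" using r6 by (auto simp: U_def)
  have \<zeta>h: "cmod \<zeta> * cmod U \<le> h" using F U0 by (simp add: \<zeta>_def norm_divide)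
  have "cmod \<zeta> \<le> 1 / 6"
  proof -
    have "cmod \<zeta> \<le> h / cmod U" using \<zeta>h U0 by (simp add: le_divide_eq)
    also have "\<dots> \<le> 1 / 6" using Uh h U0 by (simp add: divide_le_eq)
    finally show ?thesis .
  qed
  have VU: "V / U = 1 + \<zeta>" using UV U0 by (simp add: \<zeta>_def field_simps)
  have ne: "1 + \<zeta> \<noteq> 0"
  proof
    assume "1 + \<zeta> = 0"
    then have "\<zeta> = - 1" by (simp add: add_eq_0_iff)
    then show False using \<open>cmod \<zeta> \<le> 1 / 6\<close> by simp
  qed
  have V0: "V \<noteq> 0" using VU ne by auto
  then have v0: "v p \<noteq> 0" using r6 by (auto simp: V_def)
  define t where "t = Ln (1 + \<zeta>) / of_nat r"
  have t: "cmod t * R \<le> 2 * cmod \<zeta>"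
    using norm_Ln_le[of \<zeta>] \<open>cmod \<zeta> \<le> 1 / 6\<close> r6 by (simp add: t_def norm_divide R_def)
  have "cmod t \<le> 1 / 3"
  proof -
    have "cmod t * 1 \<le> cmod t * R" using R by (intro mult_left_mono) auto
    then show ?thesis using t \<open>cmod \<zeta> \<le> 1 / 6\<close> by linarith
  qed
  then have et: "cmod (exp t - 1) \<le> 3 / 2 * cmod t" by (rule norm_exp_minus_one_le)
  define \<rho> where "\<rho> = exp t * u p / v p"
  have \<rho>v: "\<rho> * v p = exp t * u p" using v0 by (simp add: \<rho>_def)
  have etr: "exp t ^ r = V / U"
    using ne r6 by (simp add: t_def VU flip: exp_of_nat_mult)
  have "\<rho> ^ r = exp t ^ r * U / V"
    by (simp add: \<rho>_def U_def V_def power_divide power_mult_distrib)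
  then have 1: "\<rho> ^ r = 1" using U0 V0 unfolding etr by simp
  have Ur: "cmod U = cmod (u p) * cmod (u p) ^ (r - 1)"
    using r6 by (cases r) (auto simp: U_def norm_mult norm_power)
  have "cmod (\<rho> * v p - u p) * (R * cmod (u p) ^ (r - 1)) = cmod (exp t - 1) * R * cmod U"
  proof -
    have "\<rho> * v p - u p = (exp t - 1) * u p" unfolding \<rho>v by (simp add: algebra_simps)
    then show ?thesis unfolding Ur by (simp add: norm_mult)
  qed
  also have "\<dots> \<le> 3 / 2 * cmod t * R * cmod U"
    using et R by (intro mult_right_mono) auto
  also have "\<dots> = 3 / 2 * (cmod t * R) * cmod U" by simp
  also have "\<dots> \<le> 3 / 2 * (2 * cmod \<zeta>) * cmod U"
    by (intro mult_right_mono mult_left_mono t) auto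
  also have "\<dots> \<le> 3 * h" using \<zeta>h by simp
  finally have 2: "near h \<rho> p" using u0 by (simp add: near_def R_def)
  have 3: "\<exists>\<tau>>0. \<rho> * v p = of_real \<tau> * u p" if "V / U \<in> \<real>"
  proof -
    have "1 + \<zeta> \<in> \<real>" using that VU by simp
    moreover have "Re (1 + \<zeta>) > 0" using abs_Re_le_cmod[of \<zeta>] \<open>cmod \<zeta> \<le> 1 / 6\<close> by simp
    ultimately have "Ln (1 + \<zeta>) \<in> \<real>" by simp
    then have "t \<in> \<real>" unfolding t_def by (intro Reals_divide) auto
    then obtain x where "t = of_real x" by (auto elim: Reals_cases)
    then have "exp t = of_real (exp x)" by (simp add: exp_of_real)
    then show ?thesis unfolding \<rho>v by (intro exI[of _ "exp x"]) simp
  qed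
  show ?thesis
    using \<open>R ^ 5 * h ^ 3 \<le> cmod U\<close> 1 2 3 by (auto simp: U_def V_def R_def norm_power)
qed

section \<open>Positive D\<close>

lemma s_real:
  assumes "D > 0"
  obtains \<sigma> :: real where "s = of_real \<sigma>"
proof -
  have "s\<^sup>2 = (of_real (sqrt (real_of_int D)))\<^sup>2"
    using assms by (simp add: s_square flip: of_real_power)
  then have "s = of_real (sqrt (real_of_int D)) \<or> s = of_real (- sqrt (real_of_int D))"
    by (simp add: power2_eq_iff)
  then show ?thesis using that by blast
qed

lemma power_ratio_real:
  assumes "D > 0"
  shows "v p ^ r / u p ^ r \<in> \<real>"
proof -
  obtain \<sigma> where "s = of_real \<sigma>" using s_real[OF assms] .
  then have "2 * of_nat r * s * u p ^ r \<in> \<real>" "2 * of_nat r * s * v p ^ r \<in> \<real>"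
    unfolding u_power v_power by (auto intro!: Reals_add Reals_diff Reals_mult simp del: of_int_mult)
  then have "(2 * of_nat r * s * v p ^ r) / (2 * of_nat r * s * u p ^ r) \<in> \<real>"
    by (rule Reals_divide[rotated])
  then show ?thesis using s_nonzero r6 by simp
qed

text \<open>For real s the products u(p) v(q) and u(q) v(p) are real multiples of the same \<mu>.
  Hence \<rho>/\<rho>' is real, and it has modulus 1.\<close>

lemma roots_differ_by_sign:
  assumes D: "D > 0" and \<rho>: "\<rho> ^ r = 1" "\<rho>' ^ r = 1" and nz: "u p \<noteq> 0" "u q \<noteq> 0"
    and \<tau>: "\<tau> > 0" "\<rho> * v p = of_real \<tau> * u p" "\<tau>' > 0" "\<rho>' * v q = of_real \<tau>' * u q"
  shows "\<rho> = \<rho>' \<or> \<rho> = - \<rho>'"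
proof -
  obtain \<sigma> where \<sigma>: "s = of_real \<sigma>" using s_real[OF D] .
  have n1: "cmod \<rho> = 1" "cmod \<rho>' = 1"
    using \<rho> by (auto intro: norm_root)
  have "2 * (u p * v q) = \<mu> * of_real (real_of_int (polar p q) + \<sigma> * real_of_int (area p q))"
    "2 * (u q * v p) = \<mu> * of_real (real_of_int (polar p q) - \<sigma> * real_of_int (area p q))"
    using uv_polar[of p q] uv_area[of p q] unfolding j_eq \<sigma> of_real_add of_real_diff of_real_mult of_real_of_int_eq
    by algebra+
  then obtain x y :: real where xy: "2 * (u p * v q) = \<mu> * of_real x" "2 * (u q * v p) = \<mu> * of_real y" by blast
  have "\<rho> * (2 * (u q * v p)) * of_real \<tau>' = of_real \<tau> * (\<rho>' * (2 * (u p * v q)))"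
    using \<tau>(2,4) by algebra
  then have "\<mu> * (\<rho> * of_real (y * \<tau>')) = \<mu> * (\<rho>' * of_real (x * \<tau>))"
    unfolding xy by (simp add: algebra_simps)
  then have e: "\<rho> * of_real (y * \<tau>') = \<rho>' * of_real (x * \<tau>)" using mu_nonzero by simp
  have "y \<noteq> 0"
  proof
    assume "y = 0"
    then have "v p = 0" using xy nz by simp
    then show False using \<tau> nz by simp
  qed
  have "cmod (\<rho> * of_real (y * \<tau>')) = cmod (\<rho>' * of_real (x * \<tau>))" using e by simp
  then have "\<bar>y * \<tau>'\<bar> = \<bar>x * \<tau>\<bar>" by (simp only: norm_mult norm_of_real n1 mult_1_left)
  moreover have "y * \<tau>' \<noteq> 0" using \<open>y \<noteq> 0\<close> \<tau> by simp
  ultimately consider "x * \<tau> = y * \<tau>'" | "x * \<tau> = - (y * \<tau>')" by linarith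
  then show ?thesis
  proof cases
    case 1
    then show ?thesis using e \<open>y * \<tau>' \<noteq> 0\<close> unfolding 1 by (metis mult_right_cancel of_real_eq_0_iff)
  next
    case 2
    have "\<rho> * of_real (y * \<tau>') = (- \<rho>') * of_real (y * \<tau>')" using e unfolding 2 by simp
    then show ?thesis using \<open>y * \<tau>' \<noteq> 0\<close> by (metis mult_right_cancel of_real_eq_0_iff)
  qed
qed

text \<open>At a real point, the equation u = \<rho> v becomes, after multiplication by v(p) and
  division by \<mu>, one real linear equation in two unknowns. A nontrivial solution makes u^r =
  v^r.\<close>

lemma real_zero:
  assumes D: "D > 0" and \<rho>: "\<rho> ^ r = 1" and u: "u p \<noteq> 0"
    and \<tau>: "\<tau> > 0" "\<rho> * v p = of_real \<tau> * u p"
  shows "\<exists>x y :: real. (x, y) \<noteq> (0, 0) \<and> binary_form r a x y = 0"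
proof -
  obtain \<sigma> where \<sigma>: "s = of_real \<sigma>" using s_real[OF D] .
  define x0 y0 where "x0 = real_of_int (fst p)" and "y0 = real_of_int (snd p)"
  define K where "K x y = 2 * real_of_int A * x * x0 + real_of_int B * (x * y0 + x0 * y) +
    2 * real_of_int C * y * y0" for x y :: real
  define d where "d x y = x * y0 - x0 * y" for x y :: real
  \<comment> \<open>K - \<sigma> d and K + \<sigma> d are, up to the factor \<mu>/2, the products
    u(p) Y and X v(p) for the values X, Y of the linear forms at (x, y), so \<open>e x y = 0\<close>
    says \<tau> u(p) Y = v(p) X.\<close>
  define e where "e = (\<lambda>x y. \<tau> * (K x y - \<sigma> * d x y) - (K x y + \<sigma> * d x y))"
  have lin: "e x y = e 1 0 * x + e 0 1 * y" for x y
    by (simp add: e_def K_def d_def algebra_simps)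
  obtain x y where xy: "(x, y) \<noteq> (0, 0)" "e x y = 0"
  proof (cases "e 1 0 = 0 \<and> e 0 1 = 0")
    case True
    then show ?thesis using that[of 1 0] by simp
  next
    case False
    have "e (e 0 1) (- e 1 0) = 0" by (subst lin) simp
    then show ?thesis using that[of "e 0 1" "- e 1 0"] False by auto
  qed
  define X Y where "X = \<alpha> * of_real x + \<beta> * of_real y" and "Y = \<gamma> * of_real x + \<delta> * of_real y"
  have up: "u p = \<alpha> * of_real x0 + \<beta> * of_real y0" "v p = \<gamma> * of_real x0 + \<delta> * of_real y0"
    by (simp_all add: u_def v_def x0_def y0_def)
  have 1: "X * v p + u p * Y = \<mu> * of_real (K x y)"
  proof -
    have "X * v p + u p * Y = 2 * (\<alpha> * \<gamma>) * (of_real x * of_real x0) +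
      (\<alpha> * \<delta> + \<beta> * \<gamma>) * (of_real x * of_real y0 + of_real x0 * of_real y) +
      2 * (\<beta> * \<delta>) * (of_real y * of_real y0)"
      by (simp add: X_def Y_def up algebra_simps)
    then show ?thesis unfolding quad_coeffs K_def by (simp add: algebra_simps)
  qed
  have 2: "X * v p - u p * Y = \<mu> * of_real (\<sigma> * d x y)"
  proof -
    have "X * v p - u p * Y = j * (of_real x * of_real y0 - of_real x0 * of_real y)"
      by (simp add: X_def Y_def up j_def algebra_simps)
    then show ?thesis unfolding j_eq \<sigma> d_def by (simp add: algebra_simps)
  qed
  have "2 * (u p * Y) = \<mu> * of_real (K x y - \<sigma> * d x y)" "2 * (X * v p) = \<mu> * of_real (K x y + \<sigma> * d x y)"
    using 1 2 unfolding of_real_add of_real_diff by algebra+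
  moreover have "of_real \<tau> * complex_of_real (K x y - \<sigma> * d x y) = of_real (K x y + \<sigma> * d x y)"
    using xy(2) unfolding e_def of_real_mult[symmetric] of_real_eq_iff by simp
  ultimately have "of_real \<tau> * (2 * (u p * Y)) = 2 * (X * v p)" by (simp add: mult.left_commute)
  then have "v p * (\<rho> * Y) = v p * X" using \<tau>(2) by algebra
  moreover have "v p \<noteq> 0" using \<tau> u by auto
  ultimately have "X = \<rho> * Y" by simp
  then have "X ^ r = Y ^ r" using \<rho> by (simp add: power_mult_distrib)
  then have "complex_of_real (binary_form r a x y) = 0"
    using diag unfolding of_real_binary_form diagonalization_def X_def Y_def by simp
  then show ?thesis using xy(1) by auto
qed

end

section \<open>Counting\<close>

lemma card_le_fibers:
  assumes fin: "finite S" and fib: "\<And>y. card {x\<in>S. f x = y} \<le> k"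
  shows "card S \<le> k * card (f ` S)"
proof -
  have "S = (\<Union>y\<in>f ` S. {x\<in>S. f x = y})" by auto
  then have "card S \<le> (\<Sum>y\<in>f ` S. card {x\<in>S. f x = y})"
    using card_UN_le[of "f ` S" "\<lambda>y. {x\<in>S. f x = y}"] fin by simp
  also have "\<dots> \<le> (\<Sum>y\<in>f ` S. k)" by (intro sum_mono fib)
  finally show ?thesis by (simp add: mult.commute)
qed

lemma coprime_proportional:
  fixes x y x' y' :: int
  assumes "coprime x y" "coprime x' y'" and e: "x * y' = x' * y"
  shows "(x', y') = (x, y) \<or> (x', y') = (- x, - y)"
proof -
  have "x dvd x' * y" unfolding e[symmetric] by simp
  moreover have "x' dvd x * y'" unfolding e by simp
  ultimately have "x dvd x'" "x' dvd x"
    using assms(1,2) by (simp_all add: coprime_dvd_mult_left_iff)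
  then have x: "\<bar>x\<bar> = \<bar>x'\<bar>" by (rule zdvd_antisym_abs)
  have "y dvd x * y'" unfolding e by simp
  moreover have "y' dvd x' * y" unfolding e[symmetric] by simp
  ultimately have "y dvd y'" "y' dvd y"
    using coprime_dvd_mult_right_iff[of y x y'] coprime_dvd_mult_right_iff[of y' x' y] assms(1,2)
    by (simp_all add: coprime_commute)
  then have y: "\<bar>y\<bar> = \<bar>y'\<bar>" by (rule zdvd_antisym_abs)
  consider "x' = x" "y' = y" | "x' = - x" "y' = - y" | "x' = x" "y' = - y" | "x' = - x" "y' = y"
    using x y by linarith
  then show ?thesis
  proof cases
    case 3
    then have "x * y = 0" using e by simp
    then show ?thesis using 3 by auto
  next
    case 4
    then have "x * y = 0" using e by simp
    then show ?thesis using 4 by auto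
  qed auto
qed

context diagonal_form
begin

lemma count_solutions:
  fixes h :: real
  assumes h: "h \<ge> 1" and J: "(cmod j / 2) ^ r \<ge> real r ^ 13 * h ^ 6"
    and fin: "finite S"
    and sol: "\<And>p. p \<in> S \<Longrightarrow> F p \<noteq> 0 \<and> \<bar>real_of_int (F p)\<bar> \<le> h"
    and area: "\<And>p q. p \<in> S \<Longrightarrow> q \<in> S \<Longrightarrow> p \<noteq> q \<Longrightarrow> area p q \<noteq> 0"
  shows "card S \<le> 2 * r + 1" "D > 0 \<Longrightarrow> card S \<le> 5" "D > 0 \<Longrightarrow> odd r \<Longrightarrow> card S \<le> 3"
    "D > 0 \<Longrightarrow> definite_form r a \<Longrightarrow> card S \<le> 1"
proof -
  have J0: "(1::real) \<le> real r ^ 13 * h ^ 6"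
    using h r6 mult_mono[of 1 "real r ^ 13" 1 "h ^ 6"] by (simp add: one_le_power)
  have J2: "cmod j / 2 \<ge> 1"
  proof (rule ccontr)
    assume "\<not> ?thesis"
    then have "(cmod j / 2) ^ r < 1 ^ r" using r6 by (intro power_strict_mono) auto
    then have "(cmod j / 2) ^ r < 1" by simp
    then show False using J J0 by linarith
  qed
  \<comment> \<open>Without a solution of least height, every remaining one satisfies height^2 >=
    |j|/2 by \<open>height_product\<close>.\<close>
  define S' where "S' = S - {arg_min_on height S}"
  have finS': "finite S'" using fin by (simp add: S'_def)
  have cS: "card S \<le> card S' + 1"
    unfolding S'_def using fin by (simp add: card_Diff_singleton_if) arith
  have large: "height p ^ r \<ge> real r ^ 6 * h ^ 3" if p: "p \<in> S'" for p
  proof -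
    define q where "q = arg_min_on height S"
    have "p \<in> S" "p \<noteq> q" "S \<noteq> {}" using p by (auto simp: S'_def q_def)
    then have "q \<in> S" "height q \<le> height p"
      using fin arg_min_if_finite(1)[of S height] arg_min_least[of S p height] by (auto simp: q_def)
    have hp: "height q \<ge> 0" "height p \<ge> 0" by (auto simp: height_def le_max_iff_disj)
    have "cmod j \<le> 2 * height p * height q"
      using area \<open>p \<in> S\<close> \<open>q \<in> S\<close> \<open>p \<noteq> q\<close> by (intro height_product) auto
    also have "\<dots> \<le> 2 * height p * height p"
      using hp \<open>height q \<le> height p\<close> by (intro mult_left_mono) auto
    finally have "cmod j / 2 \<le> height p ^ 2" by (simp add: power2_eq_square)
    then have "(cmod j / 2) ^ r \<le> (height p ^ 2) ^ r" by (intro power_mono) auto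
    then have "real r ^ 13 * h ^ 6 \<le> (height p ^ r) ^ 2"
      using J unfolding power_mult[symmetric] by (simp only: mult.commute)
    \<comment> \<open>Squaring doubles the exponents 6 and 3 of
      \<open>large_solution\<close>.\<close>
    moreover have "(real r ^ 6 * h ^ 3) ^ 2 \<le> real r ^ 13 * h ^ 6"
    proof -
      have "real r ^ 12 \<le> real r ^ 13" using r6 by (intro power_increasing) auto
      then show ?thesis using h by (simp add: power_mult_distrib mult_right_mono flip: power_mult)
    qed
    ultimately have "(real r ^ 6 * h ^ 3) ^ 2 \<le> (height p ^ r) ^ 2" by linarith
    then show ?thesis by (rule power2_le_imp_le) (simp add: hp)
  qed
  have "\<forall>p\<in>S'. \<exists>\<rho>. cmod (u p) ^ r \<ge> real r ^ 5 * h ^ 3 \<and> \<rho> ^ r = 1 \<and> near h \<rho> p \<and>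
      (v p ^ r / u p ^ r \<in> \<real> \<longrightarrow> (\<exists>\<tau>>0. \<rho> * v p = of_real \<tau> * u p))"
    using large_solution[OF h] large sol by (fastforce simp: S'_def)
  then obtain \<rho> where \<rho>: "\<And>p. p \<in> S' \<Longrightarrow> cmod (u p) ^ r \<ge> real r ^ 5 * h ^ 3 \<and> \<rho> p ^ r = 1 \<and> near h (\<rho> p) p \<and>
      (v p ^ r / u p ^ r \<in> \<real> \<longrightarrow> (\<exists>\<tau>>0. \<rho> p * v p = of_real \<tau> * u p))"
    by metis
  have fiber: "card {p\<in>S'. \<rho> p = z} \<le> 2" for z
  proof (rule ccontr)
    define G where "G = {p\<in>S'. \<rho> p = z}"
    assume "\<not> card {p\<in>S'. \<rho> p = z} \<le> 2"
    then have "3 \<le> card G" by (simp add: G_def)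
    then obtain T where "T \<subseteq> G" "card T = 3" by (rule obtain_subset_with_card_n)
    then obtain p q t where pqt: "T = {p, q, t}" "p \<noteq> q" "q \<noteq> t" "p \<noteq> t" by (auto simp: card_3_iff)
    then have mem: "p \<in> G" "q \<in> G" "t \<in> G" using \<open>T \<subseteq> G\<close> by auto
    have z: "z ^ r = 1" using mem(1) \<rho>[of p] by (auto simp: G_def)
    show False
    proof (rule no_three_near[OF h _ z _ _ mem])
      show "cmod j \<ge> 1" using J2 by linarith
      show "near h z p \<and> F p \<noteq> 0 \<and> cmod (u p) ^ r \<ge> real r ^ 5 * h ^ 3" if "p \<in> G" for p
        using that \<rho>[of p] sol[of p] by (auto simp: G_def S'_def)
      show "area p q \<noteq> 0" if "p \<in> G" "q \<in> G" "p \<noteq> q" for p q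
        using that area by (auto simp: G_def S'_def)
    qed (use pqt in auto)
  qed
  have cS': "card S' \<le> 2 * card (\<rho> ` S')" using finS' fiber by (rule card_le_fibers)
  have "card (\<rho> ` S') \<le> card {z :: complex. z ^ r = 1}"
    using \<rho> r6 by (intro card_mono finite_roots_unity) auto
  also have "\<dots> = r" using r6 by (intro card_roots_unity_eq) auto
  finally show "card S \<le> 2 * r + 1" using cS cS' by linarith
  have signs: "\<rho> p = \<rho> q \<or> \<rho> p = - \<rho> q" if D: "D > 0" and pq: "p \<in> S'" "q \<in> S'" for p q
  proof -
    obtain \<tau> \<tau>' where "\<tau> > 0" "\<rho> p * v p = of_real \<tau> * u p" "\<tau>' > 0" "\<rho> q * v q = of_real \<tau>' * u q"
      using \<rho>[OF pq(1)] \<rho>[OF pq(2)] power_ratio_real[OF D] by blast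
    then show ?thesis
      using roots_differ_by_sign[OF D, of "\<rho> p" "\<rho> q" p q] \<rho>[OF pq(1)] \<rho>[OF pq(2)] by (auto simp: near_def)
  qed
  show "card S \<le> 5" if D: "D > 0"
  proof (cases "S' = {}")
    case False
    then obtain q where "q \<in> S'" by auto
    then have "\<rho> ` S' \<subseteq> {\<rho> q, - \<rho> q}" using signs[OF D] by blast
    then have "card (\<rho> ` S') \<le> card {\<rho> q, - \<rho> q}" by (intro card_mono) auto
    also have "\<dots> \<le> 2" by (simp add: card_insert_if)
    finally show ?thesis using cS cS' by linarith
  qed (use cS in simp)
  show "card S \<le> 3" if D: "D > 0" and r: "odd r"
  proof (cases "S' = {}")
    case False
    then obtain q where q: "q \<in> S'" by auto
    have "\<rho> p = \<rho> q" if p: "p \<in> S'" for p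
    proof (rule ccontr)
      assume "\<rho> p \<noteq> \<rho> q"
      then have "\<rho> p = - \<rho> q" using signs[OF D p q] by simp
      then have "\<rho> p ^ r = - (\<rho> q ^ r)" using r by (simp add: power_minus_odd)
      then show False using \<rho>[OF p] \<rho>[OF q] by simp
    qed
    then have "\<rho> ` S' \<subseteq> {\<rho> q}" by auto
    then have "card (\<rho> ` S') \<le> card {\<rho> q}" by (intro card_mono) auto
    then show ?thesis using cS cS' by simp
  qed (use cS in simp)
  show "card S \<le> 1" if D: "D > 0" and "definite_form r a"
  proof (cases "S' = {}")
    case False
    then obtain q where q: "q \<in> S'" by auto
    obtain \<tau> where \<tau>: "\<tau> > 0" "\<rho> q * v q = of_real \<tau> * u q"
      using \<rho>[OF q] power_ratio_real[OF D] by blast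
    moreover have "\<rho> q ^ r = 1" "u q \<noteq> 0" using \<rho>[OF q] by (simp_all add: near_def)
    ultimately obtain x y :: real where "(x, y) \<noteq> (0, 0)" "binary_form r a x y = 0"
      using real_zero[OF D] by blast
    then show ?thesis using \<open>definite_form r a\<close>
      unfolding definite_form_def by (metis less_irrefl)
  qed (use cS in simp)
qed

text \<open>Formulated for finite subsets: a bound uniform in \<open>T\<close> makes the whole set
  finite, which its cardinality alone would not reveal, being 0 for infinite sets.\<close>

lemma count_pairs:
  assumes h: "h > 0" and J: "(cmod j / 2) ^ r \<ge> real r ^ 13 * real h ^ 6"
    and T: "T \<subseteq> primitive_solution_pairs r a h" "finite T"
  shows "card T \<le> 2 * r + 1" "D > 0 \<Longrightarrow> card T \<le> 5" "D > 0 \<Longrightarrow> odd r \<Longrightarrow> card T \<le> 3"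
    "D > 0 \<Longrightarrow> definite_form r a \<Longrightarrow> card T \<le> 1"
proof -
  have "\<forall>P\<in>T. \<exists>p. P = {p, (- fst p, - snd p)} \<and> coprime (fst p) (snd p) \<and> F p \<noteq> 0 \<and> \<bar>F p\<bar> \<le> int h"
  proof
    fix P assume "P \<in> T"
    then have "P \<in> primitive_solution_pairs r a h" using T(1) by blast
    then obtain x y where "P = {(x, y), (- x, - y)}" "coprime x y"
      "0 < \<bar>binary_form r a x y\<bar>" "\<bar>binary_form r a x y\<bar> \<le> int h"
      unfolding primitive_solution_pairs_def by blast
    then show "\<exists>p. P = {p, (- fst p, - snd p)} \<and> coprime (fst p) (snd p) \<and> F p \<noteq> 0 \<and> \<bar>F p\<bar> \<le> int h"
      by (intro exI[of _ "(x, y)"]) (simp add: F_def)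
  qed
  then obtain f where f: "\<And>P. P \<in> T \<Longrightarrow> P = {f P, (- fst (f P), - snd (f P))} \<and>
      coprime (fst (f P)) (snd (f P)) \<and> F (f P) \<noteq> 0 \<and> \<bar>F (f P)\<bar> \<le> int h"
    by metis
  have inj: "inj_on f T" using f by (metis inj_onI)
  have card: "card (f ` T) = card T" by (rule card_image[OF inj])
  have sol: "F p \<noteq> 0 \<and> \<bar>real_of_int (F p)\<bar> \<le> real h" if "p \<in> f ` T" for p
  proof -
    have "F p \<noteq> 0" "\<bar>F p\<bar> \<le> int h" using that f by auto
    then have "real_of_int \<bar>F p\<bar> \<le> real_of_int (int h)" by (simp only: of_int_le_iff)
    then show ?thesis using \<open>F p \<noteq> 0\<close> by simp
  qed
  \<comment> \<open>Primitive points with zero area are equal or opposite, and opposite points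
    represent the same pair.\<close>
  have area: "area p q \<noteq> 0" if pq: "p \<in> f ` T" "q \<in> f ` T" "p \<noteq> q" for p q
  proof
    assume "area p q = 0"
    obtain P Q where P: "P \<in> T" "p = f P" and Q: "Q \<in> T" "q = f Q" using pq by auto
    have "(fst q, snd q) = (fst p, snd p) \<or> (fst q, snd q) = (- fst p, - snd p)"
      using \<open>area p q = 0\<close> f[OF P(1)] f[OF Q(1)] unfolding P(2) Q(2) area_def
      by (intro coprime_proportional) auto
    then have "q = (- fst p, - snd p)" using pq(3) by (metis prod.collapse)
    then have "P = Q" using f[OF P(1)] f[OF Q(1)] unfolding P(2)[symmetric] Q(2)[symmetric]
      by (simp add: insert_commute)
    then show False using P Q pq(3) by simp
  qed
  have h1: "real h \<ge> 1" using h by simp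
  have fin: "finite (f ` T)" using T(2) by simp
  note count = count_solutions[of "real h" "f ` T", OF h1 J fin sol area, unfolded card]
  show "card T \<le> 2 * r + 1" by (rule count(1))
  show "D > 0 \<Longrightarrow> card T \<le> 5" by (rule count(2))
  show "D > 0 \<Longrightarrow> odd r \<Longrightarrow> card T \<le> 3" by (rule count(3))
  show "D > 0 \<Longrightarrow> definite_form r a \<Longrightarrow> card T \<le> 1" by (rule count(4))
qed

end

section \<open>From the discriminant to the determinant\<close>

text \<open>Because 0 < r^2 - 5r - 2 is at most r^2 and at most r^2 - r + 2, the two exponents are
  at least 13 (r-1) and 4 (r-1). Since \<Delta>' is (J/2)^(r(r-1)) / h^(2(r-1)), an (r-1)-th root
  gives the exponents 13 and 4 + 2.\<close>

lemma j_lower_bound: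
  fixes r h :: nat
  assumes r: "r \<ge> 6" and h: "h > 0" and J: "J \<ge> 0"
    and \<Delta>: "\<Delta>' = (real r ^ r * J ^ (r * (r - 1))) / (2 ^ (r\<^sup>2 - r) * real r ^ r * real h ^ (2 * r - 2))"
    and large: "\<Delta>' \<ge>
      real r powr (13 * (real r)\<^sup>2 * (real r - 1) / ((real r)\<^sup>2 - 5 * real r - 2)) *
      real h powr (4 * (real r - 1) * ((real r)\<^sup>2 - real r + 2) / ((real r)\<^sup>2 - 5 * real r - 2))"
  shows "(J / 2) ^ r \<ge> real r ^ 13 * real h ^ 6"
proof -
  define b where "b = r - 1"
  have rb: "real r - 1 = real b" using r by (simp add: b_def)
  have b0: "real b \<ge> 0" by simp
  define E where "E = (real r)\<^sup>2 - 5 * real r - 2"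
  have "real r \<ge> 6" using r by simp
  then have "real r * real r \<ge> 6 * real r" by (intro mult_right_mono) auto
  then have E: "E > 0" "E \<le> (real r)\<^sup>2" "E \<le> (real r)\<^sup>2 - real r + 2"
    using \<open>real r \<ge> 6\<close> unfolding E_def power2_eq_square by linarith+
  have r1: "real r powr (13 * (real r)\<^sup>2 * (real r - 1) / E) \<ge> (real r ^ 13) ^ b"
  proof -
    have "13 * real b * E \<le> 13 * real b * (real r)\<^sup>2" using E by (intro mult_left_mono) auto
    then have "real (13 * b) \<le> 13 * (real r)\<^sup>2 * real b / E" using E by (simp add: le_divide_eq mult_ac)
    then have "real r powr real (13 * b) \<le> real r powr (13 * (real r)\<^sup>2 * (real r - 1) / E)"
      using r unfolding rb by (intro powr_mono) auto
    also have "real r powr real (13 * b) = (real r ^ 13) ^ b"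
      using r by (subst powr_realpow) (simp_all add: power_mult)
    finally show ?thesis .
  qed
  have h1: "real h powr (4 * (real r - 1) * ((real r)\<^sup>2 - real r + 2) / E) \<ge> (real h ^ 4) ^ b"
  proof -
    have "4 * real b * E \<le> 4 * real b * ((real r)\<^sup>2 - real r + 2)" using E by (intro mult_left_mono) auto
    then have "real (4 * b) \<le> 4 * real b * ((real r)\<^sup>2 - real r + 2) / E" using E by (simp add: le_divide_eq)
    then have "real h powr real (4 * b) \<le> real h powr (4 * (real r - 1) * ((real r)\<^sup>2 - real r + 2) / E)"
      using h unfolding rb by (intro powr_mono) auto
    also have "real h powr real (4 * b) = (real h ^ 4) ^ b"
      using h by (subst powr_realpow) (simp_all add: power_mult)
    finally show ?thesis .
  qed
  have "(real r ^ 13) ^ b * (real h ^ 4) ^ b \<le> \<Delta>'"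
    using large mult_mono[OF r1 h1] unfolding E_def by simp
  moreover have "\<Delta>' = ((J / 2) ^ r) ^ b / (real h ^ 2) ^ b"
  proof -
    have "r\<^sup>2 - r = r * b" "2 * r - 2 = 2 * b" using r by (simp_all add: b_def power2_eq_square algebra_simps)
    then have "\<Delta>' = J ^ (r * b) / (2 ^ (r * b) * real h ^ (2 * b))"
      using r unfolding \<Delta> b_def[symmetric] by simp
    then show ?thesis by (simp add: power_mult power_divide)
  qed
  ultimately have "(real r ^ 13) ^ b * (real h ^ 4) ^ b * (real h ^ 2) ^ b \<le> ((J / 2) ^ r) ^ b"
    using h by (simp add: le_divide_eq)
  moreover have "(real r ^ 13 * real h ^ 6) ^ b = (real r ^ 13) ^ b * (real h ^ 4) ^ b * (real h ^ 2) ^ b"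
    by (simp add: power_mult_distrib flip: power_add power_mult)
  ultimately have "(real r ^ 13 * real h ^ 6) ^ b \<le> ((J / 2) ^ r) ^ b" by simp
  moreover have "b = Suc (b - 1)" using r by (simp add: b_def)
  ultimately show ?thesis using J by (metis power_le_imp_le_base zero_le_divide_iff zero_le_numeral zero_le_power)
qed

theorem theorem1p3:
  fixes r h :: nat and a :: "nat \<Rightarrow> int" and A B C D :: int and \<Delta>' :: real
  assumes "r \<ge> 6" and "h > 0"
    and "diagonalizable r a"
    and "diagonal_quadratic r a A B C"
    and "D = B\<^sup>2 - 4 * A * C"
    and "\<Delta>' = cmod (form_discriminant r a) /
      (2 ^ (r\<^sup>2 - r) * real r ^ r * real h ^ (2 * r - 2))"
    and "\<Delta>' \<ge>
      real r powr (13 * (real r)\<^sup>2 * (real r - 1) / ((real r)\<^sup>2 - 5 * real r - 2)) *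
      real h powr (4 * (real r - 1) * ((real r)\<^sup>2 - real r + 2) / ((real r)\<^sup>2 - 5 * real r - 2))"
  shows "finite (primitive_solution_pairs r a h) \<and>
    (D < 0 \<longrightarrow> N_F r a h \<le> 2 * r + 1) \<and>
    (D > 0 \<and> even r \<and> indefinite_form r a \<longrightarrow> N_F r a h \<le> 5) \<and>
    (D > 0 \<and> odd r \<and> indefinite_form r a \<longrightarrow> N_F r a h \<le> 3) \<and>
    (D > 0 \<and> definite_form r a \<longrightarrow> N_F r a h \<le> 1)"
proof -
  obtain \<alpha> \<beta> \<gamma> \<delta> \<mu> where diag: "diagonalization r a \<alpha> \<beta> \<gamma> \<delta>"
    and quad: "\<And>x y. (\<alpha> * x + \<beta> * y) * (\<gamma> * x + \<delta> * y) =
           \<mu> * (of_int A * x\<^sup>2 + of_int B * x * y + of_int C * y\<^sup>2)"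
    using assms(4) unfolding diagonal_quadratic_def by blast
  \<comment> \<open>The given A, B, C may have a common factor, which is moved into \<mu>. It is
    nonzero, since otherwise the product of the two linear forms would vanish identically.\<close>
  define g where "g = gcd A (gcd B C)"
  have "g \<noteq> 0"
  proof
    assume "g = 0"
    then have "A = 0" "B = 0" "C = 0" by (auto simp: g_def)
    then have z: "(\<alpha> * x + \<beta> * y) * (\<gamma> * x + \<delta> * y) = 0" for x y using quad by simp
    have "\<alpha> * \<gamma> = 0" "\<beta> * \<delta> = 0" "(\<alpha> + \<beta>) * (\<gamma> + \<delta>) = 0" using z[of 1 0] z[of 0 1] z[of 1 1] by auto
    then have "(\<alpha> * \<delta> - \<beta> * \<gamma>)\<^sup>2 = 0" by algebra
    then show False using diag by (simp add: diagonalization_def)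
  qed
  define A' B' C' where "A' = A div g" and "B' = B div g" and "C' = C div g"
  have ABC: "A = g * A'" "B = g * B'" "C = g * C'"
    unfolding A'_def B'_def C'_def
    by (metis g_def dvd_mult_div_cancel dvd_trans gcd_dvd1 gcd_dvd2)+
  have "gcd A' (gcd B' C') = 1"
  proof -
    have "g = \<bar>g\<bar> * gcd A' (gcd B' C')"
      by (metis ABC abs_gcd_int g_def gcd_mult_distrib_int)
    moreover have "g \<ge> 0" by (simp add: g_def)
    ultimately show ?thesis using \<open>g \<noteq> 0\<close> by simp
  qed
  then interpret diagonal_form r a \<alpha> \<beta> \<gamma> \<delta> "\<mu> * of_int g" A' B' C'
  proof unfold_locales
    show "(\<alpha> * x + \<beta> * y) * (\<gamma> * x + \<delta> * y) =
        \<mu> * of_int g * (of_int A' * x\<^sup>2 + of_int B' * x * y + of_int C' * y\<^sup>2)" for x y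
      unfolding quad ABC by (simp add: algebra_simps)
  qed (use assms(1) diag in auto)
  \<comment> \<open>Removing the content divides D by a nonzero square and keeps its sign.\<close>
  have "D = g\<^sup>2 * diagonal_form.D A' B' C'"
    unfolding assms(5) D_def ABC by (simp add: algebra_simps power2_eq_square)
  then have Dpos: "diagonal_form.D A' B' C' > 0" if "D > 0"
    using that by (simp add: zero_less_mult_iff)
  have J: "(cmod j / 2) ^ r \<ge> real r ^ 13 * real h ^ 6"
  proof (rule j_lower_bound[OF assms(1,2) norm_ge_zero _ assms(7)])
    show "\<Delta>' = real r ^ r * cmod j ^ (r * (r - 1)) /
        (2 ^ (r\<^sup>2 - r) * real r ^ r * real h ^ (2 * r - 2))"
      unfolding assms(6) j_def using assms(1) by (subst diagonal_discriminant[OF _ diag]) auto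
  qed
  note count = count_pairs[OF assms(2) J]
  \<comment> \<open>Finiteness and the bound on \<open>N_F\<close> come together from the uniform
    bound on finite subsets.\<close>
  have bounded: "finite (primitive_solution_pairs r a h) \<and> N_F r a h \<le> k"
    if "\<And>T. T \<subseteq> primitive_solution_pairs r a h \<Longrightarrow> finite T \<Longrightarrow> card T \<le> k" for k
    unfolding N_F_def using that by (rule finite_if_finite_subsets_card_bdd)
  show ?thesis
    using bounded[OF count(1)] bounded[OF count(2)[OF _ _ Dpos]] bounded[OF count(3)[OF _ _ Dpos]]
      bounded[OF count(4)[OF _ _ Dpos]] by blast
qed

end
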